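(* For every $y>1$ and every real $x$ there is a $c=O(y\log(n(1+|x|)y))$ such that there is a fully polynomial randomized approximation scheme (FPRAS) for $T(G;x,y)$ on $n$-vertex graphs $G$ of edge-connectivity greater than $c$.
   Context: $T(G;x,y)$ is the Tutte polynomial of the undirected (multi)graph $G=(V,E)$: for connected $G$, $T(G;x,y)=\sum_{A\subseteq E}(x-1)^{\kappa(A)-1}(y-1)^{|A|+\kappa(A)-n}$, where $\kappa(A)$ is the number of connected components of $(V,A)$ and $0^0=1$. The edge-connectivity of $G$ is the minimum number of edges crossing a partition of $V$ into two nonempty groups. An FPRAS for a quantity is a randomized algorithm that, given the input and $\epsilon>0$, runs in time polynomial in the input size and $1/\epsilon$ and returns, with probability at least $3/4$, an estimate with relative error at most $\epsilon$. *)

theory Defs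
  imports "HOL-Probability.SPMF" "HOL-Library.Landau_Symbols" "HOL-Library.Log_Nat"
begin

section \<open>Multigraphs and the Tutte polynomial\<close>

text \<open>
  A finite undirected multigraph has vertex set \<open>{..<nverts G}\<close>; its edges are the indices of
  \<open>edges G\<close>, so parallel edges are distinct. Loops are allowed, and the order of the two endpoints
  in a pair is immaterial.
\<close>

record multigraph =
  nverts :: nat
  edges :: "(nat \<times> nat) list"

definition verts :: "multigraph \<Rightarrow> nat set" where
  "verts G = {..<nverts G}"

definition edge_ids :: "multigraph \<Rightarrow> nat set" where
  "edge_ids G = {..<length (edges G)}"

definition wf_multigraph :: "multigraph \<Rightarrow> bool" where
  "wf_multigraph G \<longleftrightarrow> nverts G > 0 \<and> set (edges G) \<subseteq> verts G \<times> verts G"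

definition connected_rel :: "multigraph \<Rightarrow> nat set \<Rightarrow> (nat \<times> nat) set" where
  "connected_rel G A =
     (let R = (\<lambda>i. edges G ! i) ` A in (R \<union> R\<inverse>)\<^sup>* \<inter> verts G \<times> verts G)"

definition num_components :: "multigraph \<Rightarrow> nat set \<Rightarrow> nat" where
  "num_components G A = card (verts G // connected_rel G A)"

text \<open>
  The exponents are never truncated on well-formed graphs. For connected \<open>G\<close> the exponent of
  \<open>x - 1\<close> is \<open>num_components G A - 1\<close>. The convention \<open>0 ^ 0 = 1\<close> is that of the library.
\<close>

definition tutte :: "multigraph \<Rightarrow> real \<Rightarrow> real \<Rightarrow> real" where
  "tutte G x y =
     (\<Sum>A\<in>Pow (edge_ids G).
        (x - 1) ^ (num_components G A - num_components G (edge_ids G)) *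
        (y - 1) ^ (card A + num_components G A - nverts G))"

definition cut_edges :: "multigraph \<Rightarrow> nat set \<Rightarrow> nat set" where
  "cut_edges G S = {i \<in> edge_ids G. (fst (edges G ! i) \<in> S) \<noteq> (snd (edges G ! i) \<in> S)}"

text \<open>
  The minimum is taken in \<^typ>\<open>enat\<close>: a one-vertex graph has no cut and edge-connectivity
  \<open>\<infinity>\<close>.
\<close>

definition edge_connectivity :: "multigraph \<Rightarrow> enat" where
  "edge_connectivity G =
     (INF S\<in>{S. S \<subseteq> verts G \<and> S \<noteq> {} \<and> S \<noteq> verts G}. enat (card (cut_edges G S)))"


section \<open>Randomized computation with bit costs\<close>

text \<open>
  Randomized algorithms are programs of a random access machine with logarithmic cost, written as
  while programs over an integer-addressed memory of integers. Every evaluated subexpression,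
  addresses included, is charged its bit length, so running times agree with those of Turing
  machines up to a polynomial. Division rounds down, and \<open>a div 0 = 0\<close>.

  Programs may depend on real parameters \<open>\<rho> i\<close>, which need not be rational or computable. As in
  computable analysis, a program only sees binary approximations: \<open>Approx i e\<close> yields
  \<open>\<lfloor>\<rho> i * 2 ^ k\<rfloor>\<close> at a cost of at least \<open>k\<close>, where \<open>k\<close> is the value of \<open>e\<close>.
\<close>

type_synonym memory = "int \<Rightarrow> int"

datatype iexp =
    Num int
  | Mem iexp
  | Add iexp iexp
  | Sub iexp iexp
  | Mul iexp iexp
  | Div iexp iexp
  | Approx nat iexp

primrec ival :: "(nat \<Rightarrow> real) \<Rightarrow> iexp \<Rightarrow> memory \<Rightarrow> int" where
  "ival \<rho> (Num k) s = k"
| "ival \<rho> (Mem e) s = s (ival \<rho> e s)"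
| "ival \<rho> (Add e f) s = ival \<rho> e s + ival \<rho> f s"
| "ival \<rho> (Sub e f) s = ival \<rho> e s - ival \<rho> f s"
| "ival \<rho> (Mul e f) s = ival \<rho> e s * ival \<rho> f s"
| "ival \<rho> (Div e f) s = ival \<rho> e s div ival \<rho> f s"
| "ival \<rho> (Approx i e) s = \<lfloor>\<rho> i * 2 ^ nat (ival \<rho> e s)\<rfloor>"

definition bit_length :: "int \<Rightarrow> nat" where
  "bit_length k = floorlog 2 (nat \<bar>k\<bar>)"

primrec icost :: "(nat \<Rightarrow> real) \<Rightarrow> iexp \<Rightarrow> memory \<Rightarrow> nat" where
  "icost \<rho> (Num k) s = 1 + bit_length k"
| "icost \<rho> (Mem e) s = 1 + bit_length (ival \<rho> (Mem e) s) + icost \<rho> e s"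
| "icost \<rho> (Add e f) s = 1 + bit_length (ival \<rho> (Add e f) s) + icost \<rho> e s + icost \<rho> f s"
| "icost \<rho> (Sub e f) s = 1 + bit_length (ival \<rho> (Sub e f) s) + icost \<rho> e s + icost \<rho> f s"
| "icost \<rho> (Mul e f) s = 1 + bit_length (ival \<rho> (Mul e f) s) + icost \<rho> e s + icost \<rho> f s"
| "icost \<rho> (Div e f) s = 1 + bit_length (ival \<rho> (Div e f) s) + icost \<rho> e s + icost \<rho> f s"
| "icost \<rho> (Approx i e) s =
     1 + bit_length (ival \<rho> (Approx i e) s) + nat (ival \<rho> e s) + icost \<rho> e s"

text \<open>
  \<open>Assign a e\<close> stores the value of \<open>e\<close> at the address given by \<open>a\<close>; \<open>Flip a\<close> stores a fair random
  bit there. The tests of \<open>If\<close> and \<open>While\<close> succeed if the value is positive.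
\<close>

datatype prog =
    Skip
  | Assign iexp iexp
  | Flip iexp
  | Seq prog prog
  | If iexp prog prog
  | While iexp prog

partial_function (spmf) while_spmf ::
  "(memory \<Rightarrow> bool) \<Rightarrow> (memory \<Rightarrow> nat) \<Rightarrow> (memory \<Rightarrow> (memory \<times> nat) spmf) \<Rightarrow>
     memory \<Rightarrow> (memory \<times> nat) spmf"
where
  "while_spmf b w body s =
     (if b s then
        bind_spmf (body s) (\<lambda>(s', t).
        bind_spmf (while_spmf b w body s') (\<lambda>(s'', t').
        return_spmf (s'', w s + t + t')))
      else return_spmf (s, w s))"

text \<open>
  The joint distribution of final memory and running time; the missing mass is the probability of
  divergence.
\<close>

primrec exec :: "(nat \<Rightarrow> real) \<Rightarrow> prog \<Rightarrow> memory \<Rightarrow> (memory \<times> nat) spmf" where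
  "exec \<rho> Skip s = return_spmf (s, 1)"
| "exec \<rho> (Assign a e) s =
     return_spmf (s(ival \<rho> a s := ival \<rho> e s), 1 + icost \<rho> a s + icost \<rho> e s)"
| "exec \<rho> (Flip a) s =
     map_spmf (\<lambda>b. (s(ival \<rho> a s := of_bool b), 1 + icost \<rho> a s)) coin_spmf"
| "exec \<rho> (Seq P Q) s =
     bind_spmf (exec \<rho> P s) (\<lambda>(s', t).
     bind_spmf (exec \<rho> Q s') (\<lambda>(s'', t').
     return_spmf (s'', 1 + t + t')))"
| "exec \<rho> (If e P Q) s =
     map_spmf (\<lambda>(s', t). (s', 1 + icost \<rho> e s + t))
       (if ival \<rho> e s > 0 then exec \<rho> P s else exec \<rho> Q s)"
| "exec \<rho> (While e P) s =
     while_spmf (\<lambda>s. ival \<rho> e s > 0) (\<lambda>s. 1 + icost \<rho> e s) (exec \<rho> P) s"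


section \<open>Approximation schemes\<close>

text \<open>
  The input is a graph together with a positive rational error bound \<open>\<epsilon> = p / q\<close>, stored
  consecutively from address 0; all other cells are 0. Edges are listed one by one, so a graph
  contributes the number of its vertices and edges to the input size, and \<open>p\<close> and \<open>q\<close>
  contribute their bit lengths.
\<close>

definition input_mem :: "multigraph \<Rightarrow> nat \<Rightarrow> nat \<Rightarrow> memory" where
  "input_mem G p q =
     (let ws = [nverts G, length (edges G), p, q] @ concat (map (\<lambda>(u, v). [u, v]) (edges G))
      in (\<lambda>a. if 0 \<le> a \<and> nat a < length ws then int (ws ! nat a) else 0))"

definition input_size :: "multigraph \<Rightarrow> nat \<Rightarrow> nat \<Rightarrow> nat" where
  "input_size G p q =
     nverts G + length (edges G) + bit_length (int p) + bit_length (int q)"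

text \<open>The output is the rational number with numerator in cell 0 and denominator in cell 1.\<close>

definition outcome :: "memory \<Rightarrow> real" where
  "outcome s = of_int (s 0) / of_int (s 1)"

text \<open>
  Since \<open>exec \<rho> P s\<close> is a lossless discrete distribution, a bound on its support bounds the running
  time for all outcomes of the coin flips.
\<close>

definition is_fpras ::
  "(nat \<Rightarrow> real) \<Rightarrow> prog \<Rightarrow> multigraph set \<Rightarrow> (multigraph \<Rightarrow> real) \<Rightarrow> bool"
where
  "is_fpras \<rho> P \<G> f \<longleftrightarrow>
     (\<exists>C d :: nat. \<forall>G\<in>\<G>. \<forall>p>0. \<forall>q>0.
        let \<epsilon> = real p / real q; D = exec \<rho> P (input_mem G p q) in
          lossless_spmf D \<and>
          (\<forall>(s, t)\<in>set_spmf D. real t \<le> real C * (real (input_size G p q) + 1 / \<epsilon>) ^ d) \<and>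
          measure (measure_spmf D) {(s, t). \<bar>outcome s - f G\<bar> \<le> \<epsilon> * \<bar>f G\<bar>} \<ge> 3 / 4)"

definition has_fpras ::
  "(nat \<Rightarrow> real) \<Rightarrow> multigraph set \<Rightarrow> (multigraph \<Rightarrow> real) \<Rightarrow> bool"
where
  "has_fpras \<rho> \<G> f \<longleftrightarrow> (\<exists>P. is_fpras \<rho> P \<G> f)"

end

theory Submission
  imports Defs
begin

text \<open>
  For \<open>y > 1\<close> and connected \<open>G\<close> with \<open>m\<close> edges, let every edge fail independently with probability
  \<open>q = 1 / y\<close>, let \<open>\<kappa>\<close> be the number of components of the surviving graph, and put
  \<open>Q = (x - 1) (y - 1)\<close>. Then \<open>T(G; x, y) = y ^ m / (y - 1) ^ (n - 1)\<close> times the mean of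
  \<open>Q ^ (\<kappa> - 1)\<close>. If every cut has at least \<open>c\<close> edges, then the mean of \<open>Z ^ (\<kappa> - 1)\<close> is at most
  \<open>(1 + (Z - 1) q powr (c / 2)) ^ (n - 1)\<close> for \<open>Z \<ge> 1\<close>, which is at most \<open>3 / 2\<close> for the relevant
  \<open>Z\<close> when \<open>c\<close> is of order \<open>log (n (1 + \<bar>x\<bar>) y) / log y\<close>. So \<open>Q ^ (\<kappa> - 1)\<close> has mean at least
  \<open>1 / 2\<close> and bounded second moment, and by Chebyshev's inequality the average of \<open>512 k\<^sup>2\<close> samples is
  accurate to \<open>1 / k\<close>, where \<open>k \<ge> 1 / \<epsilon>\<close>. The program samples at rational \<open>x'\<close> and \<open>y' \<ge> y\<close> with
  dyadic \<open>x'\<close> and \<open>1 / y'\<close>, close enough to \<open>x\<close> and \<open>y\<close> that a Lipschitz bound on the Tutte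
  polynomial suffices.
\<close>

section \<open>Components and cuts\<close>

text \<open>The obstacle is cancellation: for x < 1 the base Q is negative, and the mean of Q ^
  (\<kappa> - 1) might be close to 0. It is kept near 1 by comparison with a base W^2, where W \<ge>
  \<bar>Q\<bar> + 2: the outcome \<kappa> = 1 causes no deviation at all, and any other one at most
  W ^ (2 (\<kappa> - 1)) - 1. A single estimate at the base W^2 therefore controls both moments.
  That estimate comes from a differential inequality in the failure probability, without enumerating
  small cuts. The lower bound on T that follows is also what permits rounding: the Lipschitz
  constant of T is exponential in n + m, which polynomially many bits of precision absorb once T is
  bounded below. Rounding is one-sided, y' \<ge> y, so that the failure probability stays at most 1
  / y and the moment bounds hold at the rounded point too. Since 1 / y' is dyadic, an edge is
  decided by a fixed number of fair bits. The constant 512 leaves room in Chebyshev's inequality: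
  with second moment 3 / 2 and deviation 1 / (8 k), N samples fail with probability at most 96 k^2 /
  N = 3 / 16.\<close>

lemma connected_rel_equiv: "equiv (verts G) (connected_rel G A)"
proof -
  let ?R = "(\<lambda>i. edges G ! i) ` A"
  have "sym ((?R \<union> ?R\<inverse>)\<^sup>*)" by (rule sym_rtrancl) (auto simp: sym_def)
  then show ?thesis
    unfolding connected_rel_def Let_def
    by (auto intro!: equivI simp: refl_on_def sym_def trans_def dest: rtrancl_trans)
qed

lemma edge_in_verts:
  assumes "wf_multigraph G" "i \<in> edge_ids G"
  shows "fst (edges G ! i) \<in> verts G" "snd (edges G ! i) \<in> verts G"
proof -
  have "edges G ! i \<in> set (edges G)" using assms(2) by (simp add: edge_ids_def)
  then have "edges G ! i \<in> verts G \<times> verts G" using assms(1) by (auto simp: wf_multigraph_def)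
  then show "fst (edges G ! i) \<in> verts G" "snd (edges G ! i) \<in> verts G" by auto
qed

lemma connected_rel_empty: "connected_rel G {} = Id_on (verts G)"
  by (auto simp: connected_rel_def)

text \<open>A path can be shortened until it uses the new edge at most once, so the two directions
  of travel give the only new connections.\<close>

lemma connected_rel_insert:
  assumes "wf_multigraph G" "i \<in> edge_ids G"
  defines "u \<equiv> fst (edges G ! i)" and "v \<equiv> snd (edges G ! i)"
  shows "(a, b) \<in> connected_rel G (insert i A) \<longleftrightarrow>
    (a, b) \<in> connected_rel G A \<or>
    (a, u) \<in> connected_rel G A \<and> (v, b) \<in> connected_rel G A \<or>
    (a, v) \<in> connected_rel G A \<and> (u, b) \<in> connected_rel G A"
proof -
  define R where "R = (\<lambda>i. edges G ! i) ` A"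
  define S where "S = (R \<union> R\<inverse>)\<^sup>*"
  have uv: "u \<in> verts G" "v \<in> verts G" using edge_in_verts[OF assms(1,2)] by (auto simp: u_def v_def)
  have e: "edges G ! i = (u, v)" by (simp add: u_def v_def)
  have eq: "connected_rel G A = S \<inter> verts G \<times> verts G" by (simp add: connected_rel_def S_def R_def)
  \<comment> \<open>An undirected edge amounts to two insertions into the symmetrised relation, so
    \<open>rtrancl_insert\<close> is applied twice; the combinations that use both orientations
    collapse because \<open>S\<close> is an equivalence.\<close>
  have "(insert (u,v) R \<union> (insert (u,v) R)\<inverse>) = insert (u,v) (insert (v,u) (R \<union> R\<inverse>))" by auto
  then have eq': "connected_rel G (insert i A) =
      (insert (u,v) (insert (v,u) (R \<union> R\<inverse>)))\<^sup>* \<inter> verts G \<times> verts G"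
    by (simp add: connected_rel_def R_def e)
  have tr: "(a, c) \<in> S" if "(a, b) \<in> S" "(b, c) \<in> S" for a b c
    using that unfolding S_def by (rule rtrancl_trans)
  have rf: "(a, a) \<in> S" for a by (simp add: S_def)
  have "sym S" unfolding S_def by (rule sym_rtrancl) (auto simp: sym_def)
  then have sy: "(b, a) \<in> S" if "(a, b) \<in> S" for a b using that by (auto simp: sym_def)
  show ?thesis unfolding eq eq' rtrancl_insert S_def[symmetric]
    using uv rf by (auto intro: tr sy)
qed

text \<open>Any labelling whose fibres are the components will do. The program keeps numbers as
  labels and overwrites them when components merge, while the counting arguments take the classes
  themselves; hence the type variable.\<close>

definition component_labels :: "multigraph \<Rightarrow> nat set \<Rightarrow> (nat \<Rightarrow> 'a) \<Rightarrow> bool" where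
  "component_labels G A l \<longleftrightarrow>
     (\<forall>a\<in>verts G. \<forall>b\<in>verts G. (a, b) \<in> connected_rel G A \<longleftrightarrow> l a = l b)"

lemma component_labels_class: "component_labels G A (\<lambda>a. connected_rel G A `` {a})"
  unfolding component_labels_def using eq_equiv_class_iff[OF connected_rel_equiv] by blast

lemma num_components_labels:
  assumes "component_labels G A l"
  shows "num_components G A = card (l ` verts G)"
proof -
  let ?r = "connected_rel G A"
  have eq: "?r `` {a} = ?r `` {b} \<longleftrightarrow> l a = l b" if "a \<in> verts G" "b \<in> verts G" for a b
    using assms that eq_equiv_class_iff[OF connected_rel_equiv[of G A]]
    unfolding component_labels_def by metis
  have im: "verts G // ?r = (\<lambda>a. ?r `` {a}) ` verts G" by (auto simp: quotient_def)
  define g where "g = (\<lambda>a. l (inv_into (verts G) (\<lambda>a. ?r `` {a}) a))"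
  have g: "g (?r `` {a}) = l a" if "a \<in> verts G" for a
    using eq that f_inv_into_f[of "?r `` {a}" "\<lambda>a. ?r `` {a}" "verts G"]
      inv_into_into[of "?r `` {a}" "\<lambda>a. ?r `` {a}" "verts G"]
    unfolding g_def by blast
  have "bij_betw g (verts G // ?r) (l ` verts G)"
    unfolding bij_betw_def inj_on_def im using g eq by (auto simp: image_image)
  then show ?thesis unfolding num_components_def by (rule bij_betw_same_card)
qed

lemma component_labels_empty: "component_labels G {} (\<lambda>a. a)"
  by (auto simp: component_labels_def connected_rel_empty)

text \<open>This is the update carried out by \<open>p_relabel\<close>. It is the identity if the
  two ends already carry the same label.\<close>

lemma component_labels_insert:
  assumes wf: "wf_multigraph G" "i \<in> edge_ids G" and l: "component_labels G A l"
  defines "u \<equiv> fst (edges G ! i)" and "v \<equiv> snd (edges G ! i)"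
  shows "component_labels G (insert i A) (\<lambda>w. if l w = l u then l v else l w)"
proof -
  have uv: "u \<in> verts G" "v \<in> verts G" using edge_in_verts[OF wf] by (auto simp: u_def v_def)
  then show ?thesis
    using l unfolding component_labels_def connected_rel_insert[OF wf, folded u_def v_def] by auto
qed

lemma finite_verts [simp]: "finite (verts G)" by (simp add: verts_def)
lemma finite_edge_ids [simp]: "finite (edge_ids G)" by (simp add: edge_ids_def)

text \<open>If the ends have different labels, the merge removes exactly the label of
  \<open>u\<close> from those in use, since \<open>v\<close> still holds its own.\<close>

lemma num_components_insert:
  assumes wf: "wf_multigraph G" "i \<in> edge_ids G" and l: "component_labels G A l"
  shows "num_components G A = num_components G (insert i A) +
    (if l (fst (edges G ! i)) = l (snd (edges G ! i)) then 0 else 1)"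
proof -
  define u v where "u = fst (edges G ! i)" and "v = snd (edges G ! i)"
  let ?l = "\<lambda>w. if l w = l u then l v else l w"
  have uv: "u \<in> verts G" "v \<in> verts G" using edge_in_verts[OF wf] by (auto simp: u_def v_def)
  have 1: "num_components G (insert i A) = card (?l ` verts G)"
    using num_components_labels[OF component_labels_insert[OF wf l]] by (simp add: u_def v_def)
  show ?thesis
  proof (cases "l u = l v")
    case True
    then have "?l = l" by auto
    then have "num_components G (insert i A) = card (l ` verts G)" using 1 by (simp only:)
    then show ?thesis using True num_components_labels[OF l] by (simp add: u_def v_def)
  next
    case False
    have "?l ` verts G = l ` verts G - {l u}" using uv False by force
    moreover have "card (l ` verts G) = Suc (card (l ` verts G - {l u}))"
      by (rule card.remove) (use uv in auto)
    ultimately show ?thesis using 1 False num_components_labels[OF l] by (simp add: u_def v_def)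
  qed
qed

lemma num_components_empty: "num_components G {} = nverts G"
  using num_components_labels[OF component_labels_empty] by (simp add: verts_def)

lemma num_components_pos:
  assumes "wf_multigraph G"
  shows "num_components G A \<ge> 1"
proof -
  have "verts G \<noteq> {}" using assms by (auto simp: wf_multigraph_def verts_def)
  then have "card ((\<lambda>a. connected_rel G A `` {a}) ` verts G) > 0" by (simp add: card_gt_0_iff)
  then show ?thesis using num_components_labels[OF component_labels_class, of G A] by simp
qed

lemma num_components_le: "num_components G A \<le> nverts G"
  using num_components_labels[OF component_labels_class, of G A]
    card_image_le[OF finite_verts, of "\<lambda>a. connected_rel G A `` {a}" G] by (simp add: verts_def)

text \<open>There are \<open>nverts G\<close> components without edges, and every edge removes at
  most one. Hence the exponent of y - 1 in \<open>tutte\<close> is a true difference of natural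
  numbers.\<close>

lemma num_components_card_ge:
  assumes "wf_multigraph G" "A \<subseteq> edge_ids G"
  shows "nverts G \<le> card A + num_components G A"
proof -
  have "finite A" using assms(2) finite_edge_ids finite_subset by blast
  then show ?thesis using assms(2)
  proof (induction A)
    case empty
    then show ?case by (simp add: num_components_empty)
  next
    case (insert i A)
    have "num_components G A \<le> num_components G (insert i A) + 1"
      using num_components_insert[OF assms(1) _ component_labels_class, of i A] insert.prems
      by (auto split: if_splits)
    then show ?case using insert by auto
  qed
qed

section \<open>Edges between components and the cuts that they form\<close>

text \<open>These are the edges whose addition to \<open>A\<close> lowers the number of components,
  so they alone contribute to Russo's formula for a function of that number.\<close>

definition crossing_edges :: "multigraph \<Rightarrow> nat set \<Rightarrow> nat set" where
  "crossing_edges G A =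
     {i \<in> edge_ids G. (fst (edges G ! i), snd (edges G ! i)) \<notin> connected_rel G A}"

lemma crossing_edges_disjoint:
  assumes "wf_multigraph G"
  shows "crossing_edges G A \<inter> A = {}"
proof -
  have "(fst (edges G ! i), snd (edges G ! i)) \<in> connected_rel G A" if "i \<in> A" "i \<in> edge_ids G" for i
    using that edge_in_verts[OF assms that(2)]
    by (auto simp: connected_rel_def Let_def mem_Times_iff)
  then show ?thesis by (auto simp: crossing_edges_def)
qed

text \<open>Double counting: an edge between two components lies in the cuts of these two only, and
  any other edge, loops included, lies in no cut of a component.\<close>

lemma sum_cut_edges_le:
  assumes "wf_multigraph G"
  shows "(\<Sum>S\<in>verts G // connected_rel G A. card (cut_edges G S)) \<le> 2 * card (crossing_edges G A)"
proof -
  let ?r = "connected_rel G A" and ?E = "edge_ids G"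
  let ?Q = "verts G // ?r"
  have fin: "finite ?Q" by (simp add: quotient_def)
  have "(\<Sum>S\<in>?Q. card (cut_edges G S)) = (\<Sum>S\<in>?Q. \<Sum>i\<in>?E. of_bool (i \<in> cut_edges G S))"
    by (rule sum.cong) (auto simp: cut_edges_def Int_def intro!: arg_cong[where f=card])
  also have "\<dots> = (\<Sum>i\<in>?E. card {S\<in>?Q. i \<in> cut_edges G S})"
    by (subst sum.swap) (simp add: fin Int_def)
  also have "\<dots> \<le> (\<Sum>i\<in>?E. if i \<in> crossing_edges G A then 2 else 0)"
  proof (rule sum_mono)
    fix i assume i: "i \<in> ?E"
    let ?u = "fst (edges G ! i)" and ?v = "snd (edges G ! i)"
    have uv: "?u \<in> verts G" "?v \<in> verts G" using edge_in_verts[OF assms i] by auto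
    have cls: "S = ?r `` {a}" if "S \<in> ?Q" "a \<in> S" for S a
      using that connected_rel_equiv[of G A]
      by (metis (no_types, lifting) Image_singleton_iff equiv_class_eq quotientE)
    have xr: "?v \<in> ?r `` {?u}" "?u \<in> ?r `` {?v}" if "(?u, ?v) \<in> ?r"
      using that connected_rel_equiv[of G A] by (auto simp: equiv_def sym_def)
    show "card {S\<in>?Q. i \<in> cut_edges G S} \<le> (if i \<in> crossing_edges G A then 2 else 0)"
    proof (cases "i \<in> crossing_edges G A")
      case True
      have "{S\<in>?Q. i \<in> cut_edges G S} \<subseteq> {?r `` {?u}, ?r `` {?v}}"
        using cls by (auto simp: cut_edges_def)
      then have "card {S\<in>?Q. i \<in> cut_edges G S} \<le> card {?r `` {?u}, ?r `` {?v}}"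
        by (intro card_mono) auto
      also have "\<dots> \<le> 2" by (simp add: card_insert_if)
      finally show ?thesis using True by simp
    next
      case False
      then have "(?u, ?v) \<in> ?r" using i by (auto simp: crossing_edges_def)
      then have "{S\<in>?Q. i \<in> cut_edges G S} = {}"
        using cls xr[OF \<open>(?u, ?v) \<in> ?r\<close>] unfolding cut_edges_def by blast
      then show ?thesis by (simp only: card.empty)
    qed
  qed
  also have "\<dots> = 2 * card (crossing_edges G A)"
    by (subst sum.If_cases) (auto simp: crossing_edges_def Int_def)
  finally show ?thesis .
qed

lemma card_cut_edges_ge:
  assumes "ereal c < ereal_of_enat (edge_connectivity G)"
    and "S \<subseteq> verts G" "S \<noteq> {}" "S \<noteq> verts G"
  shows "c \<le> card (cut_edges G S)"
proof -
  have "edge_connectivity G \<le> enat (card (cut_edges G S))"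
    unfolding edge_connectivity_def by (rule INF_lower) (use assms in auto)
  then have "ereal_of_enat (edge_connectivity G) \<le> ereal_of_enat (enat (card (cut_edges G S)))"
    by (simp only: ereal_of_enat_le_iff)
  then have "ereal c < ereal (card (cut_edges G S))" using assms(1) by (auto dest: less_le_trans)
  then show ?thesis by simp
qed

text \<open>With at least two components, each of them is a proper nonempty vertex set and is left
  by at least \<open>c\<close> edges; summing over the components counts each crossing edge at most
  twice.\<close>

lemma card_crossing_edges_ge:
  assumes wf: "wf_multigraph G" and c: "ereal c < ereal_of_enat (edge_connectivity G)"
    and k: "num_components G A \<ge> 2"
  shows "c * num_components G A \<le> 2 * card (crossing_edges G A)"
proof -
  let ?Q = "verts G // connected_rel G A"
  have "c \<le> card (cut_edges G S)" if "S \<in> ?Q" for S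
  proof (rule card_cut_edges_ge[OF c])
    show "S \<subseteq> verts G" "S \<noteq> {}"
      using in_quotient_imp_subset[OF connected_rel_equiv that]
        in_quotient_imp_non_empty[OF connected_rel_equiv that] by auto
    show "S \<noteq> verts G"
    proof
      assume S: "S = verts G"
      have "T = S" if "T \<in> ?Q" for T
      proof -
        have "T \<noteq> {}" "T \<subseteq> verts G"
          using in_quotient_imp_subset[OF connected_rel_equiv that]
            in_quotient_imp_non_empty[OF connected_rel_equiv that] by auto
        then have "T \<inter> S \<noteq> {}" using S by auto
        then show ?thesis using quotient_disj[OF connected_rel_equiv that \<open>S \<in> ?Q\<close>] by auto
      qed
      then have "?Q = {S}" using \<open>S \<in> ?Q\<close> by blast
      then show False using k by (simp add: num_components_def)
    qed
  qed
  then have "(\<Sum>S\<in>?Q. c) \<le> (\<Sum>S\<in>?Q. real (card (cut_edges G S)))" by (rule sum_mono)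
  also have "\<dots> = real (\<Sum>S\<in>?Q. card (cut_edges G S))" by simp
  also have "\<dots> \<le> real (2 * card (crossing_edges G A))"
    using sum_cut_edges_le[OF wf] of_nat_mono by blast
  finally show ?thesis by (simp add: num_components_def mult.commute)
qed

lemma num_components_edge_ids:
  assumes "wf_multigraph G" "ereal c < ereal_of_enat (edge_connectivity G)" "c \<ge> 0"
  shows "num_components G (edge_ids G) = 1"
proof (rule ccontr)
  assume "num_components G (edge_ids G) \<noteq> 1"
  then have k: "num_components G (edge_ids G) \<ge> 2"
    using num_components_pos[OF assms(1), of "edge_ids G"] by linarith
  \<comment> \<open>The bound \<open>c\<close> may be 0, which would give no contradiction. The
    strict inequality leaves room for a positive \<open>d\<close>, and a missing crossing edge then
    refutes two components.\<close>
  obtain d where d: "d > 0" "ereal d < ereal_of_enat (edge_connectivity G)"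
  proof (cases "edge_connectivity G")
    case (enat e)
    then have "c < e" using assms(2) by simp
    then show ?thesis using that[of "(c + e) / 2"] assms(3) enat by simp
  next
    case infinity
    then show ?thesis using that[of 1] by simp
  qed
  have "crossing_edges G (edge_ids G) = {}"
    using crossing_edges_disjoint[OF assms(1), of "edge_ids G"] by (auto simp: crossing_edges_def)
  then have "d * num_components G (edge_ids G) \<le> 0"
    using card_crossing_edges_ge[OF assms(1) d(2) k] by simp
  then show False using d(1) k by (simp add: mult_le_0_iff)
qed

section \<open>Independent edge failures and Russo's formula\<close>

text \<open>\<open>q\<close> is the probability that an edge fails, and \<open>A\<close> the set of edges that survive.\<close>

definition retention :: "nat set \<Rightarrow> real \<Rightarrow> nat set \<Rightarrow> real" where
  "retention E q A = q ^ card (E - A) * (1 - q) ^ card A"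

lemma sum_retention:
  assumes "finite E"
  shows "(\<Sum>A\<in>Pow E. retention E q A) = 1"
proof -
  have "(\<Sum>A\<in>Pow E. retention E q A) = (\<Sum>A\<in>Pow E. (\<Prod>x\<in>A. 1 - q) * (\<Prod>x\<in>E - A. q))"
    by (simp add: retention_def mult.commute)
  also have "\<dots> = (\<Prod>x\<in>E. (1 - q) + q)" using prod_add[OF assms, of "\<lambda>_. 1 - q" "\<lambda>_. q"] by simp
  finally show ?thesis by simp
qed

lemma retention_nonneg: "0 \<le> q \<Longrightarrow> q \<le> 1 \<Longrightarrow> retention E q A \<ge> 0"
  by (simp add: retention_def)

text \<open>Pairs of a set and a member correspond to pairs of a set and a non-member. This moves
  the derivative of the factor for survival from \<open>A\<close> to \<open>A - {e}\<close>, where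
  it meets the derivative of the factor for failure.\<close>

lemma sum_Pow_remove:
  fixes h :: "'a set \<Rightarrow> 'a set \<Rightarrow> real"
  assumes "finite E"
  shows "(\<Sum>A\<in>Pow E. \<Sum>e\<in>A. h (A - {e}) A) = (\<Sum>A\<in>Pow E. \<Sum>e\<in>E - A. h A (insert e A))"
proof -
  have "(\<Sum>A\<in>Pow E. \<Sum>e\<in>A. h (A - {e}) A) = (\<Sum>(A,e)\<in>Sigma (Pow E) (\<lambda>A. A). h (A - {e}) A)"
    by (rule sum.Sigma) (use assms finite_subset in auto)
  also have "\<dots> = (\<Sum>(A,e)\<in>Sigma (Pow E) (\<lambda>A. E - A). h A (insert e A))"
    by (rule sum.reindex_bij_witness[of _ "\<lambda>(A,e). (insert e A, e)" "\<lambda>(A,e). (A - {e}, e)"])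
       (auto simp: insert_absorb)
  also have "\<dots> = (\<Sum>A\<in>Pow E. \<Sum>e\<in>E - A. h A (insert e A))"
    by (rule sum.Sigma[symmetric]) (use assms finite_subset in auto)
  finally show ?thesis .
qed

text \<open>Russo's formula, multiplied by \<open>q\<close> so that the weights are again \<open>retention\<close>.\<close>

lemma sum_retention_deriv:
  assumes "finite E" "q > 0" and fq: "f = (\<lambda>A. F A q)"
    and F: "\<And>A. A \<in> Pow E \<Longrightarrow> ((\<lambda>q. F A q) has_real_derivative F' A) (at q)"
  shows "\<exists>D. ((\<lambda>q. \<Sum>A\<in>Pow E. retention E q A * F A q) has_real_derivative D) (at q) \<and>
    q * D = (\<Sum>A\<in>Pow E. retention E q A * ((\<Sum>e\<in>E - A. f A - f (insert e A)) + q * F' A))"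
proof -
  let ?a = "\<lambda>A. card (E - A)" and ?b = "\<lambda>A. card A"
  let ?d = "\<lambda>A. real (?a A) * q ^ (?a A - 1) * (1 - q) ^ ?b A - q ^ ?a A * (real (?b A) * (1 - q) ^ (?b A - 1))"
  let ?D = "\<Sum>A\<in>Pow E. ?d A * f A + retention E q A * F' A"
  have "((\<lambda>q. retention E q A) has_real_derivative ?d A) (at q)" for A
    unfolding retention_def by (auto intro!: derivative_eq_intros)
  then have 1: "((\<lambda>q. \<Sum>A\<in>Pow E. retention E q A * F A q) has_real_derivative ?D) (at q)"
    unfolding fq by (intro DERIV_sum) (auto intro!: derivative_eq_intros F simp: fq)
  let ?w = "\<lambda>A. q ^ (?a A - 1) * (1 - q) ^ ?b A"
  have "(\<Sum>A\<in>Pow E. q ^ ?a A * (real (?b A) * (1 - q) ^ (?b A - 1)) * f A)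
    = (\<Sum>A\<in>Pow E. \<Sum>e\<in>A. ?w (A - {e}) * f A)"
  proof (rule sum.cong)
    fix A assume A: "A \<in> Pow E"
    have fin: "finite A" using A assms(1) finite_subset by auto
    have "?w (A - {e}) = q ^ ?a A * (1 - q) ^ (?b A - 1)" if "e \<in> A" for e
    proof -
      have "E - (A - {e}) = insert e (E - A)" using that A by auto
      then show ?thesis using that fin assms(1) by simp
    qed
    then have "(\<Sum>e\<in>A. ?w (A - {e}) * f A) = (\<Sum>e\<in>A. q ^ ?a A * (1 - q) ^ (?b A - 1) * f A)"
      by (intro sum.cong) auto
    then show "q ^ ?a A * (real (?b A) * (1 - q) ^ (?b A - 1)) * f A = (\<Sum>e\<in>A. ?w (A - {e}) * f A)"
      by simp
  qed simp
  also have "\<dots> = (\<Sum>A\<in>Pow E. \<Sum>e\<in>E - A. ?w A * f (insert e A))"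
    by (rule sum_Pow_remove[OF assms(1), of "\<lambda>B A. ?w B * f A"])
  finally have 2: "(\<Sum>A\<in>Pow E. ?d A * f A) = (\<Sum>A\<in>Pow E. \<Sum>e\<in>E - A. ?w A * (f A - f (insert e A)))"
    by (simp add: algebra_simps sum_subtractf)
  have "q * (\<Sum>e\<in>E - A. ?w A * (f A - f (insert e A)))
      = retention E q A * (\<Sum>e\<in>E - A. f A - f (insert e A))" for A
  \<comment> \<open>The weight \<open>?w A\<close> omits one failure factor, which multiplication by
    \<open>q\<close> restores. If no edge fails, the truncated exponent makes this false, but then
    the inner sums are empty.\<close>
  proof (cases "E - A = {}")
    case False
    then have "?a A \<noteq> 0" using assms(1) by simp
    then have "q * ?w A = retention E q A" by (simp add: retention_def power_eq_if)
    then show ?thesis by (simp add: sum_distrib_left mult.assoc[symmetric])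
  next
    case True
    show ?thesis unfolding True by simp
  qed
  then have "q * (\<Sum>A\<in>Pow E. ?d A * f A) =
      (\<Sum>A\<in>Pow E. retention E q A * (\<Sum>e\<in>E - A. f A - f (insert e A)))"
    unfolding 2 sum_distrib_left[of q _ "Pow E"] by (rule sum.cong[OF refl])
  then have "q * ?D = (\<Sum>A\<in>Pow E. retention E q A * ((\<Sum>e\<in>E - A. f A - f (insert e A)) + q * F' A))"
    unfolding sum.distrib distrib_left by (simp only: sum_distrib_left[of q _ "Pow E"] mult.left_commute)
  with 1 show ?thesis by blast
qed

section \<open>The generating function of the number of components\<close>

definition mean :: "multigraph \<Rightarrow> real \<Rightarrow> (nat set \<Rightarrow> real) \<Rightarrow> real" where
  "mean G q f = (\<Sum>A\<in>Pow (edge_ids G). retention (edge_ids G) q A * f A)"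

text \<open>
  As the failure probability decreases from 1, each component beyond the first dies at rate at
  least \<open>c / 2\<close> on a logarithmic time scale, since at least \<open>c k / 2\<close> edges run between \<open>k\<close>
  components. Hence the generating function is monotone along the characteristic
  \<open>z r = 1 + (Z - 1) (q / r) powr (c / 2)\<close>, with \<open>r\<close> running from \<open>q\<close> to 1, where the graph has
  no edges.
\<close>

lemma mean_components_le:
  assumes wf: "wf_multigraph G" and c: "ereal c < ereal_of_enat (edge_connectivity G)" "c \<ge> 0"
    and q: "0 < q" "q \<le> 1" and Z: "Z \<ge> 1"
  shows "mean G q (\<lambda>A. Z ^ (num_components G A - 1)) \<le>
    (1 + (Z - 1) * q powr (c / 2)) ^ (nverts G - 1)"
proof -
  let ?E = "edge_ids G"
  let ?j = "\<lambda>A. num_components G A - 1"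
  define z where "z r = 1 + (Z - 1) * exp (c / 2 * (ln q - ln r))" for r
  define g where "g r = (\<Sum>A\<in>Pow ?E. retention ?E r A * z r ^ ?j A)" for r
  have "\<exists>D. (g has_real_derivative D) (at r) \<and> D \<ge> 0" if r: "q \<le> r" "r \<le> 1" for r
  proof -
    have r0: "r > 0" using q r by linarith
    \<comment> \<open>By this choice \<open>r * z'\<close> equals
      \<open>- (c / 2) * (z r - 1)\<close>. The derivative becomes a sum with the factors
      \<open>card ?k - c * ?j A / 2\<close>, which the cut bound makes nonnegative.\<close>
    define z' where "z' = - (c / 2) * (z r - 1) / r"
    have z1: "z r \<ge> 1" using Z by (simp add: z_def)
    have z': "(z has_real_derivative z') (at r)"
      unfolding z_def z'_def
      using q r0 by (auto intro!: derivative_eq_intros simp: divide_simps)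
    have "\<exists>D. (g has_real_derivative D) (at r) \<and>
      r * D = (\<Sum>A\<in>Pow ?E. retention ?E r A *
         ((\<Sum>e\<in>?E - A. z r ^ ?j A - z r ^ ?j (insert e A)) + r * (?j A * (z' * z r ^ (?j A - 1)))))"
      unfolding g_def
      by (rule sum_retention_deriv) (use r0 in \<open>auto intro!: derivative_eq_intros z'\<close>)
    then obtain D where D: "(g has_real_derivative D) (at r)"
      "r * D = (\<Sum>A\<in>Pow ?E. retention ?E r A *
         ((\<Sum>e\<in>?E - A. z r ^ ?j A - z r ^ ?j (insert e A)) + r * (?j A * (z' * z r ^ (?j A - 1)))))"
      by blast
    have "r * D \<ge> 0" unfolding D(2)
    proof (intro sum_nonneg mult_nonneg_nonneg)
      fix A assume A: "A \<in> Pow ?E"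
      show "0 \<le> retention ?E r A" using r r0 by (intro retention_nonneg) auto
      let ?k = "crossing_edges G A"
      have step: "?j A = (if e \<in> ?k then Suc (?j (insert e A)) else ?j (insert e A))" if "e \<in> ?E" for e
      proof -
        have "(e \<in> ?k) \<longleftrightarrow> connected_rel G A `` {fst (edges G ! e)} \<noteq> connected_rel G A `` {snd (edges G ! e)}"
          using that edge_in_verts[OF wf that] component_labels_class[of G A]
          by (simp add: crossing_edges_def component_labels_def del: prod.collapse)
        then show ?thesis
          using num_components_insert[OF wf that component_labels_class, of A]
            num_components_pos[OF wf, of "insert e A"] by auto
      qed
      have "(\<Sum>e\<in>?E - A. z r ^ ?j A - z r ^ ?j (insert e A))
        = (\<Sum>e\<in>?k. (z r - 1) * z r ^ (?j A - 1))"
      proof (rule sum.mono_neutral_cong_right)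
        show "?k \<subseteq> ?E - A" using crossing_edges_disjoint[OF wf, of A] by (auto simp: crossing_edges_def)
      next
        show "\<forall>e\<in>?E - A - ?k. z r ^ ?j A - z r ^ ?j (insert e A) = 0"
          using step by auto
      next
        fix e assume e: "e \<in> ?k"
        then have "?j A = Suc (?j (insert e A))" using step[of e] by (auto simp: crossing_edges_def)
        then show "z r ^ ?j A - z r ^ ?j (insert e A) = (z r - 1) * z r ^ (?j A - 1)"
          by (simp add: algebra_simps)
      qed simp
      also have "\<dots> = card ?k * ((z r - 1) * z r ^ (?j A - 1))" by simp
      finally have 1: "(\<Sum>e\<in>?E - A. z r ^ ?j A - z r ^ ?j (insert e A)) = card ?k * ((z r - 1) * z r ^ (?j A - 1))" .
      \<comment> \<open>A single component has no cut to count, but then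
        \<open>?j A = 0\<close>.\<close>
      have 2: "c * ?j A \<le> 2 * card ?k"
      proof (cases "num_components G A \<ge> 2")
        case True
        have "c * ?j A \<le> c * num_components G A" using c(2) by (intro mult_left_mono) auto
        also have "\<dots> \<le> 2 * card ?k" by (rule card_crossing_edges_ge[OF wf c(1) True])
        finally show ?thesis .
      next
        case False
        then have "?j A = 0" by auto
        then show ?thesis by simp
      qed
      have "r * (?j A * (z' * z r ^ (?j A - 1))) = - (c * ?j A / 2) * ((z r - 1) * z r ^ (?j A - 1))"
        using r0 by (simp add: z'_def field_simps)
      then have "(\<Sum>e\<in>?E - A. z r ^ ?j A - z r ^ ?j (insert e A)) + r * (?j A * (z' * z r ^ (?j A - 1)))
        = (card ?k - c * ?j A / 2) * ((z r - 1) * z r ^ (?j A - 1))"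
        unfolding 1 by (simp add: left_diff_distrib)
      also have "\<dots> \<ge> 0" using 2 z1 by (intro mult_nonneg_nonneg) auto
      finally show "0 \<le> (\<Sum>e\<in>?E - A. z r ^ ?j A - z r ^ ?j (insert e A)) + r * (?j A * (z' * z r ^ (?j A - 1)))" .
    qed
    then have "D \<ge> 0" using r0 by (simp add: zero_le_mult_iff)
    then show ?thesis using D(1) by blast
  qed
  from DERIV_nonneg_imp_nondecreasing[OF q(2) this] have "g q \<le> g 1" .
  moreover have "g q = mean G q (\<lambda>A. Z ^ (num_components G A - 1))"
    using q by (simp add: g_def z_def mean_def)
  moreover have "g 1 = z 1 ^ ?j {}"
  proof -
    \<comment> \<open>At failure probability 1 the factor \<open>(1 - 1) ^ card A\<close> kills
      every set but the empty one, where it is \<open>0 ^ 0 = 1\<close>.\<close>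
    have "retention ?E 1 A * z 1 ^ ?j A = (if A = {} then z 1 ^ ?j {} else 0)" if "A \<in> Pow ?E" for A
      using that finite_subset[of A ?E] by (auto simp: retention_def power_0_left)
    then have "g 1 = (\<Sum>A\<in>Pow ?E. if A = {} then z 1 ^ ?j {} else 0)"
      unfolding g_def by (rule sum.cong[OF refl])
    also have "\<dots> = z 1 ^ ?j {}" by (subst sum.delta) auto
    finally show ?thesis .
  qed
  ultimately show ?thesis using q by (simp add: z_def num_components_empty powr_def)
qed

section \<open>Refinement of programs by abstract distributions\<close>

text \<open>Under logarithmic cost, a bound on all cells bounds the price of an instruction. One
  \<beta> serves for the whole run, so sizes need not be tracked cell by cell in the time
  analysis.\<close>

definition bounded_mem :: "nat \<Rightarrow> memory \<Rightarrow> bool" where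
  "bounded_mem \<beta> s \<longleftrightarrow> (\<forall>a. \<bar>s a\<bar> \<le> 2 ^ \<beta>)"

lemma bounded_memD: "bounded_mem \<beta> s \<Longrightarrow> \<bar>s a\<bar> \<le> 2 ^ \<beta>"
  by (simp add: bounded_mem_def)

lemma bounded_mem_upd: "bounded_mem \<beta> s \<Longrightarrow> \<bar>k\<bar> \<le> 2 ^ \<beta> \<Longrightarrow> bounded_mem \<beta> (s(a := k))"
  by (simp add: bounded_mem_def)

text \<open>\<open>Approx\<close> is excluded because its value depends on the parameters and on the
  requested precision, and so is not bounded through the memory; it has a rule of its own.\<close>

primrec simple :: "nat \<Rightarrow> iexp \<Rightarrow> bool" where
  "simple \<beta> (Num k) \<longleftrightarrow> \<bar>k\<bar> \<le> 2 ^ \<beta>"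
| "simple \<beta> (Mem e) \<longleftrightarrow> simple \<beta> e"
| "simple \<beta> (Add e f) \<longleftrightarrow> simple \<beta> e \<and> simple \<beta> f"
| "simple \<beta> (Sub e f) \<longleftrightarrow> simple \<beta> e \<and> simple \<beta> f"
| "simple \<beta> (Mul e f) \<longleftrightarrow> simple \<beta> e \<and> simple \<beta> f"
| "simple \<beta> (Div e f) \<longleftrightarrow> simple \<beta> e \<and> simple \<beta> f"
| "simple \<beta> (Approx i e) \<longleftrightarrow> False"

primrec nodes :: "iexp \<Rightarrow> nat" where
  "nodes (Num k) = 1"
| "nodes (Mem e) = Suc (nodes e)"
| "nodes (Add e f) = Suc (nodes e + nodes f)"
| "nodes (Sub e f) = Suc (nodes e + nodes f)"
| "nodes (Mul e f) = Suc (nodes e + nodes f)"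
| "nodes (Div e f) = Suc (nodes e + nodes f)"
| "nodes (Approx i e) = Suc (nodes e)"

text \<open>For a < 0 < b the rounded quotient lies between a and 0, so rounding down does no harm.
  A negative divisor is handled by changing both signs.\<close>

lemma abs_div_le: "\<bar>a div b\<bar> \<le> \<bar>a\<bar>" for a b :: int
proof -
  have 1: "\<bar>a div b\<bar> \<le> \<bar>a\<bar>" if "b > 0" for a b :: int
  proof (cases "a \<ge> 0")
    case True
    then show ?thesis using that
      by (metis abs_of_nonneg div_by_1 int_one_le_iff_zero_less pos_imp_zdiv_nonneg_iff zdiv_mono2 zero_less_one)
  next
    case False
    then have "a div b \<ge> a" 
      using that by (smt (verit) div_by_1 zdiv_mono2_neg)
    moreover have "a div b \<le> 0" using False that by (simp add: div_nonpos_pos_le0)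
    ultimately show ?thesis by linarith
  qed
  consider "b > 0" | "b = 0" | "b < 0" by linarith
  then show ?thesis
  proof cases
    case 3
    then show ?thesis using 1[of "-b" "-a"] by simp
  qed (use 1 in auto)
qed

text \<open>Each node accounts for at most \<beta> bits: lengths add under multiplication, the carry
  of a sum is paid for by \<beta> \<ge> 1, and a memory access yields at most \<beta> bits whatever
  its address.\<close>

lemma abs_ival_le:
  assumes "bounded_mem \<beta> s" "\<beta> \<ge> 1"
  shows "simple \<beta> e \<Longrightarrow> \<bar>ival \<rho> e s\<bar> \<le> 2 ^ (\<beta> * nodes e)"
proof -
  have sums: "\<bar>a\<bar> + \<bar>b\<bar> \<le> 2 ^ (\<beta> * Suc (nodes e + nodes f))"
    if "\<bar>a\<bar> \<le> 2 ^ (\<beta> * nodes e)" "\<bar>b\<bar> \<le> 2 ^ (\<beta> * nodes f)" for a b :: int and e f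
  proof -
    have "(2::int) ^ (\<beta> * nodes e) + 2 ^ (\<beta> * nodes f)
      \<le> 2 ^ (\<beta> * (nodes e + nodes f)) + 2 ^ (\<beta> * (nodes e + nodes f))"
      by (intro add_mono power_increasing) auto
    also have "\<dots> = 2 ^ Suc (\<beta> * (nodes e + nodes f))" by simp
    also have "\<dots> \<le> 2 ^ (\<beta> * Suc (nodes e + nodes f))" using assms(2) by (intro power_increasing) auto
    finally show ?thesis using that by linarith
  qed
  show "simple \<beta> e \<Longrightarrow> \<bar>ival \<rho> e s\<bar> \<le> 2 ^ (\<beta> * nodes e)"
  proof (induction e)
    case (Num k)
    then show ?case by simp
  next
    case (Mem e)
    have "\<bar>s (ival \<rho> e s)\<bar> \<le> 2 ^ \<beta>" using assms(1) by (rule bounded_memD)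
    also have "(2::int) ^ \<beta> \<le> 2 ^ (\<beta> * nodes (Mem e))" by (intro power_increasing) auto
    finally show ?case by simp
  next
    case (Add e f)
    have "\<bar>ival \<rho> e s\<bar> + \<bar>ival \<rho> f s\<bar> \<le> 2 ^ (\<beta> * Suc (nodes e + nodes f))" using Add by (intro sums) auto
    then show ?case unfolding ival.simps nodes.simps by linarith
  next
    case (Sub e f)
    have "\<bar>ival \<rho> e s\<bar> + \<bar>ival \<rho> f s\<bar> \<le> 2 ^ (\<beta> * Suc (nodes e + nodes f))" using Sub by (intro sums) auto
    then show ?case unfolding ival.simps nodes.simps by linarith
  next
    case (Mul e f)
    have "\<bar>ival \<rho> e s * ival \<rho> f s\<bar> \<le> 2 ^ (\<beta> * nodes e) * 2 ^ (\<beta> * nodes f)"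
      unfolding abs_mult using Mul by (intro mult_mono) auto
    also have "\<dots> \<le> 2 ^ (\<beta> * nodes (Mul e f))"
      unfolding power_add[symmetric] by (intro power_increasing) (auto simp: algebra_simps)
    finally show ?case by simp
  next
    case (Div e f)
    have "\<bar>ival \<rho> e s div ival \<rho> f s\<bar> \<le> \<bar>ival \<rho> e s\<bar>" by (rule abs_div_le)
    also have "\<dots> \<le> 2 ^ (\<beta> * nodes e)" using Div by simp
    also have "\<dots> \<le> 2 ^ (\<beta> * nodes (Div e f))" by (intro power_increasing mult_left_mono) auto
    finally show ?case by simp
  qed simp
qed

lemma bit_length_le: "\<bar>k\<bar> \<le> 2 ^ b \<Longrightarrow> bit_length k \<le> Suc b"
proof -
  assume "\<bar>k\<bar> \<le> 2 ^ b"
  then have "nat \<bar>k\<bar> \<le> 2 ^ b" by (simp add: nat_le_iff)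
  then have "nat \<bar>k\<bar> < 2 ^ Suc b" by (rule le_less_trans) simp
  then show ?thesis unfolding bit_length_def by (intro floorlog_leI) auto
qed

lemma icost_le:
  assumes "bounded_mem \<beta> s" "\<beta> \<ge> 1"
  shows "simple \<beta> e \<Longrightarrow> nodes e \<le> m \<Longrightarrow> icost \<rho> e s \<le> nodes e * (2 + \<beta> * m)"
proof -
  have len: "bit_length (ival \<rho> e s) \<le> Suc (\<beta> * m)" if "simple \<beta> e" "nodes e \<le> m" for e
  proof (rule bit_length_le)
    have "\<bar>ival \<rho> e s\<bar> \<le> 2 ^ (\<beta> * nodes e)" using assms that(1) by (rule abs_ival_le)
    also have "\<dots> \<le> 2 ^ (\<beta> * m)" using that(2) by (intro power_increasing mult_left_mono) auto
    finally show "\<bar>ival \<rho> e s\<bar> \<le> 2 ^ (\<beta> * m)" .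
  qed
  show "simple \<beta> e \<Longrightarrow> nodes e \<le> m \<Longrightarrow> icost \<rho> e s \<le> nodes e * (2 + \<beta> * m)"
  proof (induction e)
    case (Num k)
    have "bit_length k \<le> Suc \<beta>" using Num by (intro bit_length_le) auto
    also have "\<beta> \<le> \<beta> * m" using Num by simp
    finally show ?case by simp
  next
    case (Mem e)
    then show ?case using len[of "Mem e"] by simp
  next
    case (Add e f)
    then show ?case using len[of "Add e f"] by (simp add: distrib_right)
  next
    case (Sub e f)
    then show ?case using len[of "Sub e f"] by (simp add: distrib_right)
  next
    case (Mul e f)
    then show ?case using len[of "Mul e f"] by (simp add: distrib_right)
  next
    case (Div e f)
    then show ?case using len[of "Div e f"] by (simp add: distrib_right)
  qed simp
qed

text \<open>A flat price for a basic command. An expression with at most 20 nodes costs at most 20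
  (2 + 20 \<beta>), and twice this plus 2 is below 1000 (\<beta> + 2).\<close>

definition unit_cost :: "nat \<Rightarrow> nat" where
  "unit_cost \<beta> = 1000 * (\<beta> + 2)"

lemma icost_le_unit:
  assumes "bounded_mem \<beta> s" "\<beta> \<ge> 1" "simple \<beta> e" "nodes e \<le> 20"
  shows "2 + 2 * icost \<rho> e s \<le> unit_cost \<beta>"
proof -
  have "icost \<rho> e s \<le> nodes e * (2 + \<beta> * 20)" by (rule icost_le) fact+
  also have "\<dots> \<le> 20 * (2 + \<beta> * 20)" using assms(4) by (rule mult_right_mono) simp
  finally show ?thesis by (simp add: unit_cost_def)
qed

text \<open>
  \<open>exec \<rho> P s\<close> is coupled with the abstract distribution \<open>D\<close> so that the final memory is related
  by \<open>\<Phi>\<close> to the abstract value, all cells stay below \<open>2 ^ \<beta>\<close>, and the time is at most \<open>T\<close>.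
\<close>

definition simulates ::
  "(nat \<Rightarrow> real) \<Rightarrow> nat \<Rightarrow> prog \<Rightarrow> memory \<Rightarrow> 'v pmf \<Rightarrow> (memory \<Rightarrow> 'v \<Rightarrow> bool) \<Rightarrow> nat \<Rightarrow> bool"
where
  "simulates \<rho> \<beta> P s D \<Phi> T \<longleftrightarrow> (\<beta> \<ge> 1 \<and> bounded_mem \<beta> s \<longrightarrow>
     rel_spmf (\<lambda>(s', t) v. bounded_mem \<beta> s' \<and> \<Phi> s' v \<and> t \<le> T) (exec \<rho> P s) (spmf_of_pmf D))"

lemma simulates_mono:
  assumes "simulates \<rho> \<beta> P s D \<Psi> T'" "\<And>s' v. \<Psi> s' v \<Longrightarrow> \<Phi> s' v" "T' \<le> T"
  shows "simulates \<rho> \<beta> P s D \<Phi> T"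
  using assms unfolding simulates_def by (auto elim!: rel_spmf_mono)

lemma simulates_weaken:
  "simulates \<rho> \<beta> P s D \<Phi> T' \<Longrightarrow> T' \<le> T \<Longrightarrow> simulates \<rho> \<beta> P s D \<Phi> T"
  by (rule simulates_mono)

text \<open>Deterministic code is verified against a dummy value; this exchanges the dummy for the
  value that the surrounding random computation returns.\<close>

lemma simulates_return:
  assumes "simulates \<rho> \<beta> P s (return_pmf x) (\<lambda>s' _. \<Phi> s' v) T"
  shows "simulates \<rho> \<beta> P s (return_pmf v) \<Phi> T"
  using assms by (simp add: simulates_def rel_spmf_return_spmf2 split_def)

text \<open>Makes the boundedness of the initial memory, which is built into
  \<open>simulates\<close>, available as a fact. It is needed when code copies a cell about which
  nothing else is known.\<close>

lemma simulates_bounded: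
  "(bounded_mem \<beta> s \<Longrightarrow> simulates \<rho> \<beta> P s D \<Phi> T) \<Longrightarrow> simulates \<rho> \<beta> P s D \<Phi> T"
  unfolding simulates_def by blast

lemma simulates_skip: "\<Phi> s v \<Longrightarrow> T \<ge> 1 \<Longrightarrow> simulates \<rho> \<beta> Skip s (return_pmf v) \<Phi> T"
  by (simp add: simulates_def)

lemma simulates_assign:
  assumes "simple \<beta> a" "nodes a \<le> 20" "simple \<beta> e" "nodes e \<le> 20" "\<bar>ival \<rho> e s\<bar> \<le> 2 ^ \<beta>"
    "\<Phi> (s(ival \<rho> a s := ival \<rho> e s)) v"
  shows "simulates \<rho> \<beta> (Assign a e) s (return_pmf v) \<Phi> (unit_cost \<beta>)"
  unfolding simulates_def
proof
  assume "\<beta> \<ge> 1 \<and> bounded_mem \<beta> s"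
  then show "rel_spmf (\<lambda>(s', t) v. bounded_mem \<beta> s' \<and> \<Phi> s' v \<and> t \<le> unit_cost \<beta>)
     (exec \<rho> (Assign a e) s) (spmf_of_pmf (return_pmf v))"
    using icost_le_unit[of \<beta> s a \<rho>] icost_le_unit[of \<beta> s e \<rho>] assms
    by (simp add: bounded_mem_upd)
qed

text \<open>The precision \<open>k\<close> is itself part of the cost, so
  \<open>k \<le> \<beta>\<close> is what keeps the query within \<open>unit_cost\<close>.\<close>

lemma simulates_approx:
  assumes "\<bar>v\<bar> \<le> 2 ^ \<beta>" "\<bar>w\<bar> \<le> 2 ^ \<beta>" "s w = int k" "k \<le> \<beta>" "\<bar>\<lfloor>\<rho> i * 2 ^ k\<rfloor>\<bar> \<le> 2 ^ \<beta>"
    "\<Phi> (s(v := \<lfloor>\<rho> i * 2 ^ k\<rfloor>)) ()"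
  shows "simulates \<rho> \<beta> (Assign (Num v) (Approx i (Mem (Num w)))) s (return_pmf ()) \<Phi> (unit_cost \<beta>)"
  unfolding simulates_def
proof
  assume "\<beta> \<ge> 1 \<and> bounded_mem \<beta> s"
  moreover have "bit_length v \<le> Suc \<beta>" "bit_length w \<le> Suc \<beta>" "bit_length (\<lfloor>\<rho> i * 2 ^ k\<rfloor>) \<le> Suc \<beta>"
    using assms by (auto intro: bit_length_le)
  moreover have "bit_length (int k) \<le> Suc \<beta>"
    by (rule bit_length_le) (use \<open>k \<le> \<beta>\<close> in \<open>auto intro: order_trans less_imp_le[OF of_nat_less_two_power]\<close>)
  ultimately show "rel_spmf (\<lambda>(s', t) v. bounded_mem \<beta> s' \<and> \<Phi> s' v \<and> t \<le> unit_cost \<beta>)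
     (exec \<rho> (Assign (Num v) (Approx i (Mem (Num w)))) s) (spmf_of_pmf (return_pmf ()))"
    using assms by (simp add: bounded_mem_upd unit_cost_def)
qed

lemma simulates_flip:
  assumes "simple \<beta> a" "nodes a \<le> 20" "\<And>b. \<Phi> (s(ival \<rho> a s := of_bool b)) b"
  shows "simulates \<rho> \<beta> (Flip a) s (pmf_of_set UNIV) \<Phi> (unit_cost \<beta>)"
  unfolding simulates_def
proof
  assume *: "\<beta> \<ge> 1 \<and> bounded_mem \<beta> s"
  have c: "spmf_of_pmf (pmf_of_set UNIV) = coin_spmf" by simp
  have "bounded_mem \<beta> (s(ival \<rho> a s := of_bool b))" for b
    using * by (intro bounded_mem_upd) auto
  then show "rel_spmf (\<lambda>(s', t) v. bounded_mem \<beta> s' \<and> \<Phi> s' v \<and> t \<le> unit_cost \<beta>)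
     (exec \<rho> (Flip a) s) (spmf_of_pmf (pmf_of_set UNIV))"
    unfolding c using icost_le_unit[of \<beta> s a \<rho>] * assms
    by (auto simp: spmf_rel_map intro!: rel_spmf_reflI)
qed

lemma simulates_seq:
  assumes "simulates \<rho> \<beta> P s D \<Psi> T1" "\<And>s' v. \<Psi> s' v \<Longrightarrow> simulates \<rho> \<beta> Q s' (E v) \<Phi> T2"
  shows "simulates \<rho> \<beta> (Seq P Q) s (bind_pmf D E) \<Phi> (1 + T1 + T2)"
  unfolding simulates_def
proof
  assume *: "\<beta> \<ge> 1 \<and> bounded_mem \<beta> s"
  have e: "spmf_of_pmf (bind_pmf D E) = bind_spmf (spmf_of_pmf D) (\<lambda>v. spmf_of_pmf (E v))"
    by (simp add: spmf_of_pmf_bind)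
  show "rel_spmf (\<lambda>(s', t) v. bounded_mem \<beta> s' \<and> \<Phi> s' v \<and> t \<le> 1 + T1 + T2)
     (exec \<rho> (Seq P Q) s) (spmf_of_pmf (bind_pmf D E))"
    unfolding e exec.simps
  proof (rule rel_spmf_bindI)
    show "rel_spmf (\<lambda>(s', t) v. bounded_mem \<beta> s' \<and> \<Psi> s' v \<and> t \<le> T1) (exec \<rho> P s) (spmf_of_pmf D)"
      using assms(1) * by (simp add: simulates_def)
  next
    fix st v
    assume "(case st of (s', t) \<Rightarrow> \<lambda>v. bounded_mem \<beta> s' \<and> \<Psi> s' v \<and> t \<le> T1) v"
    then obtain s' t where st: "st = (s', t)" "bounded_mem \<beta> s'" "\<Psi> s' v" "t \<le> T1"
      by (cases st) auto
    have "rel_spmf (\<lambda>(s', t) v. bounded_mem \<beta> s' \<and> \<Phi> s' v \<and> t \<le> T2) (exec \<rho> Q s') (spmf_of_pmf (E v))"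
      using assms(2)[OF st(3)] st * by (simp add: simulates_def)
    then have "rel_spmf (\<lambda>(s', t) v. bounded_mem \<beta> s' \<and> \<Phi> s' v \<and> t \<le> 1 + T1 + T2)
      (exec \<rho> Q s' \<bind> (\<lambda>(s'', t'). return_spmf (s'', 1 + t + t'))) (spmf_of_pmf (E v) \<bind> return_spmf)"
      by (rule rel_spmf_bindI) (use st in auto)
    then show "rel_spmf (\<lambda>(s', t) v. bounded_mem \<beta> s' \<and> \<Phi> s' v \<and> t \<le> 1 + T1 + T2)
      (case st of (s', t) \<Rightarrow> exec \<rho> Q s' \<bind> (\<lambda>(s'', t'). return_spmf (s'', 1 + t + t')))
      (spmf_of_pmf (E v))"
      using st by simp
  qed
qed

lemma simulates_seq_det:
  assumes "simulates \<rho> \<beta> P s (return_pmf x) (\<lambda>s' _. \<Psi> s') T1" "\<And>s'. \<Psi> s' \<Longrightarrow> simulates \<rho> \<beta> Q s' D \<Phi> T2"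
  shows "simulates \<rho> \<beta> (Seq P Q) s D \<Phi> (1 + T1 + T2)"
  using simulates_seq[OF assms(1), of Q "\<lambda>_. D" \<Phi> T2] assms(2) by (simp add: bind_return_pmf)

lemma simulates_assign_seq:
  assumes "simple \<beta> a" "nodes a \<le> 20" "simple \<beta> e" "nodes e \<le> 20" "\<bar>ival \<rho> e s\<bar> \<le> 2 ^ \<beta>"
    "simulates \<rho> \<beta> Q (s(ival \<rho> a s := ival \<rho> e s)) D \<Phi> T"
  shows "simulates \<rho> \<beta> (Seq (Assign a e) Q) s D \<Phi> (1 + unit_cost \<beta> + T)"
proof (rule simulates_seq_det)
  show "simulates \<rho> \<beta> (Assign a e) s (return_pmf ()) (\<lambda>s' _. s' = s(ival \<rho> a s := ival \<rho> e s)) (unit_cost \<beta>)"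
    by (rule simulates_assign) (use assms in auto)
qed (use assms in auto)

lemma simulates_set_seq:
  assumes "simple \<beta> e" "nodes e \<le> 20" "\<bar>v\<bar> \<le> 2 ^ \<beta>" "ival \<rho> e s = z" "\<bar>z\<bar> \<le> 2 ^ \<beta>"
    "simulates \<rho> \<beta> Q (s(v := z)) D \<Phi> T"
  shows "simulates \<rho> \<beta> (Seq (Assign (Num v) e) Q) s D \<Phi> (1 + unit_cost \<beta> + T)"
  by (rule simulates_assign_seq) (use assms in auto)

lemma simulates_approx_seq:
  assumes "\<bar>v\<bar> \<le> 2 ^ \<beta>" "\<bar>w\<bar> \<le> 2 ^ \<beta>" "s w = int k" "k \<le> \<beta>" "\<lfloor>\<rho> i * 2 ^ k\<rfloor> = z" "\<bar>z\<bar> \<le> 2 ^ \<beta>"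
    "simulates \<rho> \<beta> Q (s(v := z)) D \<Phi> T"
  shows "simulates \<rho> \<beta> (Seq (Assign (Num v) (Approx i (Mem (Num w)))) Q) s D \<Phi> (1 + unit_cost \<beta> + T)"
proof (rule simulates_seq_det)
  show "simulates \<rho> \<beta> (Assign (Num v) (Approx i (Mem (Num w)))) s (return_pmf ()) (\<lambda>s' _. s' = s(v := z)) (unit_cost \<beta>)"
    by (rule simulates_approx) (use assms in auto)
qed (use assms in auto)

lemma simulates_if:
  assumes "simple \<beta> e" "nodes e \<le> 20"
    "ival \<rho> e s > 0 \<Longrightarrow> simulates \<rho> \<beta> P s D \<Phi> T"
    "ival \<rho> e s \<le> 0 \<Longrightarrow> simulates \<rho> \<beta> Q s D \<Phi> T"
  shows "simulates \<rho> \<beta> (If e P Q) s D \<Phi> (unit_cost \<beta> + T)"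
  unfolding simulates_def
proof
  assume *: "\<beta> \<ge> 1 \<and> bounded_mem \<beta> s"
  have "simulates \<rho> \<beta> (if ival \<rho> e s > 0 then P else Q) s D \<Phi> T" using assms by simp
  then have "rel_spmf (\<lambda>(s', t) v. bounded_mem \<beta> s' \<and> \<Phi> s' v \<and> t \<le> T)
      (exec \<rho> (if ival \<rho> e s > 0 then P else Q) s) (spmf_of_pmf D)"
    using * by (simp add: simulates_def)
  then show "rel_spmf (\<lambda>(s', t) v. bounded_mem \<beta> s' \<and> \<Phi> s' v \<and> t \<le> unit_cost \<beta> + T)
     (exec \<rho> (If e P Q) s) (spmf_of_pmf D)"
    using icost_le_unit[of \<beta> s e \<rho>] * assms(1,2)
    unfolding exec.simps spmf_rel_map by (auto elim!: rel_spmf_mono)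
qed

lemma simulates_while_exit:
  assumes "simple \<beta> e" "nodes e \<le> 20" "ival \<rho> e s \<le> 0" "\<Phi> s v"
  shows "simulates \<rho> \<beta> (While e P) s (return_pmf v) \<Phi> (unit_cost \<beta>)"
  unfolding simulates_def
proof
  assume *: "\<beta> \<ge> 1 \<and> bounded_mem \<beta> s"
  then show "rel_spmf (\<lambda>(s', t) v. bounded_mem \<beta> s' \<and> \<Phi> s' v \<and> t \<le> unit_cost \<beta>)
     (exec \<rho> (While e P) s) (spmf_of_pmf (return_pmf v))"
    using icost_le_unit[of \<beta> s e \<rho>] assms by (simp add: while_spmf.simps)
qed

lemma simulates_while_step:
  assumes "simple \<beta> e" "nodes e \<le> 20" "ival \<rho> e s > 0"
    and "simulates \<rho> \<beta> P s D \<Psi> T1" "\<And>s' v. \<Psi> s' v \<Longrightarrow> simulates \<rho> \<beta> (While e P) s' (E v) \<Phi> T2"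
  shows "simulates \<rho> \<beta> (While e P) s (bind_pmf D E) \<Phi> (unit_cost \<beta> + T1 + T2)"
  unfolding simulates_def
proof
  assume *: "\<beta> \<ge> 1 \<and> bounded_mem \<beta> s"
  have "simulates \<rho> \<beta> (Seq P (While e P)) s (bind_pmf D E) \<Phi> (1 + T1 + T2)"
    by (rule simulates_seq) fact+
  then have r: "rel_spmf (\<lambda>(s', t) v. bounded_mem \<beta> s' \<and> \<Phi> s' v \<and> t \<le> 1 + T1 + T2)
     (exec \<rho> (Seq P (While e P)) s) (spmf_of_pmf (bind_pmf D E))"
    using * by (simp add: simulates_def)
  \<comment> \<open>One round of the loop is the body followed by the loop. The constant 1 charged
    by \<open>Seq\<close> is the one that \<open>While\<close> charges per test, so only the cost of
    the test expression is added.\<close>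
  have e: "exec \<rho> (While e P) s =
      map_spmf (\<lambda>(s', t). (s', icost \<rho> e s + t)) (exec \<rho> (Seq P (While e P)) s)"
    using assms(3)
    by (simp add: while_spmf.simps map_spmf_bind_spmf o_def split_def map_spmf_conv_bind_spmf[symmetric])
      (simp add: map_spmf_conv_bind_spmf split_def add_ac)
  have "icost \<rho> e s + 1 \<le> unit_cost \<beta>" using icost_le_unit[of \<beta> s e \<rho>] assms(1,2) * by simp
  then show "rel_spmf (\<lambda>(s', t) v. bounded_mem \<beta> s' \<and> \<Phi> s' v \<and> t \<le> unit_cost \<beta> + T1 + T2)
     (exec \<rho> (While e P) s) (spmf_of_pmf (bind_pmf D E))"
    unfolding e spmf_rel_map using r by (auto elim!: rel_spmf_mono)
qed

section \<open>Counted loops\<close>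

text \<open>The abstract counterpart of \<open>For\<close>: the index runs from k - 1 down to 0,
  because the loop decrements its counter before the body.\<close>

primrec down :: "(nat \<Rightarrow> 'v \<Rightarrow> 'v pmf) \<Rightarrow> nat \<Rightarrow> 'v \<Rightarrow> 'v pmf" where
  "down f 0 x = return_pmf x"
| "down f (Suc r) x = bind_pmf (f r x) (down f r)"

lemma down_return: "down (\<lambda>r x. return_pmf x) k x = return_pmf x"
  by (induction k) (auto simp: bind_return_pmf)

definition For :: "int \<Rightarrow> iexp \<Rightarrow> prog \<Rightarrow> prog" where
  "For v e P = Seq (Assign (Num v) e)
     (While (Mem (Num v)) (Seq (Assign (Num v) (Sub (Mem (Num v)) (Num 1))) P))"

text \<open>\<open>I r\<close> describes the state with \<open>r\<close> rounds to go. The abstract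
  step may depend on \<open>r\<close>, as it does where round \<open>r\<close> decides the fate of
  edge \<open>r\<close>; the body has to preserve the counter.\<close>

lemma simulates_for:
  assumes "\<bar>v\<bar> \<le> 2 ^ \<beta>" "simple \<beta> e" "nodes e \<le> 20" "ival \<rho> e s = int k" "int k \<le> 2 ^ \<beta>"
    and init: "I k (s(v := int k)) x"
    and step: "\<And>r s x. r < k \<Longrightarrow> I (Suc r) s x \<Longrightarrow> s v = int (Suc r) \<Longrightarrow>
       simulates \<rho> \<beta> P (s(v := int r)) (f r x) (\<lambda>s' x'. I r s' x' \<and> s' v = int r) T"
    and exit: "\<And>s x. I 0 s x \<Longrightarrow> s v = 0 \<Longrightarrow> \<Phi> s x"
  shows "simulates \<rho> \<beta> (For v e P) s (down f k x) \<Phi> ((k + 1) * (T + 4 * unit_cost \<beta>))"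
proof -
  let ?U = "unit_cost \<beta>"
  let ?b = "Seq (Assign (Num v) (Sub (Mem (Num v)) (Num 1))) P"
  have v: "simple \<beta> (Num v)" "simple \<beta> (Mem (Num v))" "nodes (Mem (Num v)) \<le> 20" using assms(1) by auto
  have loop: "simulates \<rho> \<beta> (While (Mem (Num v)) ?b) s (down f r x) \<Phi> (r * (T + 3 * ?U) + ?U)"
    if "r \<le> k" "I r s x" "s v = int r" for r s x
    using that
  proof (induction r arbitrary: s x)
    case 0
    then show ?case using v exit by (auto intro!: simulates_while_exit)
  next
    case (Suc r)
    have "int (Suc r) \<le> int k" using Suc.prems(1) by (subst of_nat_le_iff)
    then have rb: "\<bar>int r\<bar> \<le> 2 ^ \<beta>" using assms(5) by simp
    have "simulates \<rho> \<beta> ?b s (f r x) (\<lambda>s' x'. I r s' x' \<and> s' v = int r) (1 + ?U + T)"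
      by (rule simulates_assign_seq) (use v rb Suc.prems step[of r s x] in auto)
    then have "simulates \<rho> \<beta> (While (Mem (Num v)) ?b) s (bind_pmf (f r x) (down f r)) \<Phi>
        (?U + (1 + ?U + T) + (r * (T + 3 * ?U) + ?U))"
      by (rule simulates_while_step[OF v(2,3), rotated]) (use Suc in auto)
    then show ?case unfolding down.simps
      by (rule simulates_mono) (auto simp: unit_cost_def algebra_simps)
  qed
  have "simulates \<rho> \<beta> (For v e P) s (down f k x) \<Phi> (1 + ?U + (k * (T + 3 * ?U) + ?U))"
    unfolding For_def by (rule simulates_assign_seq) (use assms v loop in auto)
  then show ?thesis by (rule simulates_mono) (auto simp: unit_cost_def algebra_simps)
qed

lemma simulates_for_det:
  assumes "\<bar>v\<bar> \<le> 2 ^ \<beta>" "simple \<beta> e" "nodes e \<le> 20" "ival \<rho> e s = int k" "int k \<le> 2 ^ \<beta>"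
    and init: "I k (s(v := int k))"
    and step: "\<And>r s. r < k \<Longrightarrow> I (Suc r) s \<Longrightarrow> s v = int (Suc r) \<Longrightarrow>
       simulates \<rho> \<beta> P (s(v := int r)) (return_pmf ()) (\<lambda>s' _. I r s' \<and> s' v = int r) T"
    and exit: "\<And>s. I 0 s \<Longrightarrow> s v = 0 \<Longrightarrow> \<Phi> s"
  shows "simulates \<rho> \<beta> (For v e P) s (return_pmf ()) (\<lambda>s' _. \<Phi> s') ((k + 1) * (T + 4 * unit_cost \<beta>))"
  using simulates_for[where f="\<lambda>r x. return_pmf x" and x="()" and I="\<lambda>r s _. I r s" and \<Phi>="\<lambda>s' _. \<Phi> s'"] assms
  by (simp add: down_return)

text \<open>The three demands of \<open>is_fpras\<close> follow from the coupling: total mass is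
  preserved, the relation holds at every point of the support and so bounds every running time, and
  an abstract event that forces a concrete one has no greater probability.\<close>

lemma simulatesD:
  assumes "simulates \<rho> \<beta> P s D \<Phi> T" "\<beta> \<ge> 1" "bounded_mem \<beta> s"
  shows "lossless_spmf (exec \<rho> P s)"
    and "(s', t) \<in> set_spmf (exec \<rho> P s) \<Longrightarrow> t \<le> T"
    and "(\<And>s' v. \<Phi> s' v \<Longrightarrow> v \<in> A \<Longrightarrow> s' \<in> B) \<Longrightarrow>
      measure_pmf.prob D A \<le> measure (measure_spmf (exec \<rho> P s)) {(s', t). s' \<in> B}"
proof -
  let ?R = "\<lambda>(s', t) v. bounded_mem \<beta> s' \<and> \<Phi> s' v \<and> t \<le> T"
  have r: "rel_spmf ?R (exec \<rho> P s) (spmf_of_pmf D)" using assms by (simp add: simulates_def)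
  show "lossless_spmf (exec \<rho> P s)"
    using rel_spmf_weightD[OF r] by (simp add: lossless_spmf_def)
  show "t \<le> T" if "(s', t) \<in> set_spmf (exec \<rho> P s)"
    using rel_setD1[OF rel_funD[OF set_spmf_parametric r] that] by auto
  assume AB: "\<And>s' v. \<Phi> s' v \<Longrightarrow> v \<in> A \<Longrightarrow> s' \<in> B"
  have "rel_spmf ?R\<inverse>\<inverse> (spmf_of_pmf D) (exec \<rho> P s)" unfolding spmf_rel_conversep using r by simp
  from rel_spmf_measureD[OF this, of A]
  have "measure_pmf.prob D A \<le> measure (measure_spmf (exec \<rho> P s)) {st. \<exists>v\<in>A. ?R st v}" by simp
  also have "\<dots> \<le> measure (measure_spmf (exec \<rho> P s)) {(s', t). s' \<in> B}"
    by (rule measure_spmf.finite_measure_mono) (use AB in auto)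
  finally show "measure_pmf.prob D A \<le> measure (measure_spmf (exec \<rho> P s)) {(s', t). s' \<in> B}" .
qed

section \<open>The Tutte polynomial as a mean\<close>

text \<open>The identity holds term by term. A surviving edge has weight (y - 1) / y, so
  \<open>y ^ ?m\<close> leaves \<open>(y - 1) ^ card A\<close>; the exponent of y - 1 exceeds
  \<open>card A\<close> by (\<kappa> - 1) - (n - 1), which yields the base Q and the
  prefactor.\<close>

lemma tutte_eq_mean:
  assumes wf: "wf_multigraph G" and k1: "num_components G (edge_ids G) = 1" and y: "y > 1"
  shows "tutte G x y = y ^ length (edges G) / (y - 1) ^ (nverts G - 1) *
    mean G (1 / y) (\<lambda>A. ((x - 1) * (y - 1)) ^ (num_components G A - 1))"
proof -
  let ?E = "edge_ids G" and ?m = "length (edges G)" and ?n = "nverts G"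
  have "(x - 1) ^ (num_components G A - num_components G ?E) * (y - 1) ^ (card A + num_components G A - ?n)
    = y ^ ?m / (y - 1) ^ (?n - 1) * (retention ?E (1 / y) A * ((x - 1) * (y - 1)) ^ (num_components G A - 1))"
    if A: "A \<in> Pow ?E" for A
  proof -
    let ?k = "num_components G A"
    have fin: "finite A" using A finite_subset[of A ?E] by auto
    have cA: "card A \<le> ?m" using A card_mono[of ?E A] by (simp add: edge_ids_def)
    have m: "card (?E - A) = ?m - card A" using A fin by (simp add: card_Diff_subset edge_ids_def)
    have k: "?k \<ge> 1" by (rule num_components_pos[OF wf])
    have n: "?n \<ge> 1" using wf by (simp add: wf_multigraph_def Suc_le_eq)
    have "?n \<le> card A + ?k" using num_components_card_ge[OF wf, of A] A by auto
    then have "(card A + ?k - ?n) + (?n - 1) = card A + (?k - 1)" using k n by linarith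
    then have "(y - 1) ^ (card A + ?k - ?n) * (y - 1) ^ (?n - 1) = (y - 1) ^ card A * (y - 1) ^ (?k - 1)"
      by (metis power_add)
    then have 1: "(y - 1) ^ (card A + ?k - ?n) = (y - 1) ^ card A * (y - 1) ^ (?k - 1) / (y - 1) ^ (?n - 1)"
      using y by (simp add: field_simps)
    have "1 - 1 / y = (y - 1) / y" using y by (simp add: field_simps)
    moreover have "y ^ ?m = y ^ (?m - card A) * y ^ card A" using cA by (simp flip: power_add)
    ultimately have 2: "y ^ ?m * retention ?E (1 / y) A = (y - 1) ^ card A"
      unfolding retention_def m using y by (simp add: power_divide)
    have "y ^ ?m / (y - 1) ^ (?n - 1) * (retention ?E (1 / y) A * ((x - 1) * (y - 1)) ^ (?k - 1))
      = (y ^ ?m * retention ?E (1 / y) A) * ((x - 1) * (y - 1)) ^ (?k - 1) / (y - 1) ^ (?n - 1)"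
      by simp
    also have "\<dots> = (x - 1) ^ (?k - num_components G ?E) * (y - 1) ^ (card A + ?k - ?n)"
      unfolding 2 1 k1 by (simp add: power_mult_distrib)
    finally show ?thesis by (rule sym)
  qed
  then have "tutte G x y = (\<Sum>A\<in>Pow ?E. y ^ ?m / (y - 1) ^ (?n - 1) *
      (retention ?E (1 / y) A * ((x - 1) * (y - 1)) ^ (num_components G A - 1)))"
    unfolding tutte_def by (rule sum.cong[OF refl])
  also have "\<dots> = y ^ ?m / (y - 1) ^ (?n - 1) *
    mean G (1 / y) (\<lambda>A. ((x - 1) * (y - 1)) ^ (num_components G A - 1))"
    unfolding mean_def by (simp only: sum_distrib_left)
  finally show ?thesis .
qed

section \<open>First and second moments of a sample\<close>

lemma mean_mono:
  assumes "0 \<le> q" "q \<le> 1" "\<And>A. A \<subseteq> edge_ids G \<Longrightarrow> f A \<le> g A"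
  shows "mean G q f \<le> mean G q g"
  unfolding mean_def by (intro sum_mono mult_left_mono retention_nonneg) (use assms in auto)

lemma mean_const_diff: "mean G q (\<lambda>A. f A - c) = mean G q f - c"
  unfolding mean_def right_diff_distrib sum_subtractf sum_distrib_right[symmetric]
  by (simp add: sum_retention)

lemma abs_mean_le:
  assumes "0 \<le> q" "q \<le> 1"
  shows "\<bar>mean G q f\<bar> \<le> mean G q (\<lambda>A. \<bar>f A\<bar>)"
  unfolding mean_def using assms
  by (intro order_trans[OF sum_abs]) (auto simp: abs_mult retention_nonneg)

text \<open>The product of (1 + a) ^ n and (1 - a) ^ n is at most 1, and Bernoulli's inequality
  gives (1 - a) ^ n \<ge> 1 - n a \<ge> 2 / 3.\<close>

lemma power_one_add_le:
  fixes a :: real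
  assumes "a \<ge> 0" "3 * real n * a \<le> 1"
  shows "(1 + a) ^ n \<le> 3 / 2"
proof (cases "n = 0")
  case False
  have "a \<le> n * a" using False assms(1) by (simp add: mult_le_cancel_right1)
  then have a1: "a < 1" using assms by simp
  have "1 + real n * (- a) \<le> (1 + (- a)) ^ n" using a1 by (intro Bernoulli_inequality) auto
  then have 1: "2 / 3 \<le> (1 - a) ^ n" using assms(2) by simp
  have "(1 + a) ^ n * (2 / 3) \<le> (1 + a) ^ n * (1 - a) ^ n" by (rule mult_left_mono[OF 1]) (use assms in simp)
  also have "\<dots> = (1 - a\<^sup>2) ^ n" by (simp flip: power_mult_distrib add: power2_eq_square algebra_simps)
  also have "\<dots> \<le> 1" using a1 assms(1) by (intro power_le_one) (auto simp: power_le_one abs_square_le_1)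
  finally show ?thesis by simp
qed simp

text \<open>Both bounds are read off from the generating function at the positive base W^2: it
  dominates Q^2 for the second moment, and its powers minus 1 dominate the deviation from 1 for the
  first, whatever the sign of Q.\<close>

lemma mean_components_power:
  assumes wf: "wf_multigraph G" and c: "ereal c < ereal_of_enat (edge_connectivity G)" "c \<ge> 0"
    and q: "0 < q" "q \<le> 1" and small: "3 * real (nverts G) * (W\<^sup>2 * q powr (c / 2)) \<le> 1" and W: "\<bar>Q\<bar> + 2 \<le> W"
  shows "mean G q (\<lambda>A. (Q ^ (num_components G A - 1))\<^sup>2) \<le> 3 / 2"
    and "\<bar>mean G q (\<lambda>A. Q ^ (num_components G A - 1)) - 1\<bar> \<le> 1 / 2"
proof -
  let ?j = "\<lambda>A. num_components G A - 1"
  have W2: "W \<ge> 2" using W by linarith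
  then have WW: "W \<le> W\<^sup>2" "1 \<le> W\<^sup>2" using self_le_power[of W 2] by auto
  have "mean G q (\<lambda>A. (W\<^sup>2) ^ ?j A) \<le> (1 + (W\<^sup>2 - 1) * q powr (c / 2)) ^ (nverts G - 1)"
    by (rule mean_components_le) (use wf c q WW in auto)
  also have "\<dots> \<le> (1 + W\<^sup>2 * q powr (c / 2)) ^ (nverts G - 1)"
    by (intro power_mono add_left_mono mult_right_mono) (use WW in auto)
  also have "\<dots> \<le> (1 + W\<^sup>2 * q powr (c / 2)) ^ nverts G"
    by (intro power_increasing) auto
  also have "\<dots> \<le> 3 / 2"
    by (rule power_one_add_le) (use small in auto)
  finally have M: "mean G q (\<lambda>A. (W\<^sup>2) ^ ?j A) \<le> 3 / 2" .
  have "mean G q (\<lambda>A. (Q ^ ?j A)\<^sup>2) \<le> mean G q (\<lambda>A. (W\<^sup>2) ^ ?j A)"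
  proof (rule mean_mono)
    fix A
    have "Q\<^sup>2 \<le> W\<^sup>2" using W by (simp flip: abs_le_square_iff)
    then have "(Q\<^sup>2) ^ ?j A \<le> (W\<^sup>2) ^ ?j A" by (rule power_mono) simp
    then show "(Q ^ ?j A)\<^sup>2 \<le> (W\<^sup>2) ^ ?j A" by (metis power_mult mult.commute)
  qed (use q in auto)
  then show "mean G q (\<lambda>A. (Q ^ ?j A)\<^sup>2) \<le> 3 / 2" using M by linarith
  \<comment> \<open>For j \<ge> 1 the margin 2 in \<open>W\<close> gives \<bar>Q\<bar> ^ j + 2 \<le>
    (\<bar>Q\<bar> + 2) ^ j, which covers \<bar>Q ^ j - 1\<bar> \<le> \<bar>Q\<bar> ^ j + 1. For j =
    0 both sides vanish, so that connected outcomes do not enter the error.\<close>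
  have pw: "\<bar>Q ^ j - 1\<bar> \<le> (W\<^sup>2) ^ j - 1" for j
  proof (cases j)
    case (Suc i)
    have "\<bar>Q\<bar> ^ j + 2 \<le> (\<bar>Q\<bar> + 2) ^ j" unfolding Suc
    proof (induction i)
      case (Suc i)
      have "\<bar>Q\<bar> ^ Suc (Suc i) + 2 \<le> (\<bar>Q\<bar> + 2) * (\<bar>Q\<bar> ^ Suc i + 2)"
        by (simp add: algebra_simps)
      also have "\<dots> \<le> (\<bar>Q\<bar> + 2) * (\<bar>Q\<bar> + 2) ^ Suc i" by (intro mult_left_mono Suc) auto
      finally show ?case by simp
    qed simp
    also have "\<dots> \<le> (W\<^sup>2) ^ j" using W WW by (intro power_mono) auto
    finally have "\<bar>Q ^ j\<bar> + 2 \<le> (W\<^sup>2) ^ j" by (simp add: power_abs)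
    then show ?thesis by linarith
  qed simp
  have "\<bar>mean G q (\<lambda>A. Q ^ ?j A) - 1\<bar> = \<bar>mean G q (\<lambda>A. Q ^ ?j A - 1)\<bar>"
    by (simp add: mean_const_diff)
  also have "\<dots> \<le> mean G q (\<lambda>A. \<bar>Q ^ ?j A - 1\<bar>)" using q by (intro abs_mean_le) auto
  also have "\<dots> \<le> mean G q (\<lambda>A. (W\<^sup>2) ^ ?j A - 1)" using q pw by (intro mean_mono) auto
  also have "\<dots> \<le> 1 / 2" unfolding mean_const_diff using M by linarith
  finally show "\<bar>mean G q (\<lambda>A. Q ^ ?j A) - 1\<bar> \<le> 1 / 2" .
qed

section \<open>The connectivity threshold\<close>

text \<open>With L = ln (n (1 + \<bar>x\<bar>) y), the choice makes (1 / y) powr (c / 2) equal to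
  exp (- (6 + 2 L)). The part 2 L cancels the square of W = 4 (1 + \<bar>x\<bar>) y and the factor
  n; the part 6 leaves exp 6 \<ge> 2^6 against 3 * 4^2 = 48.\<close>

definition conn_bound :: "real \<Rightarrow> real \<Rightarrow> nat \<Rightarrow> real" where
  "conn_bound x y n = (12 + 4 * ln (real n * (1 + \<bar>x\<bar>) * y)) / ln y"

lemma ln_arg_ge:
  assumes "y > 1" "n \<ge> 1"
  shows "ln y \<le> ln (real n * (1 + \<bar>x\<bar>) * y)"
proof -
  have "1 * 1 \<le> real n * (1 + \<bar>x\<bar>)" using assms by (intro mult_mono) auto
  then have "1 * y \<le> real n * (1 + \<bar>x\<bar>) * y" using assms by (intro mult_right_mono) auto
  then show ?thesis using assms by simp
qed

lemma conn_bound_nonneg: "y > 1 \<Longrightarrow> n \<ge> 1 \<Longrightarrow> conn_bound x y n \<ge> 0"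
  using ln_arg_ge[of y n x] ln_gt_zero[of y] unfolding conn_bound_def
  by (intro divide_nonneg_pos) linarith+

lemma conn_bound_small:
  assumes y: "y > 1" and n: "n \<ge> 1" and q: "0 < q" "q \<le> 1 / y"
  shows "3 * real n * ((4 * (1 + \<bar>x\<bar>) * y)\<^sup>2 * q powr (conn_bound x y n / 2)) \<le> 1"
proof -
  let ?L = "ln (real n * (1 + \<bar>x\<bar>) * y)"
  have x: "1 + \<bar>x\<bar> > 0" by linarith
  have "q powr (conn_bound x y n / 2) \<le> (1 / y) powr (conn_bound x y n / 2)"
    using conn_bound_nonneg[OF y n, of x] q by (intro powr_mono2) auto
  also have "\<dots> = exp (- (6 + 2 * ?L))"
    using y by (simp add: powr_def conn_bound_def ln_div) (simp add: field_simps)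
  also have "\<dots> = inverse (exp 6 * (real n * (1 + \<bar>x\<bar>) * y)\<^sup>2)"
  proof -
    have "exp (2 * ln z) = z\<^sup>2" if "z > 0" for z :: real using that by (simp add: exp_double)
    moreover have "real n * (1 + \<bar>x\<bar>) * y > 0" using y n x by simp
    ultimately show ?thesis by (simp only: exp_minus exp_add)
  qed
  finally have 1: "q powr (conn_bound x y n / 2) \<le> inverse (exp 6 * (real n * (1 + \<bar>x\<bar>) * y)\<^sup>2)" .
  have "(2::real) ^ 6 \<le> exp 1 ^ 6" using exp_ge_add_one_self[of 1] by (intro power_mono) auto
  then have e6: "exp (6::real) \<ge> 48" by (simp flip: exp_of_nat_mult)
  have "3 * real n * ((4 * (1 + \<bar>x\<bar>) * y)\<^sup>2 * q powr (conn_bound x y n / 2))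
    \<le> 3 * real n * ((4 * (1 + \<bar>x\<bar>) * y)\<^sup>2 * inverse (exp 6 * (real n * (1 + \<bar>x\<bar>) * y)\<^sup>2))"
    by (intro mult_left_mono 1) auto
  also have "\<dots> = 48 / (exp 6 * n)"
  proof -
    have "3 * real n * ((4 * u * y)\<^sup>2 * inverse (exp 6 * (real n * u * y)\<^sup>2)) = 48 / (exp 6 * n)"
      if "u > 0" for u using that y n by (simp add: field_simps power2_eq_square)
    then show ?thesis using x .
  qed
  also have "\<dots> \<le> 1"
  proof -
    have "48 * 1 \<le> exp 6 * real n" using e6 n by (intro mult_mono) auto
    then show ?thesis using n by (simp add: field_simps)
  qed
  finally show ?thesis .
qed

text \<open>Uniformity needs y to stay away from 1: then L \<ge> ln y \<ge> ln y0 > 0, which absorbs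
  the additive 12 into L and bounds the denominator from below. The factor y comes from 1 \<le>
  y.\<close>

lemma conn_bound_bigo:
  assumes y0: "y0 > 1"
  shows "(\<lambda>(x, y, n). conn_bound x y n) \<in> O[principal {(x, y, n). y \<ge> y0 \<and> n \<ge> 1}](
           \<lambda>(x, y, n). y * ln (real n * (1 + \<bar>x\<bar>) * y))"
proof (rule bigoI)
  let ?C = "(12 / ln y0 + 4) / ln y0"
  have "norm (conn_bound x y n) \<le> ?C * norm (y * ln (real n * (1 + \<bar>x\<bar>) * y))"
    if "y \<ge> y0" "n \<ge> 1" for x y :: real and n :: nat
  proof -
    let ?L = "ln (real n * (1 + \<bar>x\<bar>) * y)"
    have y: "y > 1" using that y0 by linarith
    have l0: "0 < ln y0" "ln y0 \<le> ln y" using y0 that by auto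
    have L: "ln y0 \<le> ?L" using ln_arg_ge[OF y that(2), of x] l0 by linarith
    have "12 * ln y0 \<le> 12 * ?L" using L by simp
    then have 1: "12 + 4 * ?L \<le> (12 / ln y0 + 4) * ?L" using l0 by (simp add: field_simps)
    have "conn_bound x y n \<le> (12 + 4 * ?L) / ln y0"
      unfolding conn_bound_def using l0 L by (intro divide_left_mono) auto
    also have "\<dots> \<le> (12 / ln y0 + 4) * ?L / ln y0" using 1 l0 by (intro divide_right_mono) auto
    also have "\<dots> = ?C * (1 * ?L)" by simp
    also have "\<dots> \<le> ?C * (y * ?L)" using y L l0 by (intro mult_left_mono mult_right_mono) auto
    also have "\<dots> = ?C * norm (y * ?L)" using y L l0 by (simp add: abs_mult)
    finally show ?thesis using conn_bound_nonneg[OF y that(2), of x] by simp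
  qed
  then show "\<forall>\<^sub>F z in principal {(x, y, n). y \<ge> y0 \<and> n \<ge> 1}.
      norm (case z of (x, y, n) \<Rightarrow> conn_bound x y n) \<le>
      ?C * norm (case z of (x, y, n) \<Rightarrow> y * ln (real n * (1 + \<bar>x\<bar>) * y))"
    by (auto simp: eventually_principal)
qed

section \<open>Stability of the Tutte polynomial under rounding of its arguments\<close>

lemma abs_power_diff_le:
  fixes a b :: real
  assumes "\<bar>a\<bar> \<le> M" "\<bar>b\<bar> \<le> M" "M \<ge> 1" "\<bar>a - b\<bar> \<le> \<delta>"
  shows "\<bar>a ^ i - b ^ i\<bar> \<le> i * M ^ i * \<delta>"
proof (induction i)
  case (Suc i)
  have "a ^ Suc i - b ^ Suc i = a * (a ^ i - b ^ i) + (a - b) * b ^ i" by (simp add: algebra_simps)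
  then have "\<bar>a ^ Suc i - b ^ Suc i\<bar> \<le> \<bar>a\<bar> * \<bar>a ^ i - b ^ i\<bar> + \<bar>a - b\<bar> * \<bar>b\<bar> ^ i"
    by (metis abs_mult abs_triangle_ineq power_abs)
  also have "\<dots> \<le> M * (i * M ^ i * \<delta>) + \<delta> * M ^ i"
    by (intro add_mono mult_mono power_mono Suc) (use assms in auto)
  also have "\<delta> * M ^ i \<le> \<delta> * M ^ Suc i"
    by (intro mult_left_mono power_increasing) (use assms in auto)
  finally show ?case by (simp add: algebra_simps)
qed simp

text \<open>A crude Lipschitz bound, summed over all edge sets. The constant is exponential, but its
  logarithm is polynomial in the size of the graph, and only that enters the number of bits.\<close>

lemma tutte_diff_le:
  assumes wf: "wf_multigraph G" and k1: "num_components G (edge_ids G) = 1" and M: "M \<ge> 1"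
    and b: "\<bar>x - 1\<bar> \<le> M" "\<bar>x' - 1\<bar> \<le> M" "\<bar>y - 1\<bar> \<le> M" "\<bar>y' - 1\<bar> \<le> M"
    and d: "\<bar>x' - x\<bar> \<le> \<delta>" "\<bar>y' - y\<bar> \<le> \<delta>"
  defines "L \<equiv> nverts G + length (edges G)"
  shows "\<bar>tutte G x' y' - tutte G x y\<bar> \<le> 2 ^ length (edges G) * (L * M ^ L * \<delta>)"
proof -
  let ?E = "edge_ids G"
  let ?i = "\<lambda>A. num_components G A - num_components G ?E" and ?j = "\<lambda>A. card A + num_components G A - nverts G"
  have d0: "\<delta> \<ge> 0" using d by linarith
  have term_le: "\<bar>(x' - 1) ^ ?i A * (y' - 1) ^ ?j A - (x - 1) ^ ?i A * (y - 1) ^ ?j A\<bar> \<le> L * M ^ L * \<delta>"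
    if A: "A \<in> Pow ?E" for A
  proof -
    let ?i = "?i A" and ?j = "?j A"
    have "card A \<le> length (edges G)" using A card_mono[of ?E A] by (simp add: edge_ids_def)
    then have ij: "?i + ?j \<le> L"
      using num_components_le[of G A] by (simp add: L_def)
    have split: "(x' - 1) ^ ?i * (y' - 1) ^ ?j - (x - 1) ^ ?i * (y - 1) ^ ?j =
      ((x' - 1) ^ ?i - (x - 1) ^ ?i) * (y' - 1) ^ ?j + (x - 1) ^ ?i * ((y' - 1) ^ ?j - (y - 1) ^ ?j)"
      by (simp add: algebra_simps)
    have "\<bar>(x' - 1) ^ ?i * (y' - 1) ^ ?j - (x - 1) ^ ?i * (y - 1) ^ ?j\<bar> \<le>
      \<bar>(x' - 1) ^ ?i - (x - 1) ^ ?i\<bar> * \<bar>y' - 1\<bar> ^ ?j + \<bar>x - 1\<bar> ^ ?i * \<bar>(y' - 1) ^ ?j - (y - 1) ^ ?j\<bar>"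
      unfolding split by (rule order_trans[OF abs_triangle_ineq]) (simp add: abs_mult power_abs)
    also have "\<dots> \<le> (?i * M ^ ?i * \<delta>) * M ^ ?j + M ^ ?i * (?j * M ^ ?j * \<delta>)"
    proof (rule add_mono; rule mult_mono)
      show "\<bar>(x' - 1) ^ ?i - (x - 1) ^ ?i\<bar> \<le> ?i * M ^ ?i * \<delta>"
        by (rule abs_power_diff_le) (use b d M in auto)
      show "\<bar>(y' - 1) ^ ?j - (y - 1) ^ ?j\<bar> \<le> ?j * M ^ ?j * \<delta>"
        by (rule abs_power_diff_le) (use b d M in auto)
      show "\<bar>y' - 1\<bar> ^ ?j \<le> M ^ ?j" "\<bar>x - 1\<bar> ^ ?i \<le> M ^ ?i"
        using b by (auto intro: power_mono)
    qed (use d0 M in auto)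
    also have "\<dots> = real (?i + ?j) * M ^ (?i + ?j) * \<delta>" by (simp add: power_add algebra_simps)
    also have "\<dots> \<le> L * M ^ L * \<delta>"
      using ij M d0 by (intro mult_right_mono mult_mono power_increasing) auto
    finally show ?thesis .
  qed
  have "\<bar>tutte G x' y' - tutte G x y\<bar> \<le> (\<Sum>A\<in>Pow ?E. L * M ^ L * \<delta>)"
    unfolding tutte_def sum_subtractf[symmetric]
    by (rule order_trans[OF sum_abs]) (rule sum_mono[OF term_le])
  also have "\<dots> = 2 ^ length (edges G) * (L * M ^ L * \<delta>)" by (simp add: card_Pow edge_ids_def)
  finally show ?thesis .
qed

section \<open>Chebyshev's inequality for sums of independent samples\<close>

lemma expectation_bind:
  assumes "finite (set_pmf p)" "\<And>x. x \<in> set_pmf p \<Longrightarrow> finite (set_pmf (f x))"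
  shows "measure_pmf.expectation (bind_pmf p f) h =
    measure_pmf.expectation p (\<lambda>x. measure_pmf.expectation (f x) (h :: 'b \<Rightarrow> real))"
proof -
  have "measure_pmf.expectation p (\<lambda>x. measure_pmf.expectation (f x) h)
    = (\<Sum>a\<in>set_pmf p. measure_pmf.expectation (f a) h * pmf p a)"
    by (rule integral_measure_pmf_real) (use assms in auto)
  then show ?thesis using pmf_expectation_bind[of "set_pmf p" f p h] assms by (simp add: mult.commute)
qed

lemma finite_set_down:
  assumes "\<And>r x. finite (set_pmf (f r x))"
  shows "finite (set_pmf (down f k x))"
  by (induction k arbitrary: x) (auto simp: assms)

text \<open>The offset \<open>d\<close> carries the induction: once the first sample is drawn, its
  centred value is added to the offset of the remaining ones. Averaging gives the variance, which is
  at most the raw second moment \<open>V\<close>.\<close>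

lemma second_moment_sum:
  fixes h :: "'a \<Rightarrow> int"
  assumes fin: "finite (set_pmf p)"
    and \<mu>: "\<mu> = measure_pmf.expectation p (\<lambda>a. real_of_int (h a))"
    and V: "measure_pmf.expectation p (\<lambda>a. (real_of_int (h a))\<^sup>2) \<le> V"
  shows "measure_pmf.expectation (down (\<lambda>_ S. map_pmf (\<lambda>a. S + h a) p) N S0)
     (\<lambda>S. (real_of_int S - real_of_int S0 - real N * \<mu> + d)\<^sup>2) \<le> real N * V + d\<^sup>2"
proof (induction N arbitrary: S0 d)
  case (Suc N)
  let ?f = "\<lambda>(_::nat) S. map_pmf (\<lambda>a. S + h a) p"
  let ?E = "measure_pmf.expectation p"
  have int: "integrable p g" for g :: "'a \<Rightarrow> real" using fin by (rule integrable_measure_pmf_finite)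
  have "measure_pmf.expectation (down ?f (Suc N) S0) (\<lambda>S. (real_of_int S - real_of_int S0 - real (Suc N) * \<mu> + d)\<^sup>2)
    = ?E (\<lambda>a. measure_pmf.expectation (down ?f N (S0 + h a)) (\<lambda>S. (real_of_int S - real_of_int S0 - real (Suc N) * \<mu> + d)\<^sup>2))"
    by (simp add: bind_map_pmf expectation_bind fin finite_set_down)
  also have "\<dots> = ?E (\<lambda>a. measure_pmf.expectation (down ?f N (S0 + h a))
      (\<lambda>S. (real_of_int S - real_of_int (S0 + h a) - real N * \<mu> + (real_of_int (h a) - \<mu> + d))\<^sup>2))"
    by (simp add: algebra_simps)
  also have "\<dots> \<le> ?E (\<lambda>a. real N * V + (real_of_int (h a) - \<mu> + d)\<^sup>2)"
    by (intro integral_mono int Suc)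
  also have "\<dots> = ?E (\<lambda>a. (N * V + (d - \<mu>)\<^sup>2) + ((real_of_int (h a))\<^sup>2 + 2 * (d - \<mu>) * real_of_int (h a)))"
    by (simp add: power2_eq_square algebra_simps)
  also have "\<dots> = (N * V + (d - \<mu>)\<^sup>2) + (?E (\<lambda>a. (real_of_int (h a))\<^sup>2) + 2 * (d - \<mu>) * \<mu>)"
    unfolding \<mu> by (simp add: int measure_pmf.prob_space)
  also have "\<dots> \<le> real (Suc N) * V + d\<^sup>2 - \<mu>\<^sup>2" using V by (simp add: power2_eq_square algebra_simps)
  also have "\<dots> \<le> real (Suc N) * V + d\<^sup>2" by simp
  finally show ?case .
qed simp

lemma prob_sum_deviation:
  fixes h :: "'a \<Rightarrow> int"
  assumes fin: "finite (set_pmf p)"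
    and \<mu>: "\<mu> = measure_pmf.expectation p (\<lambda>a. real_of_int (h a))"
    and V: "measure_pmf.expectation p (\<lambda>a. (real_of_int (h a))\<^sup>2) \<le> V" and e: "e > 0"
  shows "measure_pmf.prob (down (\<lambda>_ S. map_pmf (\<lambda>a. S + h a) p) N 0) {S. \<bar>real_of_int S - real N * \<mu>\<bar> < e}
    \<ge> 1 - real N * V / e\<^sup>2"
proof -
  let ?D = "down (\<lambda>_ S. map_pmf (\<lambda>a. S + h a) p) N 0"
  have fD: "finite (set_pmf ?D)" by (rule finite_set_down) (simp add: fin)
  have "measure_pmf.prob ?D {S\<in>space ?D. \<bar>real_of_int S - real N * \<mu>\<bar> \<ge> e}
    \<le> measure_pmf.expectation ?D (\<lambda>S. (real_of_int S - real N * \<mu>)\<^sup>2) / e\<^sup>2"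
    by (rule measure_pmf.second_moment_method) (use e fD in \<open>auto intro: integrable_measure_pmf_finite\<close>)
  also have "\<dots> \<le> real N * V / e\<^sup>2"
    using second_moment_sum[OF fin \<mu> V, of N 0 0] by (intro divide_right_mono) auto
  finally have 1: "measure_pmf.prob ?D {S. \<bar>real_of_int S - real N * \<mu>\<bar> \<ge> e} \<le> real N * V / e\<^sup>2" by simp
  have "{S. \<bar>real_of_int S - real N * \<mu>\<bar> < e} = - {S. \<bar>real_of_int S - real N * \<mu>\<bar> \<ge> e}" by auto
  then have "measure_pmf.prob ?D {S. \<bar>real_of_int S - real N * \<mu>\<bar> < e} = 1 - measure_pmf.prob ?D {S. \<bar>real_of_int S - real N * \<mu>\<bar> \<ge> e}"
    using measure_pmf.prob_compl[of "{S. \<bar>real_of_int S - real N * \<mu>\<bar> \<ge> e}" ?D] by (simp add: Compl_eq_Diff_UNIV)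
  then show ?thesis using 1 by linarith
qed

section \<open>Exact sampling of edge sets from fair bits\<close>

definition random_edges :: "real \<Rightarrow> nat \<Rightarrow> nat set pmf" where
  "random_edges p m = down (\<lambda>i A. map_pmf (\<lambda>b. if b then insert i A else A) (bernoulli_pmf p)) m {}"

lemma finite_set_random_edges: "finite (set_pmf (random_edges p m))"
  unfolding random_edges_def by (rule finite_set_down) (auto intro: finite_subset[of _ UNIV])

text \<open>For the induction the loop starts from an arbitrary set \<open>X\<close> of edges
  decided earlier; the subsets of {..<m + 1} split according to whether they contain
  \<open>m\<close>.\<close>

lemma expectation_random_edges:
  assumes "0 \<le> q" "q \<le> 1"
  shows "measure_pmf.expectation (random_edges (1 - q) m) f =
    (\<Sum>A\<in>Pow {..<m}. retention {..<m} q A * f A)"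
proof -
  let ?f = "\<lambda>i A. map_pmf (\<lambda>b. if b then insert i A else A) (bernoulli_pmf (1 - q))"
  have "measure_pmf.expectation (down ?f m X) f = (\<Sum>A\<in>Pow {..<m}. retention {..<m} q A * f (A \<union> X))" for X
  proof (induction m arbitrary: X)
    case 0
    show ?case by (simp add: retention_def)
  next
    case (Suc m)
    have fin: "finite (set_pmf (?f i A))" for i A by (auto intro: finite_subset[of _ UNIV])
    have "measure_pmf.expectation (down ?f (Suc m) X) f =
      measure_pmf.expectation (bernoulli_pmf (1 - q)) (\<lambda>b. measure_pmf.expectation (down ?f m (if b then insert m X else X)) f)"
      by (simp add: expectation_bind bind_map_pmf finite_set_down fin finite_subset[of _ UNIV])
    also have "\<dots> = (1 - q) * (\<Sum>A\<in>Pow {..<m}. retention {..<m} q A * f (A \<union> insert m X))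
        + q * (\<Sum>A\<in>Pow {..<m}. retention {..<m} q A * f (A \<union> X))"
      using assms by (simp add: Suc)
    also have "\<dots> = (\<Sum>A\<in>Pow {..<Suc m}. retention {..<Suc m} q A * f (A \<union> X))"
    proof -
      have ins: "{..<Suc m} = insert m {..<m}" by auto
      have "(\<Sum>A\<in>Pow {..<Suc m}. retention {..<Suc m} q A * f (A \<union> X)) =
        (\<Sum>A\<in>Pow {..<m}. retention {..<Suc m} q A * f (A \<union> X)) +
        (\<Sum>A\<in>insert m ` Pow {..<m}. retention {..<Suc m} q A * f (A \<union> X))"
        unfolding ins Pow_insert by (rule sum.union_disjoint) auto
      also have "(\<Sum>A\<in>insert m ` Pow {..<m}. retention {..<Suc m} q A * f (A \<union> X)) =
        (\<Sum>A\<in>Pow {..<m}. retention {..<Suc m} q (insert m A) * f (insert m A \<union> X))"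
        by (subst sum.reindex) (auto simp: inj_on_def intro!: insert_ident[THEN iffD1])
      also have "\<dots> = (1 - q) * (\<Sum>A\<in>Pow {..<m}. retention {..<m} q A * f (A \<union> insert m X))"
        unfolding sum_distrib_left
      proof (rule sum.cong[OF refl])
        fix A assume A: "A \<in> Pow {..<m}"
        then have "finite A" "m \<notin> A" using finite_subset[of A "{..<m}"] by auto
        moreover have "{..<Suc m} - insert m A = {..<m} - A" by auto
        ultimately show "retention {..<Suc m} q (insert m A) * f (insert m A \<union> X) =
          (1 - q) * (retention {..<m} q A * f (A \<union> insert m X))"
          by (simp add: retention_def)
      qed
      also have "(\<Sum>A\<in>Pow {..<m}. retention {..<Suc m} q A * f (A \<union> X)) =
        q * (\<Sum>A\<in>Pow {..<m}. retention {..<m} q A * f (A \<union> X))"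
        unfolding sum_distrib_left
      proof (rule sum.cong[OF refl])
        fix A assume A: "A \<in> Pow {..<m}"
        then have "{..<Suc m} - A = insert m ({..<m} - A)" by auto
        then show "retention {..<Suc m} q A * f (A \<union> X) = q * (retention {..<m} q A * f (A \<union> X))"
          by (simp add: retention_def)
      qed
      finally show ?thesis by simp
    qed
    finally show ?case .
  qed
  from this[of "{}"] show ?thesis by (simp add: random_edges_def)
qed

text \<open>Bits arrive most significant first, and the values still reachable from \<open>u\<close>
  form a block. The next bit chooses one of its two halves, which have equal size.\<close>

lemma down_bits:
  "down (\<lambda>_ u. map_pmf (\<lambda>b. 2 * u + of_bool b) (pmf_of_set UNIV)) B u =
     pmf_of_set {u * 2 ^ B..<(u + 1) * 2 ^ B :: int}"
proof (induction B arbitrary: u)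
  case 0
  have "{u..<u + 1} = {u}" by auto
  then show ?case by (simp add: pmf_of_set_singleton)
next
  case (Suc B)
  let ?S = "\<lambda>b. {(2 * u + of_bool b) * 2 ^ B..<((2 * u + of_bool b) + 1) * 2 ^ B :: int}"
  have "(\<Union>b\<in>UNIV. ?S b) = {u * 2 ^ Suc B..<(u + 1) * 2 ^ Suc B}"
    by (auto simp: UNIV_bool algebra_simps)
  moreover have "pmf_of_set (\<Union>b\<in>UNIV. ?S b) = pmf_of_set UNIV \<bind> (\<lambda>b. pmf_of_set (?S b))"
  proof (rule pmf_of_set_UN)
    show "disjoint_family_on ?S UNIV"
      by (auto simp: disjoint_family_on_def UNIV_bool algebra_simps)
    show "card (?S b) = 2 ^ B" for b
      by (simp add: algebra_simps nat_power_eq)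
  qed (auto simp: algebra_simps)
  ultimately show ?case by (simp add: bind_map_pmf Suc)
qed

text \<open>A dyadic probability is attained exactly by comparing \<open>B\<close> fair bits with a
  threshold. Without a rejection loop the number of flips is fixed, and the program halts with
  certainty.\<close>

lemma map_bits_bernoulli:
  assumes "0 \<le> R" "R \<le> 2 ^ B"
  shows "map_pmf (\<lambda>u. u \<ge> R) (down (\<lambda>_ u. map_pmf (\<lambda>b. 2 * u + of_bool b) (pmf_of_set UNIV)) B 0)
     = bernoulli_pmf (1 - real_of_int R / 2 ^ B)"
proof -
  let ?p = "map_pmf (\<lambda>u. u \<ge> R) (pmf_of_set {0..<2 ^ B :: int})"
  have ne: "{0..<2 ^ B :: int} \<noteq> {}" by simp
  have "real_of_int R \<le> real_of_int (2 ^ B)" using assms(2) by (simp only: of_int_le_iff)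
  then have R: "real_of_int R \<le> 2 ^ B" by simp
  have i: "{0..<2 ^ B} \<inter> ((\<lambda>u. u \<ge> R) -` {True}) = {R..<2 ^ B}"
  proof (rule set_eqI)
    fix u
    have "0 \<le> u" if "R \<le> u" using assms(1) that by (rule order_trans)
    then show "u \<in> {0..<2 ^ B} \<inter> ((\<lambda>u. u \<ge> R) -` {True}) \<longleftrightarrow> u \<in> {R..<2 ^ B}"
      unfolding Int_iff vimage_eq atLeastLessThan_iff insert_iff empty_iff by blast
  qed
  have "pmf ?p True = real (card {R..<2 ^ B}) / real (card {0..<2 ^ B :: int})"
    unfolding pmf_map measure_pmf_of_set[OF ne finite_atLeastLessThan_int] i ..
  also have "real (card {R..<2 ^ B}) = 2 ^ B - R"
  proof -
    have "int (card {R..<2 ^ B}) = 2 ^ B - R" using assms(2) unfolding card_atLeastLessThan_int by simp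
    then have "real_of_int (int (card {R..<2 ^ B})) = real_of_int (2 ^ B - R)" by (simp only:)
    then show ?thesis by (simp del: card_atLeastLessThan_int)
  qed
  also have "real (card {0..<2 ^ B :: int}) = 2 ^ B" by (simp add: nat_power_eq)
  finally have T: "pmf ?p True = 1 - real_of_int R / 2 ^ B" by (simp add: diff_divide_distrib)
  have "pmf ?p False = 1 - pmf ?p True"
    using sum_pmf_eq_1[OF finite[of "UNIV :: bool set"] subset_UNIV, of ?p] by (simp add: UNIV_bool)
  then have "pmf ?p b = pmf (bernoulli_pmf (1 - real_of_int R / 2 ^ B)) b" for b
    using T assms R by (cases b) (simp_all del: map_pmf_of_set_inj)
  then show ?thesis unfolding down_bits by (simp add: pmf_eqI)
qed

section \<open>Accuracy of the estimate\<close>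

text \<open>All roundings push \<open>R\<close> down: \<open>\<lfloor>y * 2 ^ B\<rfloor> + 1\<close>
  overestimates the scaled y, and the division rounds down. Together they lose at most 2 from 2^B /
  y, which is at least 8, so \<open>R\<close> is at least half of it and the error of 2^B / R is of
  order y^2 / 2^B.\<close>

lemma dyadic_inverse:
  fixes y :: real
  assumes y: "y > 1" and E: "E = 2 ^ B" "8 * y\<^sup>2 \<le> 2 ^ B"
    and R: "R = E * E div (\<lfloor>y * 2 ^ B\<rfloor> + 1)"
  shows "0 < R" "R < E" "real_of_int R / 2 ^ B \<le> 1 / y" "y \<le> 2 ^ B / real_of_int R"
    "2 ^ B / real_of_int R \<le> y + 4 * y\<^sup>2 / 2 ^ B"
proof -
  let ?e = "(2::real) ^ B" and ?Y = "\<lfloor>y * 2 ^ B\<rfloor>"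
  have Ee: "real_of_int E = ?e" using E by simp
  have "y * 1 \<le> y * y" using y by (intro mult_left_mono) auto
  then have yy: "y \<le> y\<^sup>2" by (simp add: power2_eq_square)
  have e: "?e \<ge> 8 * y" "?e > 1" using E yy y by linarith+
  have Y: "y * ?e < real_of_int (?Y + 1)" "real_of_int (?Y + 1) \<le> y * ?e + 1" by linarith+
  have Y0: "real_of_int (?Y + 1) > 0" using Y(1) y by (smt (verit) mult_pos_pos zero_less_power)
  have Rq: "real_of_int R \<le> ?e * ?e / real_of_int (?Y + 1)" "?e * ?e / real_of_int (?Y + 1) < real_of_int R + 1"
  proof -
    have "R = \<lfloor>real_of_int (E * E) / real_of_int (?Y + 1)\<rfloor>"
      unfolding R by (rule floor_divide_of_int_eq[symmetric])
    also have "real_of_int (E * E) = ?e * ?e" by (simp only: of_int_mult Ee)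
    finally have "R = \<lfloor>?e * ?e / real_of_int (?Y + 1)\<rfloor>" .
    then show "real_of_int R \<le> ?e * ?e / real_of_int (?Y + 1)" "?e * ?e / real_of_int (?Y + 1) < real_of_int R + 1"
      by linarith+
  qed
  have "?e * ?e / real_of_int (?Y + 1) \<le> ?e * ?e / (y * ?e)"
    using Y Y0 y by (intro divide_left_mono mult_pos_pos) auto
  then have up: "real_of_int R \<le> ?e / y" using Rq(1) by simp
  \<comment> \<open>A linear minorant of e^2 / (y e + 1): multiplied by y e + 1 it gives e^2 - 1 /
    y^2.\<close>
  have "?e / y - 1 / y\<^sup>2 \<le> ?e * ?e / (y * ?e + 1)"
  proof -
    have "(?e / y - 1 / y\<^sup>2) * (y * ?e + 1) = ?e * ?e - 1 / y\<^sup>2"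
      using y by (simp add: field_simps power2_eq_square)
    also have "\<dots> \<le> ?e * ?e" by simp
    finally show ?thesis using y by (simp add: pos_le_divide_eq add_pos_pos)
  qed
  also have "\<dots> \<le> ?e * ?e / real_of_int (?Y + 1)"
    using Y Y0 y by (intro divide_left_mono mult_pos_pos add_pos_pos) auto
  finally have "?e / y - 1 / y\<^sup>2 < real_of_int R + 1" using Rq(2) by linarith
  moreover have "1 / y\<^sup>2 \<le> 1" using y yy by simp
  ultimately have lo: "?e / y - 2 \<le> real_of_int R" by linarith
  have ey: "8 \<le> ?e / y" using e y by (simp add: field_simps)
  then have R0: "real_of_int R > 0" using lo by linarith
  then show "0 < R" by simp
  show "real_of_int R / 2 ^ B \<le> 1 / y" using up y by (simp add: field_simps)
  have "?e / y < ?e" using y by (simp add: field_simps)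
  then have "real_of_int R < real_of_int E" using up Ee by linarith
  then show "R < E" by simp
  show "y \<le> 2 ^ B / real_of_int R" using up y R0 by (simp add: field_simps)
  have "z / 2 \<le> r" if "z - 2 \<le> r" "8 \<le> z" for z r :: real using that by linarith
  from this[OF lo ey] have "?e / y / 2 \<le> real_of_int R" .
  then have "?e / (2 * y) \<le> real_of_int R" by (simp add: field_simps)
  then have y2: "?e / real_of_int R \<le> 2 * y" using y R0 by (simp add: field_simps)
  have "?e / real_of_int R - y = (?e / y - real_of_int R) * y / real_of_int R"
    using y R0 by (simp add: field_simps)
  also have "\<dots> \<le> 2 * y / real_of_int R"
    using lo y R0 by (intro divide_right_mono mult_right_mono) auto
  also have "\<dots> = (?e / real_of_int R) * (2 * y / ?e)" by simp
  also have "\<dots> \<le> (2 * y) * (2 * y / ?e)" using y2 y by (intro mult_right_mono) auto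
  finally show "2 ^ B / real_of_int R \<le> y + 4 * y\<^sup>2 / 2 ^ B" by (simp add: power2_eq_square)
qed

section \<open>Choice of the precision\<close>

text \<open>With M = \<bar>x\<bar> + y + 3, one factor 4 M per vertex and edge pays for the
  Lipschitz constant and another for the lower bound on the Tutte polynomial; hence the square. The
  factor 64 y^2 covers the rounding error 4 y^2 / 2^B and the numerical constants.\<close>

definition precise :: "real \<Rightarrow> real \<Rightarrow> nat \<Rightarrow> bool" where
  "precise x y K \<longleftrightarrow> 64 * y\<^sup>2 * (4 * (\<bar>x\<bar> + y + 3))\<^sup>2 \<le> 2 ^ K"

lemma precise_exists: "\<exists>K. precise x y K"
proof -
  obtain K where "64 * y\<^sup>2 * (4 * (\<bar>x\<bar> + y + 3))\<^sup>2 < 2 ^ K" using real_arch_pow[of 2] by auto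
  then show ?thesis unfolding precise_def by (intro exI[of _ K] less_imp_le)
qed

lemma nat_le_two_power: "real n \<le> 2 ^ n"
  using less_imp_le[OF of_nat_less_two_power[of n]] by simp

text \<open>In the exponent, \<open>L\<close> serves the power and \<open>k\<close> serves the
  factor \<open>k \<le> 2 ^ k\<close>. Precision linear in \<open>k\<close> is affordable because
  the running time may be polynomial in 1 / \<epsilon>, and it spares the program a
  logarithm.\<close>

lemma precise_power:
  assumes K: "precise x y K" and y: "y > 1" and L: "L \<ge> 1" and k: "k \<ge> 1"
  shows "64 * y\<^sup>2 * k * ((4 * (\<bar>x\<bar> + y + 3))\<^sup>2) ^ L \<le> 2 ^ (K * (L + k))"
proof -
  let ?M = "(4 * (\<bar>x\<bar> + y + 3))\<^sup>2"
  have "1 \<le> y\<^sup>2" using y by (intro one_le_power) auto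
  then have a: "64 \<le> 64 * y\<^sup>2" by simp
  have "1 \<le> 4 * (\<bar>x\<bar> + y + 3)" using y by (auto intro: add_nonneg_nonneg)
  then have M: "1 \<le> ?M" by (intro one_le_power) auto
  have "2 * 1 \<le> 64 * y\<^sup>2 * ?M" using a M by (intro mult_mono) auto
  then have K2: "2 \<le> (2::real) ^ K" using K by (simp add: precise_def)
  have "64 * y\<^sup>2 \<le> (64 * y\<^sup>2) ^ L" using a L by (intro self_le_power) auto
  then have "64 * y\<^sup>2 * k * ?M ^ L \<le> (64 * y\<^sup>2) ^ L * 2 ^ k * ?M ^ L"
    using nat_le_two_power[of k] a M by (intro mult_mono) auto
  also have "\<dots> = (64 * y\<^sup>2 * ?M) ^ L * 2 ^ k" by (simp add: power_mult_distrib)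
  also have "\<dots> \<le> (2 ^ K) ^ L * (2 ^ K) ^ k"
    using K K2 a M by (intro mult_mono power_mono) (auto simp: precise_def)
  also have "\<dots> = 2 ^ (K * (L + k))" by (simp add: power_mult power_add)
  finally show ?thesis .
qed

text \<open>
  \<open>K\<close> is hard-coded in the program. It is chosen so large that at precision \<open>2 ^ - (K (n + m + k))\<close>
  the rounding error of \<open>(x, y)\<close> changes the Tutte polynomial by a relative error of at most
  \<open>1 / (4 k)\<close>.
\<close>

locale tutte_sampling =
  fixes G :: multigraph and x y :: real and K k :: nat
  assumes wf: "wf_multigraph G" and y: "y > 1" and K: "precise x y K" and k: "k \<ge> 1"
    and conn: "ereal (conn_bound x y (nverts G)) < ereal_of_enat (edge_connectivity G)"
begin

text \<open>
  The evaluation point is \<open>x' = X / E\<close>, \<open>y' = E / R\<close>. Then \<open>a / D = x' - 1\<close>, \<open>b / D = 1 / (y' - 1)\<close>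
  and \<open>a / b = (x' - 1) (y' - 1)\<close>, so \<open>h A / D ^ (n - 1)\<close> is an unbiased sample of
  \<open>T(G; x', y') / y' ^ m\<close> with an integral numerator.
\<close>

definition n :: nat where "n = nverts G"
definition m :: nat where "m = length (edges G)"
definition B :: nat where "B = K * (n + m + k)"
definition E :: int where "E = 2 ^ B"
definition X :: int where "X = \<lfloor>x * 2 ^ B\<rfloor>"
definition R :: int where "R = E * E div (\<lfloor>y * 2 ^ B\<rfloor> + 1)"
definition a :: int where "a = (X - E) * (E - R)"
definition b :: int where "b = R * E"
definition D :: int where "D = E * (E - R)"
definition N :: nat where "N = 512 * k * k"
definition h :: "nat set \<Rightarrow> int" where "h A = a ^ (num_components G A - 1) * b ^ (n - num_components G A)"

definition samples :: "int pmf" where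
  "samples = down (\<lambda>_ S. map_pmf (\<lambda>A. S + h A) (random_edges (1 - real_of_int R / 2 ^ B) m)) N 0"

definition estimate :: "int \<Rightarrow> real" where
  "estimate S = real_of_int (S * E ^ m) / real_of_int (int N * R ^ m * D ^ (n - 1))"

lemma n1: "n \<ge> 1" using wf by (simp add: n_def wf_multigraph_def Suc_le_eq)

lemma precision: "64 * y\<^sup>2 * k * ((4 * (\<bar>x\<bar> + y + 3))\<^sup>2) ^ (n + m) \<le> 2 ^ B"
  unfolding B_def by (rule precise_power) (use K y n1 k in auto)

lemma precision': "64 * y\<^sup>2 \<le> 2 ^ B"
proof -
  have "1 \<le> 4 * (\<bar>x\<bar> + y + 3)" using y by (auto intro: add_nonneg_nonneg)
  then have "1 \<le> ((4 * (\<bar>x\<bar> + y + 3))\<^sup>2) ^ (n + m)" by (intro one_le_power) auto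
  then have "64 * y\<^sup>2 * 1 * 1 \<le> 64 * y\<^sup>2 * k * ((4 * (\<bar>x\<bar> + y + 3))\<^sup>2) ^ (n + m)"
    using k by (intro mult_mono) auto
  then show ?thesis using precision by simp
qed

lemma R_props: "0 < R" "R < E" "real_of_int R / 2 ^ B \<le> 1 / y" "y \<le> 2 ^ B / real_of_int R"
    "2 ^ B / real_of_int R \<le> y + 4 * y\<^sup>2 / 2 ^ B"
proof -
  have "8 * y\<^sup>2 \<le> 2 ^ B" using precision' zero_le_power2[of y] by linarith
  from dyadic_inverse[OF y E_def this R_def]
  show "0 < R" "R < E" "real_of_int R / 2 ^ B \<le> 1 / y" "y \<le> 2 ^ B / real_of_int R"
    "2 ^ B / real_of_int R \<le> y + 4 * y\<^sup>2 / 2 ^ B" .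
qed

lemma E_real: "real_of_int E = 2 ^ B" by (simp add: E_def)

definition x' :: real where "x' = real_of_int X / 2 ^ B"
definition y' :: real where "y' = 2 ^ B / real_of_int R"
definition q where "q = real_of_int R / 2 ^ B"

lemma q_bounds: "0 < q" "q \<le> 1 / y" "q \<le> 1" "q = 1 / y'"
proof -
  show "0 < q" "q \<le> 1 / y" "q = 1 / y'" using R_props by (auto simp: q_def y'_def)
  moreover have "1 / y \<le> 1" using y by simp
  ultimately show "q \<le> 1" by linarith
qed

lemma x'_bounds: "x - 1 / 2 ^ B \<le> x'" "x' \<le> x"
proof -
  have "real_of_int X \<le> x * 2 ^ B" "x * 2 ^ B - 1 \<le> real_of_int X" unfolding X_def by linarith+
  then have "(x * 2 ^ B - 1) / 2 ^ B \<le> x'" "x' \<le> x * 2 ^ B / 2 ^ B"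
    unfolding x'_def by (intro divide_right_mono; simp)+
  then show "x - 1 / 2 ^ B \<le> x'" "x' \<le> x" by (simp_all add: diff_divide_distrib)
qed

lemma y'_bounds: "y \<le> y'" "y' \<le> y + 4 * y\<^sup>2 / 2 ^ B" "1 < y'"
  using R_props(4,5) y less_le_trans[OF y R_props(4)] by (simp_all only: y'_def)

lemma precision_small: "1 / 2 ^ B \<le> (1::real)" "4 * y\<^sup>2 / 2 ^ B \<le> 1" "1 / 2 ^ B \<le> 4 * y\<^sup>2 / 2 ^ B"
proof -
  have "1 \<le> y\<^sup>2" using y by (intro one_le_power) auto
  then show "1 / 2 ^ B \<le> 4 * y\<^sup>2 / 2 ^ B" by (intro divide_right_mono) auto
  show "4 * y\<^sup>2 / 2 ^ B \<le> 1"
  proof (subst divide_le_eq_1_pos)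
    show "4 * y\<^sup>2 \<le> 2 ^ B" using precision' zero_le_power2[of y] by linarith
  qed simp
qed simp

lemma k1: "num_components G (edge_ids G) = 1"
  using num_components_edge_ids[OF wf conn conn_bound_nonneg] y n1 by (simp add: n_def)

text \<open>Stated for every failure probability up to 1 / y, because it is applied both at the true
  point and at the rounded one.\<close>

lemma mean_bounds:
  assumes "0 < p" "p \<le> 1 / y" "\<bar>Q\<bar> + 2 \<le> 4 * (1 + \<bar>x\<bar>) * y"
  shows "mean G p (\<lambda>A. (Q ^ (num_components G A - 1))\<^sup>2) \<le> 3 / 2"
    and "\<bar>mean G p (\<lambda>A. Q ^ (num_components G A - 1)) - 1\<bar> \<le> 1 / 2"
proof -
  have "1 / y \<le> 1" using y by simp
  then have p: "p \<le> 1" using assms by linarith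
  note * = mean_components_power[OF wf conn _ assms(1) p conn_bound_small assms(3)]
  show "mean G p (\<lambda>A. (Q ^ (num_components G A - 1))\<^sup>2) \<le> 3 / 2"
    and "\<bar>mean G p (\<lambda>A. Q ^ (num_components G A - 1)) - 1\<bar> \<le> 1 / 2"
    using * assms y n1 conn_bound_nonneg by (auto simp: n_def)
qed

definition Q where "Q = (x' - 1) * (y' - 1)"

text \<open>The bounds \<bar>x\<bar> + 2 and y, instead of \<bar>x\<bar> + 1 and y - 1, leave room
  for a rounding error of up to 1 in each coordinate.\<close>

lemma abs_mult_bound:
  assumes "\<bar>u\<bar> \<le> \<bar>x\<bar> + 2" "0 \<le> v" "v \<le> y"
  shows "\<bar>u * v\<bar> + 2 \<le> 4 * (1 + \<bar>x\<bar>) * y"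
proof -
  have "\<bar>u * v\<bar> \<le> (\<bar>x\<bar> + 2) * y" unfolding abs_mult using assms by (intro mult_mono) auto
  moreover have "\<bar>x\<bar> * 1 \<le> \<bar>x\<bar> * y" using y by (intro mult_left_mono) auto
  ultimately show ?thesis using y by (simp add: algebra_simps)
qed

lemma Q_bound: "\<bar>Q\<bar> + 2 \<le> 4 * (1 + \<bar>x\<bar>) * y"
  unfolding Q_def by (rule abs_mult_bound) (use x'_bounds y'_bounds precision_small y in linarith)+

text \<open>The mean is at least 1 / 2. This positive lower bound is what converts the absolute
  rounding error into a relative one.\<close>

lemma tutte_ge: "1 / 2 * (y ^ m / (y - 1) ^ (n - 1)) \<le> tutte G x y"
proof -
  let ?c = "y ^ m / (y - 1) ^ (n - 1)"
  have c: "?c > 0" using y by simp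
  have "\<bar>(x - 1) * (y - 1)\<bar> + 2 \<le> 4 * (1 + \<bar>x\<bar>) * y" by (rule abs_mult_bound) (use y in auto)
  have half: "1 / 2 \<le> z" if "\<bar>z - 1\<bar> \<le> 1 / 2" for z :: real using that by linarith
  from \<open>\<bar>(x - 1) * (y - 1)\<bar> + 2 \<le> 4 * (1 + \<bar>x\<bar>) * y\<close>
  have "1 / 2 \<le> mean G (1 / y) (\<lambda>A. ((x - 1) * (y - 1)) ^ (num_components G A - 1))" (is "_ \<le> ?mu")
    using y by (intro half mean_bounds(2)) auto
  then have "1 / 2 * ?c \<le> ?c * ?mu" using c by (subst mult.commute) (intro mult_left_mono, auto)
  then show ?thesis unfolding tutte_eq_mean[OF wf k1 y] n_def m_def .
qed

lemma tutte_approx: "\<bar>tutte G x' y' - tutte G x y\<bar> \<le> tutte G x y / (4 * k)"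
proof -
  define M where "M = \<bar>x\<bar> + y + 3"
  define L where "L = n + m"
  have M: "M \<ge> 1" using y by (simp add: M_def)
  have "\<bar>tutte G x' y' - tutte G x y\<bar> \<le> 2 ^ length (edges G) * ((nverts G + length (edges G)) * M ^ (nverts G + length (edges G)) * (4 * y\<^sup>2 / 2 ^ B))"
  proof (rule tutte_diff_le[OF wf k1 M])
    show "\<bar>x - 1\<bar> \<le> M" "\<bar>x' - 1\<bar> \<le> M" "\<bar>y - 1\<bar> \<le> M" "\<bar>y' - 1\<bar> \<le> M"
      "\<bar>x' - x\<bar> \<le> 4 * y\<^sup>2 / 2 ^ B" "\<bar>y' - y\<bar> \<le> 4 * y\<^sup>2 / 2 ^ B"
      using x'_bounds y'_bounds precision_small y unfolding M_def by linarith+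
  qed
  also have "\<dots> = 2 ^ m * (L * M ^ L * (4 * y\<^sup>2 / 2 ^ B))" by (simp add: L_def m_def n_def)
  \<comment> \<open>The number of edge sets and the factor \<open>L\<close> are both bounded by
    \<open>2 ^ L\<close>, so the Lipschitz constant becomes \<open>(4 * M) ^ L\<close>.\<close>
  also have "\<dots> \<le> 2 ^ L * (2 ^ L * M ^ L * (4 * y\<^sup>2 / 2 ^ B))"
  proof (rule mult_mono)
    show "L * M ^ L * (4 * y\<^sup>2 / 2 ^ B) \<le> 2 ^ L * M ^ L * (4 * y\<^sup>2 / 2 ^ B)"
      using nat_le_two_power[of L] M by (intro mult_right_mono) auto
    show "(2::real) ^ m \<le> 2 ^ L" by (rule power_increasing) (auto simp: L_def)
  qed (use M in auto)
  also have "\<dots> = (4 * M) ^ L * (4 * y\<^sup>2) / 2 ^ B"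
  proof -
    have "(4 * M) ^ L = (2 * 2 * M) ^ L" by simp
    also have "\<dots> = 2 ^ L * 2 ^ L * M ^ L" by (simp only: power_mult_distrib)
    finally have "(4 * M) ^ L = 2 ^ L * 2 ^ L * M ^ L" .
    then show ?thesis by (simp only: mult.assoc times_divide_eq_right)
  qed
  \<comment> \<open>The precision covers the square of \<open>(4 * M) ^ L\<close>: one factor
    cancels the Lipschitz constant, and the other remains in the denominator to be compared with the
    Tutte polynomial.\<close>
  also have "\<dots> \<le> 1 / (8 * k * (4 * M) ^ L)"
  proof -
    have "((4 * M) ^ L * (4 * y\<^sup>2)) * (8 * k * (4 * M) ^ L) = 32 * y\<^sup>2 * k * ((4 * M)\<^sup>2) ^ L"
      by (simp only: power2_eq_square power_mult_distrib[of "4 * M" "4 * M"]) simp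
    also have "\<dots> \<le> 64 * y\<^sup>2 * k * ((4 * M)\<^sup>2) ^ L" by (intro mult_right_mono) auto
    also have "\<dots> \<le> 2 ^ B" using precision by (simp add: M_def L_def)
    finally show ?thesis using M k by (simp add: field_simps)
  qed
  also have "\<dots> \<le> tutte G x y / (4 * k)"
  proof -
    have "(y - 1) ^ (n - 1) \<le> (4 * M) ^ (n - 1)" using y by (intro power_mono) (auto simp: M_def)
    also have "\<dots> \<le> (4 * M) ^ L" using M by (intro power_increasing) (auto simp: L_def)
    finally have "1 / (4 * M) ^ L \<le> 1 / (y - 1) ^ (n - 1)" using y by (intro divide_left_mono mult_pos_pos) (use M in auto)
    also have "\<dots> \<le> y ^ m / (y - 1) ^ (n - 1)" using y by (intro divide_right_mono) (auto intro: one_le_power)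
    finally have "1 / 2 * (1 / (4 * M) ^ L) \<le> tutte G x y" using tutte_ge by linarith
    then have "1 / 2 * (1 / (4 * M) ^ L) / (4 * k) \<le> tutte G x y / (4 * k)" by (rule divide_right_mono) simp
    then show ?thesis by (simp add: mult_ac)
  qed
  finally show ?thesis .
qed

lemma h_eq: "real_of_int (h A) = real_of_int b ^ (n - 1) * Q ^ (num_components G A - 1)"
proof -
  let ?j = "num_components G A"
  have "real_of_int a = real_of_int b * Q"
    using R_props E_real by (simp add: a_def b_def Q_def x'_def y'_def field_simps)
  moreover have "n - 1 = (?j - 1) + (n - ?j)"
    using num_components_pos[OF wf, of A] num_components_le[of G A] by (simp add: n_def)
  ultimately show ?thesis by (simp add: h_def power_mult_distrib power_add)
qed

lemma prob_good:
  "measure_pmf.prob samples {S. \<bar>estimate S - tutte G x y\<bar> \<le> \<bar>tutte G x y\<bar> / k} \<ge> 3 / 4"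
proof -
  let ?p = "random_edges (1 - q) m"
  define \<mu> where "\<mu> = mean G q (\<lambda>A. Q ^ (num_components G A - 1))"
  define c where "c = real_of_int b ^ (n - 1)"
  have b0: "b > 0" using R_props by (simp add: b_def)
  then have c0: "c > 0" by (simp add: c_def)
  have N0: "real N > 0" using k by (simp add: N_def)
  have ids: "edge_ids G = {..<m}" by (simp add: edge_ids_def m_def)
  have ex: "measure_pmf.expectation ?p f = mean G q f" for f
    using expectation_random_edges[of q m f] q_bounds by (simp add: mean_def ids)
  have E1: "c * \<mu> = measure_pmf.expectation ?p (\<lambda>A. real_of_int (h A))"
    unfolding ex h_eq \<mu>_def c_def mean_def by (simp add: sum_distrib_left algebra_simps)
  have E2: "measure_pmf.expectation ?p (\<lambda>A. (real_of_int (h A))\<^sup>2) \<le> c\<^sup>2 * (3 / 2)"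
  proof -
    have "measure_pmf.expectation ?p (\<lambda>A. (real_of_int (h A))\<^sup>2)
      = c\<^sup>2 * mean G q (\<lambda>A. (Q ^ (num_components G A - 1))\<^sup>2)"
      unfolding ex h_eq c_def mean_def by (simp add: sum_distrib_left power_mult_distrib algebra_simps)
    also have "\<dots> \<le> c\<^sup>2 * (3 / 2)" by (intro mult_left_mono mean_bounds Q_bound q_bounds) auto
    finally show ?thesis .
  qed
  \<comment> \<open>Divided by \<open>N * c\<close>, this is an error 1 / (8 k) in the mean, hence a
    relative error of at most 1 / (4 k), as the mean is at least 1 / 2.\<close>
  define e where "e = N * c / (8 * k)"
  have e0: "e > 0" using N0 c0 k by (simp add: e_def)
  have "real N * (c\<^sup>2 * (3 / 2)) / e\<^sup>2 \<le> 1 / 4"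
    using c0 k by (simp add: e_def N_def field_simps power2_eq_square)
  then have pr: "3 / 4 \<le> measure_pmf.prob samples {S. \<bar>real_of_int S - real N * (c * \<mu>)\<bar> < e}"
    using prob_sum_deviation[OF finite_set_random_edges E1 E2 e0, of N]
    unfolding samples_def q_def by linarith
  also have "\<dots> \<le> measure_pmf.prob samples {S. \<bar>estimate S - tutte G x y\<bar> \<le> \<bar>tutte G x y\<bar> / k}"
  proof (rule measure_pmf.finite_measure_mono)
    show "{S. \<bar>real_of_int S - real N * (c * \<mu>)\<bar> < e} \<subseteq> {S. \<bar>estimate S - tutte G x y\<bar> \<le> \<bar>tutte G x y\<bar> / k}"
    proof safe
      fix S :: int assume S: "\<bar>real_of_int S - real N * (c * \<mu>)\<bar> < e"
      define C where "C = y' ^ m / (y' - 1) ^ (n - 1)"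
      have C0: "C > 0" using y'_bounds by (simp add: C_def)
      have "real_of_int b / real_of_int D = 1 / (y' - 1)"
        using R_props E_real by (simp add: b_def D_def y'_def field_simps)
      then have cD: "c / real_of_int D ^ (n - 1) = 1 / (y' - 1) ^ (n - 1)"
        by (simp add: c_def flip: power_divide) (simp add: power_divide)
      have "estimate S = y' ^ m * (real_of_int S / N) / real_of_int D ^ (n - 1)"
        unfolding estimate_def y'_def power_divide of_int_mult of_int_power E_real by (simp add: mult_ac)
      also have "\<dots> = y' ^ m * (real_of_int S / (N * c)) * (c / real_of_int D ^ (n - 1))"
        using c0 by simp
      finally have est: "estimate S = C * (real_of_int S / (N * c))" unfolding cD by (simp add: C_def)
      have T': "tutte G x' y' = C * \<mu>"
        unfolding tutte_eq_mean[OF wf k1 y'_bounds(3)] C_def \<mu>_def Q_def n_def m_def q_bounds(4) ..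
      have mu: "\<mu> \<ge> 1 / 2" using mean_bounds(2)[OF q_bounds(1,2) Q_bound] unfolding \<mu>_def by linarith
      have "\<bar>real_of_int S / (N * c) - \<mu>\<bar> = \<bar>real_of_int S - real N * (c * \<mu>)\<bar> / (N * c)"
        using c0 N0 by (simp add: abs_divide[symmetric] field_simps flip: abs_of_pos[of "N * c"]) 
      also have "\<dots> \<le> e / (N * c)" using S c0 by (intro divide_right_mono) auto
      also have "\<dots> = 1 / (8 * k)" using N0 c0 by (simp add: e_def)
      also have "\<dots> \<le> \<mu> / (4 * k)" using mu k by (simp add: field_simps)
      finally have dev: "\<bar>real_of_int S / (N * c) - \<mu>\<bar> \<le> \<mu> / (4 * k)" .
      have "estimate S - tutte G x' y' = C * (real_of_int S / (N * c) - \<mu>)"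
        unfolding est T' by (simp add: algebra_simps)
      then have "\<bar>estimate S - tutte G x' y'\<bar> = C * \<bar>real_of_int S / (N * c) - \<mu>\<bar>"
        using C0 by (simp add: abs_mult)
      also have "\<dots> \<le> C * (\<mu> / (4 * k))" using dev C0 by (intro mult_left_mono) auto
      also have "\<dots> = tutte G x' y' / (4 * k)" unfolding T' by simp
      finally have 1: "\<bar>estimate S - tutte G x' y'\<bar> \<le> tutte G x' y' / (4 * k)" .
      define T where "T = tutte G x y"
      have "0 < 1 / 2 * (y ^ m / (y - 1) ^ (n - 1))" using y by simp
      then have T0: "T > 0" using tutte_ge unfolding T_def by linarith
      have 2: "\<bar>tutte G x' y' - T\<bar> \<le> T / (4 * k)" using tutte_approx unfolding T_def .
      have k4: "T / (4 * k) \<le> T / 4" using T0 k by (simp add: field_simps)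
      \<comment> \<open>The sampling error is relative to the rounded point. The factor 2 transfers
        it to the true one, and the total is 2 / (4 k) for sampling plus 1 / (4 k) for
        rounding.\<close>
      have "tutte G x' y' \<le> 2 * T" using 2 k4 T0 by linarith
      then have "tutte G x' y' / (4 * k) \<le> 2 * T / (4 * k)" by (intro divide_right_mono) auto
      then have "\<bar>estimate S - T\<bar> \<le> 2 * T / (4 * k) + T / (4 * k)" using 1 2 by linarith
      also have "\<dots> \<le> T / k" using T0 k by (simp add: field_simps)
      finally show "\<bar>estimate S - tutte G x y\<bar> \<le> \<bar>tutte G x y\<bar> / k" using T0 by (simp add: T_def)
    qed
  qed simp
  finally show ?thesis .
qed

end

section \<open>The program\<close>

text \<open>
  Scalar variables live at negative addresses, which are free on input. The component labels of the
  vertices are stored right behind the input. Cell \<open>v_kap\<close> holds the number of components minus 1.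
\<close>

abbreviation "var v \<equiv> Mem (Num v)"
abbreviation "v_k \<equiv> -1 :: int"
abbreviation "v_B \<equiv> -2 :: int"
abbreviation "v_N \<equiv> -3 :: int"
abbreviation "v_E \<equiv> -4 :: int"
abbreviation "v_t \<equiv> -5 :: int"
abbreviation "v_X \<equiv> -6 :: int"
abbreviation "v_R \<equiv> -7 :: int"
abbreviation "v_a \<equiv> -8 :: int"
abbreviation "v_b \<equiv> -9 :: int"
abbreviation "v_D \<equiv> -10 :: int"
abbreviation "v_S \<equiv> -11 :: int"
abbreviation "v_j \<equiv> -12 :: int"
abbreviation "v_w \<equiv> -13 :: int"
abbreviation "v_i \<equiv> -14 :: int"
abbreviation "v_u \<equiv> -15 :: int"
abbreviation "v_c \<equiv> -16 :: int"
abbreviation "v_lu \<equiv> -17 :: int"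
abbreviation "v_lv \<equiv> -18 :: int"
abbreviation "v_kap \<equiv> -19 :: int"
abbreviation "v_val \<equiv> -20 :: int"
abbreviation "v_den \<equiv> -21 :: int"
abbreviation "v_Y \<equiv> -22 :: int"

abbreviation "label_addr e \<equiv> Add (Add (Num 4) (Mul (Num 2) (var 1))) e"

text \<open>Tests of \<open>If\<close> only detect positive values, so equality of labels is tested
  as 1 - (c - lu)^2 > 0. In \<open>p_merge\<close> inequality is tested as a positive
  square.\<close>

definition p_relabel :: prog where
  "p_relabel = For v_w (var 0) (Seq (Assign (Num v_c) (Mem (label_addr (var v_w))))
     (If (Sub (Num 1) (Mul (Sub (var v_c) (var v_lu)) (Sub (var v_c) (var v_lu))))
        (Assign (label_addr (var v_w)) (var v_lv)) Skip))"

definition p_merge :: prog where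
  "p_merge =
     Seq (Assign (Num v_lu) (Mem (label_addr (Mem (Add (Num 4) (Mul (Num 2) (var v_i)))))))
    (Seq (Assign (Num v_lv) (Mem (label_addr (Mem (Add (Num 5) (Mul (Num 2) (var v_i)))))))
    (If (Mul (Sub (var v_lu) (var v_lv)) (Sub (var v_lu) (var v_lv)))
       (Seq (Assign (Num v_kap) (Sub (var v_kap) (Num 1))) p_relabel) Skip))"

definition p_bits :: prog where
  "p_bits = For v_t (var v_B) (Seq (Flip (Num v_c))
     (Assign (Num v_u) (Add (Mul (Num 2) (var v_u)) (var v_c))))"

text \<open>The test u + 1 - R > 0 means R \<le> u, the event that the edge survives.\<close>

definition p_edge :: prog where
  "p_edge = Seq (Assign (Num v_u) (Num 0)) (Seq p_bits
     (If (Sub (Add (var v_u) (Num 1)) (var v_R)) p_merge Skip))"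

definition p_labels :: prog where
  "p_labels = For v_w (var 0) (Assign (label_addr (var v_w)) (var v_w))"

text \<open>The old content of \<open>v\<close> remains as a factor, so that successive calls build
  up products of powers.\<close>

definition p_power :: "int \<Rightarrow> int \<Rightarrow> iexp \<Rightarrow> int \<Rightarrow> prog" where
  "p_power v w e c = For w e (Assign (Num v) (Mul (var v) (var c)))"

definition p_sample :: prog where
  "p_sample = Seq p_labels (Seq (Assign (Num v_kap) (Sub (var 0) (Num 1)))
     (Seq (For v_i (var 1) p_edge) (Seq (Assign (Num v_val) (Num 1))
     (Seq (p_power v_val v_w (var v_kap) v_a)
     (Seq (p_power v_val v_w (Sub (Sub (var 0) (Num 1)) (var v_kap)) v_b)
     (Assign (Num v_S) (Add (var v_S) (var v_val))))))))"

text \<open>\<open>v_R\<close> temporarily holds the base 2 from which \<open>v_E\<close> is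
  computed as a power, before it receives its proper value.\<close>

definition p_init :: "nat \<Rightarrow> prog" where
  "p_init K =
     Seq (Assign (Num v_k) (Add (Div (var 3) (var 2)) (Num 1)))
    (Seq (Assign (Num v_B) (Mul (Num (int K)) (Add (Add (var 0) (var 1)) (var v_k))))
    (Seq (Assign (Num v_N) (Mul (Mul (Num 512) (var v_k)) (var v_k)))
    (Seq (Assign (Num v_E) (Num 1))
    (Seq (Assign (Num v_R) (Num 2))
    (Seq (p_power v_E v_t (var v_B) v_R)
    (Seq (Assign (Num v_X) (Approx 0 (var v_B)))
    (Seq (Assign (Num v_Y) (Approx 1 (var v_B)))
    (Seq (Assign (Num v_R) (Div (Mul (var v_E) (var v_E)) (Add (var v_Y) (Num 1))))
    (Seq (Assign (Num v_a) (Mul (Sub (var v_X) (var v_E)) (Sub (var v_E) (var v_R))))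
    (Seq (Assign (Num v_b) (Mul (var v_R) (var v_E)))
         (Assign (Num v_D) (Mul (var v_E) (Sub (var v_E) (var v_R))))))))))))))"

text \<open>Cells 0 and 1 supply the numbers of vertices and edges for the powers, so the result is
  written there only at the end.\<close>

definition p_final :: prog where
  "p_final = Seq (Assign (Num v_den) (var v_N))
    (Seq (p_power v_S v_w (var 1) v_E) (Seq (p_power v_den v_w (var 1) v_R)
    (Seq (p_power v_den v_w (Sub (var 0) (Num 1)) v_D)
    (Seq (Assign (Num 0) (var v_S)) (Assign (Num 1) (var v_den))))))"

definition p_main :: "nat \<Rightarrow> prog" where
  "p_main K = Seq (p_init K) (Seq (Assign (Num v_S) (Num 0)) (Seq (For v_j (var v_N) p_sample) p_final))"

section \<open>Frame conditions and the layout of the input\<close>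

definition same :: "int set \<Rightarrow> memory \<Rightarrow> memory \<Rightarrow> bool" where
  "same X s s' \<longleftrightarrow> (\<forall>a. a \<notin> X \<longrightarrow> s' a = s a)"

lemma same_refl [simp]: "same X s s" by (simp add: same_def)
lemma same_upd: "same X s s' \<Longrightarrow> v \<in> X \<Longrightarrow> same X s (s'(v := z))" by (simp add: same_def)
lemma sameD: "same X s s' \<Longrightarrow> a \<notin> X \<Longrightarrow> s' a = s a" by (simp add: same_def)
lemma same_trans: "same X s s' \<Longrightarrow> same Y s' s'' \<Longrightarrow> X \<subseteq> Z \<Longrightarrow> Y \<subseteq> Z \<Longrightarrow> same Z s s''"
  unfolding same_def by (metis subsetD)

lemma square_less_one: "z * z < 1 \<longleftrightarrow> z = 0" for z :: int
proof
  assume "z * z < 1"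
  moreover have "1 * 1 \<le> \<bar>z\<bar> * \<bar>z\<bar>" if "z \<noteq> 0" using that by (intro mult_mono) auto
  ultimately show "z = 0" by (auto simp: abs_mult_self_eq)
qed simp

lemma nth_concat_pairs:
  assumes "i < length es"
  shows "concat (map (\<lambda>(u, v). [u, v]) es) ! (2 * i) = fst (es ! i)"
    and "concat (map (\<lambda>(u, v). [u, v]) es) ! Suc (2 * i) = snd (es ! i)"
  using assms
proof (induction es arbitrary: i)
  case (Cons e es)
  case 1
  then show ?case using Cons by (cases i) (auto split: prod.splits)
next
  case (Cons e es)
  case 2
  then show ?case using Cons by (cases i) (auto split: prod.splits)
qed simp_all

lemma length_concat_pairs: "length (concat (map (\<lambda>(u, v). [u, v]) es)) = 2 * length es"
  by (induction es) auto

text \<open>Here \<epsilon> = pn / qn, so \<open>k\<close> is an integer between 1 / \<epsilon> and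
  1 / \<epsilon> + 1.\<close>

locale tutte_program = tutte_sampling +
  fixes pn qn :: nat
  assumes pn: "pn > 0" and qn: "qn > 0" and k_def: "k = qn div pn + 1"
begin

text \<open>The largest numbers occur in the final fraction: \<open>N\<close> bits cover the factor
  N \<le> 2^N, 3 B n bits a sample, and B m bits the power of \<open>E\<close>. The 10 admits
  literal constants up to 1024, and the bit lengths of \<open>pn\<close> and \<open>qn\<close> admit
  the input.\<close>

definition \<beta> :: nat where "\<beta> = 10 + N + 4 * B * (n + m) + bit_length (int pn) + bit_length (int qn)"
definition \<rho> :: "nat \<Rightarrow> real" where "\<rho> = (\<lambda>i. if i = 0 then x else y)"

abbreviation "sim \<equiv> simulates \<rho> \<beta>"
abbreviation "U \<equiv> unit_cost \<beta>"
abbreviation "lab w \<equiv> 4 + 2 * int m + int w"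

lemma U1 [simp]: "Suc 0 \<le> U" by (simp add: unit_cost_def)

lemma U2: "2 \<le> U" by (simp add: unit_cost_def)

lemma two_pow_le: "i \<le> \<beta> \<Longrightarrow> z \<le> 2 ^ i \<Longrightarrow> z \<le> (2::int) ^ \<beta>"
  by (erule order_trans) (rule power_increasing, auto)

lemma numeral_bound [simp]: "numeral w \<le> (1024::int) \<Longrightarrow> numeral w \<le> (2::int) ^ \<beta>"
  by (rule two_pow_le[of 10]) (auto simp: \<beta>_def)

lemma K_pos: "K \<ge> 1"
proof (rule ccontr)
  assume "\<not> K \<ge> 1"
  then have "64 * y\<^sup>2 * (4 * (\<bar>x\<bar> + y + 3))\<^sup>2 \<le> 1" using K by (simp add: precise_def not_le)
  moreover have "64 * 1 \<le> 64 * y\<^sup>2 * (4 * (\<bar>x\<bar> + y + 3))\<^sup>2"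
  proof (rule mult_mono)
    have "1 \<le> y\<^sup>2" using y by (intro one_le_power) auto
    then show "64 \<le> 64 * y\<^sup>2" by simp
    show "1 \<le> (4 * (\<bar>x\<bar> + y + 3))\<^sup>2" by (rule one_le_power) (use y abs_ge_zero[of x] in argo)
  qed auto
  ultimately show False by linarith
qed

lemma B_ge: "n + m + k \<le> B"
  using K_pos by (simp add: B_def)

lemma KB: "K \<le> B"
  using n1 by (simp add: B_def)

lemma B_beta: "4 * B \<le> \<beta>" "B \<le> \<beta>"
proof -
  have "4 * B * 1 \<le> 4 * B * (n + m)" using n1 by (intro mult_left_mono) auto
  then show "4 * B \<le> \<beta>" unfolding \<beta>_def by linarith
  then show "B \<le> \<beta>" by simp
qed

lemma param_bounds [simp]:
  "n \<le> 2 ^ \<beta>" "m \<le> 2 ^ \<beta>" "B \<le> 2 ^ \<beta>" "N \<le> 2 ^ \<beta>" "k \<le> 2 ^ \<beta>" "K \<le> 2 ^ \<beta>"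
proof -
  have "i \<le> 2 ^ \<beta>" if "i \<le> \<beta>" for i
    using less_imp_le[OF less_exp[of i]] power_increasing[OF that, of "2::nat"] by linarith
  moreover have "N \<le> \<beta>" by (simp add: \<beta>_def)
  ultimately show "n \<le> 2 ^ \<beta>" "m \<le> 2 ^ \<beta>" "B \<le> 2 ^ \<beta>" "N \<le> 2 ^ \<beta>" "k \<le> 2 ^ \<beta>" "K \<le> 2 ^ \<beta>"
    using B_ge KB B_beta by auto
qed

text \<open>What stays fixed while sampling and is read there or in \<open>p_final\<close>; it
  separates the initialisation from the rest of the verification.\<close>

definition params :: "memory \<Rightarrow> bool" where
  "params s \<longleftrightarrow> s 0 = int n \<and> s 1 = int m \<and>
     (\<forall>i<m. s (4 + 2 * int i) = int (fst (edges G ! i)) \<and> s (5 + 2 * int i) = int (snd (edges G ! i))) \<and>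
     s v_B = int B \<and> s v_N = int N \<and> s v_E = E \<and> s v_R = R \<and> s v_a = a \<and> s v_b = b \<and> s v_D = D"

definition labs :: "int set" where "labs = {lab w |w. w < n}"

definition labelled :: "nat set \<Rightarrow> memory \<Rightarrow> bool" where
  "labelled A s \<longleftrightarrow> component_labels G A (\<lambda>w. s (lab w)) \<and> s v_kap = int (num_components G A - 1)"

lemma lab_neg [simp]: "lab w \<noteq> - numeral v" "- numeral v \<noteq> lab w"
  by (smt (verit) of_nat_0_le_iff neg_numeral_less_zero)+

lemma labs_neg [simp]: "- numeral v \<notin> labs" "lab w \<in> labs \<longleftrightarrow> w < n" "0 \<notin> labs" "1 \<notin> labs"
  by (auto simp: labs_def)

lemma labs_edges: "i < m \<Longrightarrow> 4 + 2 * int i \<notin> labs" "i < m \<Longrightarrow> 5 + 2 * int i \<notin> labs"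
  by (auto simp: labs_def)

text \<open>The listed addresses are the scalar cells about which \<open>params\<close> says
  nothing, and the labels lie beyond the input, so writes to these places preserve it.\<close>

lemma params_same:
  assumes "params s" "same (V \<union> labs) s s'" "V \<subseteq> {-1, -5, -6, -11, -12, -13, -14, -15, -16, -17, -18, -19, -20, -21, -22}"
  shows "params s'"
proof -
  have *: "s' v = s v" if "v \<notin> V" "v \<notin> labs" for v using that sameD[OF assms(2)] by auto
  have "s' v = s v" if "v \<in> {0, 1, -2, -3, -4, -7, -8, -9, -10}" for v
    using that by (intro *) (use assms(3) in auto)
  moreover have "s' (4 + 2 * int i) = s (4 + 2 * int i)" "s' (5 + 2 * int i) = s (5 + 2 * int i)" if "i < m" for i
    using that labs_edges by (auto intro!: *) (use assms(3) in auto)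
  ultimately show ?thesis using assms(1) by (simp add: params_def)
qed

lemma params_upd [simp]:
  "v \<in> {-1, -5, -6, -11, -12, -13, -14, -15, -16, -17, -18, -19, -20, -21, -22} \<Longrightarrow> params (s(v := z)) \<longleftrightarrow> params s"
  using params_same[of s "{v}" "s(v := z)"] params_same[of "s(v := z)" "{v}" s]
  by (simp only: insert_subset empty_subsetI simp_thms) (auto simp: same_def)

lemma simulates_p_relabel:
  assumes "params s0"
  shows "sim p_relabel s0 (return_pmf ())
    (\<lambda>s _. same ({v_w, v_c} \<union> labs) s0 s \<and>
       (\<forall>w<n. s (lab w) = (if s0 (lab w) = s0 v_lu then s0 v_lv else s0 (lab w)))) ((n + 1) * (8 * U))"
proof -
  let ?X = "{v_w, v_c} \<union> labs"
  \<comment> \<open>The loop runs downwards, so with \<open>r\<close> rounds to go exactly the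
    vertices from \<open>r\<close> on are relabelled. The two labels are read from cells outside the
    array and do not change on the way.\<close>
  let ?I = "\<lambda>r s. same ?X s0 s \<and>
     (\<forall>w<n. s (lab w) = (if r \<le> w \<and> s0 (lab w) = s0 v_lu then s0 v_lv else s0 (lab w)))"
  have *: "sim p_relabel s0 (return_pmf ())
    (\<lambda>s _. same ?X s0 s \<and>
       (\<forall>w<n. s (lab w) = (if s0 (lab w) = s0 v_lu then s0 v_lv else s0 (lab w)))) ((n + 1) * ((1 + U + (U + U)) + 4 * U))"
    unfolding p_relabel_def
  proof (rule simulates_for_det[where k=n and I="?I"])
    fix r s assume r: "r < n" and I: "?I (Suc r) s" and "s v_w = int (Suc r)"
    let ?s = "s(v_w := int r)"
    note sm = sameD[OF conjunct1[OF I]]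
    have v: "s 1 = int m" "s v_lu = s0 v_lu" "s v_lv = s0 v_lv"
      using assms sm[of 1] sm[of v_lu] sm[of v_lv] by (simp_all add: params_def)
    have sr: "s (lab r) = s0 (lab r)" using I r by simp
    show "sim (Seq (Assign (Num v_c) (Mem (label_addr (var v_w))))
      (If (Sub (Num 1) (Mul (Sub (var v_c) (var v_lu)) (Sub (var v_c) (var v_lu))))
        (Assign (label_addr (var v_w)) (var v_lv)) Skip)) ?s (return_pmf ())
       (\<lambda>s' _. ?I r s' \<and> s' v_w = int r) (1 + U + (U + U))"
    proof (rule simulates_bounded)
      assume b: "bounded_mem \<beta> ?s"
      have bl: "\<bar>s (lab r)\<bar> \<le> 2 ^ \<beta>" "\<bar>s0 v_lv\<bar> \<le> 2 ^ \<beta>"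
        using bounded_memD[OF b, of "lab r"] bounded_memD[OF b, of v_lv] v(3) by simp_all
      show ?thesis
        apply (rule simulates_assign_seq)
             apply (simp_all add: v bl)
        apply (rule simulates_if)
           apply simp
          apply simp
        subgoal
          apply (rule simulates_assign)
               apply (simp_all add: v bl square_less_one)
          using I r sr by (auto simp: v same_upd)
        subgoal
          apply (rule simulates_skip)
           apply (simp_all add: v U1)
          using I r sr by (auto simp: v same_upd square_less_one not_less_eq_eq dest: le_antisym)
        done
    qed
  qed (use assms in \<open>auto simp: params_def same_upd\<close>)
  show ?thesis by (rule simulates_weaken[OF *], rule mult_left_mono) (use U1 in auto)
qed

lemma component_labels_cong:
  assumes "component_labels G A l" "\<And>w. w < n \<Longrightarrow> l' w = l w"
  shows "component_labels G A l'"
  using assms by (auto simp: component_labels_def verts_def n_def)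

lemma simulates_p_merge:
  assumes ok: "params s0" "labelled A s0" "s0 v_i = int i" "i < m"
  shows "sim p_merge s0 (return_pmf ())
    (\<lambda>s _. same ({v_w, v_c, v_lu, v_lv, v_kap} \<union> labs) s0 s \<and> labelled (insert i A) s) ((n + 1) * (16 * U))"
proof -
  define eu ev where "eu = fst (edges G ! i)" and "ev = snd (edges G ! i)"
  let ?l = "\<lambda>w. s0 (lab w)"
  have i: "i \<in> edge_ids G" using ok by (simp add: edge_ids_def m_def)
  have uv: "eu < n" "ev < n" using edge_in_verts[OF wf i] by (auto simp: eu_def ev_def verts_def n_def)
  have e: "s0 1 = int m" "s0 (4 + 2 * int i) = int eu" "s0 (5 + 2 * int i) = int ev"
    using ok by (auto simp: params_def eu_def ev_def)
  have l: "component_labels G A ?l" "s0 v_kap = int (num_components G A - 1)"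
    using ok(2) by (auto simp: labelled_def)
  note ins = component_labels_insert[OF wf i l(1), folded eu_def ev_def]
    num_components_insert[OF wf i l(1), folded eu_def ev_def]
  have pos: "num_components G (insert i A) \<ge> 1" "num_components G A \<le> n"
    using num_components_pos[OF wf] num_components_le by (auto simp: n_def)
  have nB: "int (num_components G A - 1) \<le> 2 ^ \<beta>"
  proof -
    have "num_components G A - 1 \<le> 2 ^ \<beta>" using pos(2) param_bounds(1) by linarith
    then show ?thesis by simp
  qed
  show ?thesis
  proof (rule simulates_bounded)
    assume "bounded_mem \<beta> s0"
    then have bl: "\<bar>s0 z\<bar> \<le> 2 ^ \<beta>" for z by (rule bounded_memD)
    let ?X = "{v_w, v_c, v_lu, v_lv, v_kap} \<union> labs"
    let ?\<Phi> = "\<lambda>s (_::unit). same ?X s0 s \<and> labelled (insert i A) s"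
    let ?s1 = "s0(v_lu := ?l eu, v_lv := ?l ev)"
    let ?s2 = "?s1(v_kap := int (num_components G A - 1) - 1)"
    have join: "sim (Seq (Assign (Num v_kap) (Sub (var v_kap) (Num 1))) p_relabel) ?s1 (return_pmf ()) ?\<Phi>
      (1 + U + (n + 1) * (8 * U))" if ne: "?l eu \<noteq> ?l ev"
    proof (rule simulates_assign_seq)
      have kap: "num_components G A = Suc (num_components G (insert i A))" using ins(2) ne by simp
      then have "ival \<rho> (Sub (var v_kap) (Num 1)) ?s1 = int (num_components G (insert i A)) - 1"
        using l(2) by simp
      moreover have "int (num_components G (insert i A)) \<le> 2 ^ \<beta>" using nB unfolding kap by (simp only: diff_Suc_1)
      ultimately show "\<bar>ival \<rho> (Sub (var v_kap) (Num 1)) ?s1\<bar> \<le> 2 ^ \<beta>" using pos by linarith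
      show "sim p_relabel (?s1(ival \<rho> (Num v_kap) ?s1 := ival \<rho> (Sub (var v_kap) (Num 1)) ?s1))
        (return_pmf ()) ?\<Phi> ((n + 1) * (8 * U))"
      proof (rule simulates_mono[OF simulates_p_relabel])
        fix s
        assume "same ({v_w, v_c} \<union> labs) (?s1(ival \<rho> (Num v_kap) ?s1 := ival \<rho> (Sub (var v_kap) (Num 1)) ?s1)) s \<and>
         (\<forall>w<n. s (lab w) = (if (?s1(ival \<rho> (Num v_kap) ?s1 := ival \<rho> (Sub (var v_kap) (Num 1)) ?s1)) (lab w) =
            (?s1(ival \<rho> (Num v_kap) ?s1 := ival \<rho> (Sub (var v_kap) (Num 1)) ?s1)) v_lu
            then (?s1(ival \<rho> (Num v_kap) ?s1 := ival \<rho> (Sub (var v_kap) (Num 1)) ?s1)) v_lv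
            else (?s1(ival \<rho> (Num v_kap) ?s1 := ival \<rho> (Sub (var v_kap) (Num 1)) ?s1)) (lab w)))"
        then have sm: "same ({v_w, v_c} \<union> labs) ?s2 s"
          and lb: "\<And>w. w < n \<Longrightarrow> s (lab w) = (if ?l w = ?l eu then ?l ev else ?l w)"
          using l(2) by simp_all
        have "same ?X s0 ?s2" by (simp add: same_upd)
        then have "same ?X s0 s" by (rule same_trans[OF _ sm]) auto
        moreover have "component_labels G (insert i A) (\<lambda>w. s (lab w))"
          by (rule component_labels_cong[OF ins(1)]) (simp add: lb)
        moreover have "s v_kap = int (num_components G (insert i A) - 1)"
          using sameD[OF sm, of v_kap] kap pos by simp
        ultimately show "same ?X s0 s \<and> labelled (insert i A) s" by (simp add: labelled_def)
      qed (use ok in simp_all)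
    qed simp_all
    have stay: "?\<Phi> ?s1 ()" if eq: "?l eu = ?l ev"
    proof -
      have "(\<lambda>w. if ?l w = ?l eu then ?l ev else ?l w) = ?l" using eq by auto
      then have "component_labels G (insert i A) ?l" using ins(1) by (simp only:)
      then show ?thesis using l(2) ins(2) eq by (simp add: labelled_def same_upd)
    qed
    have test: "0 < z * z \<longleftrightarrow> z \<noteq> 0" for z :: int by (auto simp: zero_less_mult_iff)
    let ?e = "Mul (Sub (var v_lu) (var v_lv)) (Sub (var v_lu) (var v_lv))"
    let ?P = "Seq (Assign (Num v_kap) (Sub (var v_kap) (Num 1))) p_relabel"
    have tv: "ival \<rho> ?e ?s1 = (?l eu - ?l ev) * (?l eu - ?l ev)" by simp
    have c1: "sim (If ?e ?P Skip) ?s1 (return_pmf ()) ?\<Phi> (U + (1 + U + (n + 1) * (8 * U)))"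
    proof (rule simulates_if)
      assume "0 < ival \<rho> ?e ?s1"
      then have "?l eu \<noteq> ?l ev" unfolding tv test by simp
      then show "sim ?P ?s1 (return_pmf ()) ?\<Phi> (1 + U + (n + 1) * (8 * U))" by (rule join)
    next
      assume "ival \<rho> ?e ?s1 \<le> 0"
      then have "?l eu = ?l ev" unfolding tv not_less[symmetric] test by simp
      then show "sim Skip ?s1 (return_pmf ()) ?\<Phi> (1 + U + (n + 1) * (8 * U))"
        using stay by (intro simulates_skip[where \<Phi>="?\<Phi>" and v="()"]) simp_all
    qed simp_all
    let ?e4 = "Mem (label_addr (Mem (Add (Num 4) (Mul (Num 2) (var v_i)))))"
    let ?e5 = "Mem (label_addr (Mem (Add (Num 5) (Mul (Num 2) (var v_i)))))"
    let ?s0 = "s0(v_lu := ?l eu)"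
    have v4: "ival \<rho> ?e4 s0 = ?l eu" and v5: "ival \<rho> ?e5 ?s0 = ?l ev"
      by (simp_all add: e ok(3))
    have c2: "sim (Seq (Assign (Num v_lv) ?e5) (If ?e ?P Skip)) ?s0 (return_pmf ()) ?\<Phi>
      (1 + U + (U + (1 + U + (n + 1) * (8 * U))))"
    proof (rule simulates_assign_seq)
      show "\<bar>ival \<rho> ?e5 ?s0\<bar> \<le> 2 ^ \<beta>" unfolding v5 by (rule bl)
      show "sim (If ?e ?P Skip) (?s0(ival \<rho> (Num v_lv) ?s0 := ival \<rho> ?e5 ?s0)) (return_pmf ()) ?\<Phi>
        (U + (1 + U + (n + 1) * (8 * U)))" unfolding v5 ival.simps(1) by (rule c1)
    qed simp_all
    have "sim p_merge s0 (return_pmf ()) ?\<Phi> (1 + U + (1 + U + (U + (1 + U + (n + 1) * (8 * U)))))"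
      unfolding p_merge_def
    proof (rule simulates_assign_seq)
      show "\<bar>ival \<rho> ?e4 s0\<bar> \<le> 2 ^ \<beta>" unfolding v4 by (rule bl)
      show "sim (Seq (Assign (Num v_lv) ?e5) (If ?e ?P Skip)) (s0(ival \<rho> (Num v_lu) s0 := ival \<rho> ?e4 s0))
        (return_pmf ()) ?\<Phi> (1 + U + (U + (1 + U + (n + 1) * (8 * U))))"
        unfolding v4 ival.simps(1) by (rule c2)
    qed simp_all
    then show ?thesis by (rule simulates_weaken) (use U2 in \<open>simp add: algebra_simps\<close>)
  qed
qed

lemma simulates_p_bits:
  assumes ok: "params s0" "s0 v_u = 0"
  shows "sim p_bits s0 (down (\<lambda>_ u. map_pmf (\<lambda>b. 2 * u + of_bool b) (pmf_of_set UNIV)) B 0)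
    (\<lambda>s u. same {v_u, v_c, v_t} s0 s \<and> s v_u = u \<and> 0 \<le> u \<and> u < 2 ^ B) ((B + 1) * (7 * U))"
proof -
  let ?X = "{v_u, v_c, v_t}"
  \<comment> \<open>With \<open>r\<close> rounds to go, \<open>B - r\<close> bits have been read,
    which bounds the number formed so far.\<close>
  let ?I = "\<lambda>r s u. same ?X s0 s \<and> s v_u = u \<and> 0 \<le> u \<and> u < 2 ^ (B - r)"
  have *: "sim p_bits s0 (down (\<lambda>_ u. map_pmf (\<lambda>b. 2 * u + of_bool b) (pmf_of_set UNIV)) B 0)
    (\<lambda>s u. same ?X s0 s \<and> s v_u = u \<and> 0 \<le> u \<and> u < 2 ^ B) ((B + 1) * ((1 + U + U) + 4 * U))"
    unfolding p_bits_def
  proof (rule simulates_for[where k=B and I="?I"])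
    fix r s u assume r: "r < B" and I: "?I (Suc r) s u" and "s v_t = int (Suc r)"
    have "u < 2 ^ (B - Suc r)" using I by simp
    then have "2 * u + 1 < 2 * 2 ^ (B - Suc r)" by linarith
    also have "2 * 2 ^ (B - Suc r) = (2::int) ^ (B - r)" using r by (simp flip: power_Suc add: Suc_diff_Suc)
    finally have ub: "2 * u + 1 < 2 ^ (B - r)" .
    also have "(2::int) ^ (B - r) \<le> 2 ^ \<beta>" using B_beta by (intro power_increasing) auto
    finally have ub': "2 * u + 1 < 2 ^ \<beta>" .
    show "sim (Seq (Flip (Num v_c)) (Assign (Num v_u) (Add (Mul (Num 2) (var v_u)) (var v_c))))
       (s(v_t := int r)) (map_pmf (\<lambda>b. 2 * u + of_bool b) (pmf_of_set UNIV))
       (\<lambda>s' u'. ?I r s' u' \<and> s' v_t = int r) (1 + U + U)"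
      unfolding map_pmf_def
      apply (rule simulates_seq[where \<Psi>="\<lambda>s' b. s' = s(v_t := int r, v_c := of_bool b)"])
      subgoal by (rule simulates_flip) auto
      subgoal for s' b
        apply (rule simulates_assign)
        using I ub ub' by (auto simp: same_upd of_bool_def)
      done
  qed (use ok in \<open>auto simp: params_def same_upd\<close>)
  show ?thesis by (rule simulates_weaken[OF *], rule mult_left_mono) (use U1 in auto)
qed

lemma simulates_p_edge:
  assumes ok: "params s0" "labelled A s0" "s0 v_i = int i" "i < m"
  shows "sim p_edge s0 (map_pmf (\<lambda>b. if b then insert i A else A) (bernoulli_pmf (1 - real_of_int R / 2 ^ B)))
    (\<lambda>s A'. same ({v_t, v_u, v_w, v_c, v_lu, v_lv, v_kap} \<union> labs) s0 s \<and> labelled A' s)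
     ((n + B + 2) * (20 * U))"
proof -
  let ?bits = "down (\<lambda>_ u. map_pmf (\<lambda>b. 2 * u + of_bool b) (pmf_of_set UNIV)) B (0::int)"
  let ?X = "{v_t, v_u, v_w, v_c, v_lu, v_lv, v_kap} \<union> labs"
  have "R \<le> 2 ^ B" using R_props(2) by (simp add: E_def)
  \<comment> \<open>The Bernoulli trial is unfolded into its bits followed by a deterministic
    decision, to match the shape of the program.\<close>
  then have D: "map_pmf (\<lambda>b. if b then insert i A else A) (bernoulli_pmf (1 - real_of_int R / 2 ^ B))
    = bind_pmf ?bits (\<lambda>u. return_pmf (if R \<le> u then insert i A else A))"
    using R_props(1) by (subst map_bits_bernoulli[symmetric]) (auto simp: map_pmf_def bind_assoc_pmf bind_return_pmf)
  let ?s1 = "s0(v_u := 0)"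
  have s1: "params ?s1" "labelled A ?s1" "?s1 v_i = int i" "same ?X s0 ?s1"
    using ok by (simp_all add: labelled_def same_upd)
  let ?T = "U + (n + 1) * (16 * U)"
  let ?\<Phi> = "\<lambda>s A'. same ?X s0 s \<and> labelled A' s"
  note 1 = simulates_p_bits[OF s1(1) fun_upd_same]
  have 2: "sim (If (Sub (Add (var v_u) (Num 1)) (var v_R)) p_merge Skip) s
      (return_pmf (if R \<le> u then insert i A else A)) ?\<Phi> ?T"
    if "same {v_u, v_c, v_t} ?s1 s \<and> s v_u = u \<and> 0 \<le> u \<and> u < 2 ^ B" for s u
  proof -
    have sm: "same {v_u, v_c, v_t} ?s1 s" "s v_u = u" using that by auto
    note d = sameD[OF sm(1)]
    have "same ({v_u, v_c, v_t} \<union> labs) ?s1 s" by (rule same_trans[OF same_refl sm(1), of "{}"]) auto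
    from params_same[OF s1(1) this] have p: "params s" by simp
    have dl: "s (lab w) = s0 (lab w)" for w using d[of "lab w"] by simp
    have la: "labelled A s" using s1(2) d[of v_kap] by (simp add: labelled_def dl)
    have vi: "s v_i = int i" using s1(3) d[of v_i] by simp
    have vr: "s v_R = R" using p by (simp add: params_def)
    have s0s: "same ?X s0 s" by (rule same_trans[OF s1(4) sm(1)]) auto
    show ?thesis
    proof (rule simulates_if)
      assume "0 < ival \<rho> (Sub (Add (var v_u) (Num 1)) (var v_R)) s"
      then have "R \<le> u" using sm(2) vr by simp
      then show "sim p_merge s (return_pmf (if R \<le> u then insert i A else A)) ?\<Phi> ((n + 1) * (16 * U))"
        by (simp only: if_True, rule_tac simulates_return[where x="()"], rule_tac simulates_mono[OF simulates_p_merge[OF p la vi ok(4)]])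
          (erule conjE, rule conjI, rule same_trans[OF s0s], auto)
    next
      assume "ival \<rho> (Sub (Add (var v_u) (Num 1)) (var v_R)) s \<le> 0"
      then have "\<not> R \<le> u" using sm(2) vr by simp
      then show "sim Skip s (return_pmf (if R \<le> u then insert i A else A)) ?\<Phi> ((n + 1) * (16 * U))"
        using s0s la by (auto intro!: simulates_skip trans_le_add1 order_trans[OF U1])
    qed auto
  qed
  have 3: "sim (Seq p_bits (If (Sub (Add (var v_u) (Num 1)) (var v_R)) p_merge Skip)) ?s1
      (bind_pmf ?bits (\<lambda>u. return_pmf (if R \<le> u then insert i A else A))) ?\<Phi>
      (1 + (B + 1) * (7 * U) + ?T)"
    by (rule simulates_seq[OF 1 2])
  show ?thesis unfolding D p_edge_def
  proof (rule simulates_weaken)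
    show "sim (Seq (Assign (Num v_u) (Num 0)) (Seq p_bits (If (Sub (Add (var v_u) (Num 1)) (var v_R)) p_merge Skip)))
      s0 (bind_pmf ?bits (\<lambda>u. return_pmf (if R \<le> u then insert i A else A))) ?\<Phi>
      (1 + U + (1 + (B + 1) * (7 * U) + ?T))"
      by (rule simulates_assign_seq[rotated -1], unfold ival.simps(1), rule 3) simp_all
    show "1 + U + (1 + (B + 1) * (7 * U) + ?T) \<le> (n + B + 2) * (20 * U)"
      using U2 by (simp add: algebra_simps)
  qed
qed

lemma simulates_p_labels:
  assumes ok: "params s0"
  shows "sim p_labels s0 (return_pmf ())
    (\<lambda>s _. same ({v_w} \<union> labs) s0 s \<and> (\<forall>w<n. s (lab w) = int w)) ((n + 1) * (5 * U))"
proof -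
  let ?X = "{v_w} \<union> labs"
  let ?I = "\<lambda>r s. same ?X s0 s \<and> (\<forall>w<n. r \<le> w \<longrightarrow> s (lab w) = int w)"
  have "sim p_labels s0 (return_pmf ())
    (\<lambda>s _. same ?X s0 s \<and> (\<forall>w<n. s (lab w) = int w)) ((n + 1) * (U + 4 * U))"
    unfolding p_labels_def
  proof (rule simulates_for_det[where k=n and I="?I"])
    fix r s assume r: "r < n" and I: "?I (Suc r) s" and "s v_w = int (Suc r)"
    have "s 1 = int m" using ok sameD[OF conjunct1[OF I], of 1] by (simp add: params_def)
    moreover have "r \<le> 2 ^ \<beta>" using r param_bounds(1) by linarith
    ultimately show "sim (Assign (label_addr (var v_w)) (var v_w)) (s(v_w := int r)) (return_pmf ())
       (\<lambda>s' _. ?I r s' \<and> s' v_w = int r) U"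
      apply (intro simulates_assign)
      using I r by (auto simp: same_upd not_less_eq_eq dest: le_antisym)
  qed (use ok in \<open>auto simp: params_def same_upd\<close>)
  then show ?thesis by (simp add: mult.assoc)
qed

lemma simulates_p_power:
  assumes v: "\<bar>v\<bar> \<le> 2 ^ \<beta>" "\<bar>w\<bar> \<le> 2 ^ \<beta>" "\<bar>c\<bar> \<le> 2 ^ \<beta>" "v \<noteq> w" "c \<noteq> v" "c \<noteq> w"
    and e: "simple \<beta> e" "nodes e \<le> 20" "ival \<rho> e s0 = int l" "int l \<le> 2 ^ \<beta>"
    and b: "\<And>i. i \<le> l \<Longrightarrow> \<bar>s0 v * s0 c ^ i\<bar> \<le> 2 ^ \<beta>"
  shows "sim (p_power v w e c) s0 (return_pmf ())
    (\<lambda>s _. same {v, w} s0 s \<and> s v = s0 v * s0 c ^ l) ((l + 1) * (5 * U))"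
proof -
  let ?I = "\<lambda>r s. same {v, w} s0 s \<and> s v = s0 v * s0 c ^ (l - r)"
  have "sim (p_power v w e c) s0 (return_pmf ())
    (\<lambda>s _. same {v, w} s0 s \<and> s v = s0 v * s0 c ^ l) ((l + 1) * (U + 4 * U))"
    unfolding p_power_def
  proof (rule simulates_for_det[where k=l and I="?I"])
    fix r s assume r: "r < l" and I: "?I (Suc r) s" and "s w = int (Suc r)"
    have c: "s c = s0 c" using sameD[OF conjunct1[OF I], of c] v by simp
    have "s0 c ^ (l - r) = s0 c * s0 c ^ (l - Suc r)" using r by (simp flip: power_Suc add: Suc_diff_Suc)
    then have val: "s v * s c = s0 v * s0 c ^ (l - r)" using I c by simp
    show "sim (Assign (Num v) (Mul (var v) (var c))) (s(w := int r)) (return_pmf ())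
       (\<lambda>s' _. ?I r s' \<and> s' w = int r) U"
      apply (rule simulates_assign)
      using I v val b[of "l - r"] by (auto simp: same_upd mult_ac)
  qed (use v e in \<open>simp_all add: same_upd\<close>)
  then show ?thesis by (simp add: mult.assoc)
qed

section \<open>Bit lengths of the numbers in the program\<close>

lemma size_bound: "4 * (\<bar>x\<bar> + y + 3) \<le> 2 ^ B"
proof -
  let ?M = "4 * (\<bar>x\<bar> + y + 3)"
  have y2: "1 \<le> y\<^sup>2" using y by (intro one_le_power) auto
  have M: "1 \<le> ?M" using y by (auto intro: add_nonneg_nonneg)
  have "?M * 1 \<le> ?M * ?M" using M by (intro mult_left_mono) auto
  then have "?M \<le> ?M\<^sup>2" by (simp add: power2_eq_square)
  also have "\<dots> \<le> (?M\<^sup>2) ^ (n + m)" using M n1 by (intro self_le_power one_le_power) auto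
  also have "\<dots> \<le> 64 * y\<^sup>2 * k * (?M\<^sup>2) ^ (n + m)"
  proof -
    have "1 * 1 \<le> 64 * y\<^sup>2 * k" using y2 k by (intro mult_mono) auto
    then have "1 * (?M\<^sup>2) ^ (n + m) \<le> 64 * y\<^sup>2 * k * (?M\<^sup>2) ^ (n + m)" by (intro mult_right_mono) auto
    then show ?thesis by simp
  qed
  also have "\<dots> \<le> 2 ^ B" by (rule precision)
  finally show ?thesis .
qed

text \<open>The additional \<open>2 ^ B\<close> on the left makes room for the difference
  \<open>X - E\<close> in \<open>a\<close>.\<close>

lemma abs_floor_le:
  assumes "\<bar>z\<bar> + 2 \<le> (2::real) ^ B"
  shows "\<bar>\<lfloor>z * 2 ^ B\<rfloor>\<bar> + 2 ^ B \<le> 2 ^ (2 * B)"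
proof -
  let ?f = "\<lfloor>z * 2 ^ B\<rfloor>"
  have "\<bar>real_of_int ?f - z * 2 ^ B\<bar> \<le> 1" by linarith
  moreover have "\<bar>z * 2 ^ B\<bar> = \<bar>z\<bar> * 2 ^ B" by (simp add: abs_mult)
  ultimately have "\<bar>real_of_int ?f\<bar> \<le> \<bar>z\<bar> * 2 ^ B + 1" by linarith
  also have "\<dots> \<le> \<bar>z\<bar> * 2 ^ B + 2 ^ B" by simp
  finally have "real_of_int (\<bar>?f\<bar> + 2 ^ B) \<le> (\<bar>z\<bar> + 2) * 2 ^ B" by (simp add: algebra_simps)
  also have "\<dots> \<le> 2 ^ B * 2 ^ B" by (intro mult_right_mono assms) auto
  also have "\<dots> = real_of_int (2 ^ (2 * B))" by (simp add: power_add mult_2)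
  finally show ?thesis by (simp only: of_int_le_iff)
qed

lemma xy_bound: "\<bar>x\<bar> + 2 \<le> 2 ^ B" "\<bar>y\<bar> + 2 \<le> 2 ^ B"
proof -
  have "u + 2 \<le> e \<and> \<bar>y\<bar> + 2 \<le> e" if "4 * (u + y + 3) \<le> e" "0 \<le> u" for u e
    using that y by (auto simp: distrib_left)
  from this[OF size_bound abs_ge_zero] show "\<bar>x\<bar> + 2 \<le> 2 ^ B" "\<bar>y\<bar> + 2 \<le> 2 ^ B" by auto
qed

lemma abs_X: "\<bar>X\<bar> + 2 ^ B \<le> 2 ^ (2 * B)"
  unfolding X_def by (rule abs_floor_le[OF xy_bound(1)])

lemma abs_Y: "\<bar>\<lfloor>y * 2 ^ B\<rfloor>\<bar> + 2 ^ B \<le> 2 ^ (2 * B)"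
  by (rule abs_floor_le[OF xy_bound(2)])

lemma coefficient_bounds:
  "\<bar>a\<bar> \<le> 2 ^ (3 * B)" "\<bar>b\<bar> \<le> 2 ^ (2 * B)" "\<bar>D\<bar> \<le> 2 ^ (2 * B)" "\<bar>R\<bar> \<le> 2 ^ B" "\<bar>E\<bar> \<le> 2 ^ B"
proof -
  show R: "\<bar>R\<bar> \<le> 2 ^ B" "\<bar>E\<bar> \<le> 2 ^ B" using R_props E_def by auto
  have ER: "\<bar>E - R\<bar> \<le> 2 ^ B" using R_props E_def by auto
  have "\<bar>X - E\<bar> \<le> 2 ^ (2 * B)" using abs_X zero_le_power[of "2::int" B] unfolding E_def by linarith
  then have "\<bar>a\<bar> \<le> 2 ^ (2 * B) * 2 ^ B" unfolding a_def abs_mult using ER by (intro mult_mono) auto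
  then show "\<bar>a\<bar> \<le> 2 ^ (3 * B)" by (simp flip: power_add)
  have "\<bar>b\<bar> \<le> 2 ^ B * 2 ^ B" unfolding b_def abs_mult using R by (intro mult_mono) auto
  then show "\<bar>b\<bar> \<le> 2 ^ (2 * B)" by (simp add: power_add mult_2)
  have "\<bar>D\<bar> \<le> 2 ^ B * 2 ^ B" unfolding D_def abs_mult using R ER by (intro mult_mono) auto
  then show "\<bar>D\<bar> \<le> 2 ^ (2 * B)" by (simp add: power_add mult_2)
qed

lemma power_bound: "\<bar>z\<bar> \<le> 2 ^ c \<Longrightarrow> \<bar>z ^ i\<bar> \<le> (2::int) ^ (c * i)"
  unfolding power_abs power_mult by (rule power_mono) auto

lemma weight_bound:
  assumes "i + j \<le> n"
  shows "\<bar>a ^ i * b ^ j\<bar> \<le> 2 ^ (3 * B * n)"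
proof -
  have "\<bar>a ^ i * b ^ j\<bar> \<le> 2 ^ (3 * B * i) * 2 ^ (2 * B * j)"
    unfolding abs_mult using coefficient_bounds by (intro mult_mono power_bound) auto
  also have "\<dots> = 2 ^ (3 * B * i + 2 * B * j)" by (simp add: power_add)
  also have "\<dots> \<le> 2 ^ (3 * B * n)"
  proof (rule power_increasing)
    have "3 * B * i + 2 * B * j \<le> 3 * B * (i + j)" by (simp add: algebra_simps)
    also have "\<dots> \<le> 3 * B * n" using assms by (intro mult_left_mono) auto
    finally show "3 * B * i + 2 * B * j \<le> 3 * B * n" .
  qed simp
  finally show ?thesis .
qed

lemma weight_bound_beta: "3 * B * n + N \<le> \<beta>"
  by (simp add: \<beta>_def distrib_left)

lemma simulates_p_accumulate:
  assumes ok: "params s0" "labelled A s0" "s0 v_S = S" "\<bar>S\<bar> + 2 ^ (3 * B * n) \<le> 2 ^ \<beta>"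
  shows "sim (Seq (Assign (Num v_val) (Num 1))
     (Seq (p_power v_val v_w (var v_kap) v_a)
     (Seq (p_power v_val v_w (Sub (Sub (var 0) (Num 1)) (var v_kap)) v_b)
     (Assign (Num v_S) (Add (var v_S) (var v_val)))))) s0 (return_pmf ())
    (\<lambda>s _. same {v_val, v_w, v_S} s0 s \<and> s v_S = S + h A) (3 + 2 * U + 2 * ((n + 1) * (5 * U)))"
proof -
  let ?k = "num_components G A"
  let ?s1 = "s0(v_val := 1)"
  have k: "1 \<le> ?k" "?k \<le> n" using num_components_pos[OF wf] num_components_le by (auto simp: n_def)
  have kap: "s0 v_kap = int (?k - 1)" and ab: "s0 v_a = a" "s0 v_b = b" "s0 0 = int n"
    using ok by (auto simp: labelled_def params_def)
  have kB: "i \<le> 2 ^ \<beta>" if "i \<le> n" for i using that param_bounds(1) by linarith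
  have wb: "\<bar>a ^ i * b ^ j\<bar> \<le> 2 ^ \<beta>" if "i + j \<le> n" for i j
    by (rule two_pow_le[OF _ weight_bound[OF that]]) (use weight_bound_beta in linarith)
  have "\<bar>h A\<bar> \<le> 2 ^ (3 * B * n)" unfolding h_def by (rule weight_bound) (use k in linarith)
  then have Sb: "\<bar>S + h A\<bar> \<le> 2 ^ \<beta>" using ok(4) by linarith
  have 1: "sim (p_power v_val v_w (var v_kap) v_a) ?s1 (return_pmf ())
    (\<lambda>s _. same {v_val, v_w} ?s1 s \<and> s v_val = a ^ (?k - 1)) ((n + 1) * (5 * U))"
  proof (rule simulates_mono[OF simulates_p_power[where l="?k - 1"]])
    show "\<bar>?s1 v_val * ?s1 v_a ^ i\<bar> \<le> 2 ^ \<beta>" if "i \<le> ?k - 1" for i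
      using wb[of i 0] that k by (simp add: ab)
    show "(?k - 1 + 1) * (5 * U) \<le> (n + 1) * (5 * U)" using k by (intro mult_right_mono) auto
    show "int (?k - 1) \<le> 2 ^ \<beta>" using kB[of "?k - 1"] k(2) by (simp del: of_nat_diff)
  qed (use kap k ab in simp_all)
  have 2: "sim (p_power v_val v_w (Sub (Sub (var 0) (Num 1)) (var v_kap)) v_b) s (return_pmf ())
     (\<lambda>s' _. same {v_val, v_w} ?s1 s' \<and> s' v_val = h A) ((n + 1) * (5 * U))"
    if s: "same {v_val, v_w} ?s1 s \<and> s v_val = a ^ (?k - 1)" for s
  proof (rule simulates_mono[OF simulates_p_power[where l="n - ?k"]])
    note d = sameD[OF conjunct1[OF s]]
    have sb: "s v_b = b" "s v_kap = int (?k - 1)" "s 0 = int n"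
      using d[of v_b] d[of v_kap] d[of 0] ab kap by simp_all
    show "\<bar>s v_val * s v_b ^ i\<bar> \<le> 2 ^ \<beta>" if "i \<le> n - ?k" for i
      using wb[of "?k - 1" i] that k s by (simp add: sb)
    show "ival \<rho> (Sub (Sub (var 0) (Num 1)) (var v_kap)) s = int (n - ?k)"
      using k by (simp add: sb of_nat_diff)
    show "int (n - ?k) \<le> 2 ^ \<beta>" using kB[of "n - ?k"] by simp
    show "(n - ?k + 1) * (5 * U) \<le> (n + 1) * (5 * U)" by (intro mult_right_mono) auto
    fix s'
    assume s': "same {v_val, v_w} s s' \<and> s' v_val = s v_val * s v_b ^ (n - ?k)"
    have "same {v_val, v_w} ?s1 s'" by (rule same_trans[OF conjunct1[OF s] conjunct1[OF s']]) auto
    then show "same {v_val, v_w} ?s1 s' \<and> s' v_val = h A"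
      using s s' by (simp add: h_def sb)
  qed simp_all
  have 3: "sim (Assign (Num v_S) (Add (var v_S) (var v_val))) s (return_pmf ())
      (\<lambda>s' _. same {v_val, v_w, v_S} s0 s' \<and> s' v_S = S + h A) U"
    if s: "same {v_val, v_w} ?s1 s \<and> s v_val = h A" for s
  proof (rule simulates_assign)
    have vs: "s v_S = S" using sameD[OF conjunct1[OF s], of v_S] ok(3) by simp
    then show "\<bar>ival \<rho> (Add (var v_S) (var v_val)) s\<bar> \<le> 2 ^ \<beta>" using s Sb by simp
    have "same {v_val, v_w, v_S} s0 ?s1" by (simp add: same_upd)
    then have "same {v_val, v_w, v_S} s0 s" by (rule same_trans[OF _ conjunct1[OF s]]) auto
    then show "same {v_val, v_w, v_S} s0 (s(ival \<rho> (Num v_S) s := ival \<rho> (Add (var v_S) (var v_val)) s)) \<and>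
      (s(ival \<rho> (Num v_S) s := ival \<rho> (Add (var v_S) (var v_val)) s)) v_S = S + h A"
      using s vs by (simp add: same_upd)
  qed simp_all
  show ?thesis
  proof (rule simulates_weaken)
    show "sim (Seq (Assign (Num v_val) (Num 1))
     (Seq (p_power v_val v_w (var v_kap) v_a)
     (Seq (p_power v_val v_w (Sub (Sub (var 0) (Num 1)) (var v_kap)) v_b)
     (Assign (Num v_S) (Add (var v_S) (var v_val)))))) s0 (return_pmf ())
    (\<lambda>s _. same {v_val, v_w, v_S} s0 s \<and> s v_S = S + h A)
      (1 + U + (1 + (n + 1) * (5 * U) + (1 + (n + 1) * (5 * U) + U)))"
      by (rule simulates_assign_seq[rotated -1], unfold ival.simps(1),
        rule simulates_seq_det[OF 1 simulates_seq_det[OF 2 3]]) simp_all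
  qed simp
qed

abbreviation "sample_vars \<equiv> {v_w, v_kap, v_i, v_t, v_u, v_c, v_lu, v_lv, v_val, v_S} \<union> labs"

lemma params_sample: "params s \<Longrightarrow> same sample_vars s s' \<Longrightarrow> params s'"
  by (erule params_same[where V="{v_w, v_kap, v_i, v_t, v_u, v_c, v_lu, v_lv, v_val, v_S}"]) simp_all

text \<open>The postcondition records the growth of the sum, so that the outer loop can keep the
  accumulator within \<beta> bits for every outcome of the coins.\<close>

lemma simulates_p_sample:
  assumes ok: "params s0" "s0 v_S = S" "\<bar>S\<bar> + 2 ^ (3 * B * n) \<le> 2 ^ \<beta>"
  shows "sim p_sample s0 (map_pmf (\<lambda>A. S + h A) (random_edges (1 - real_of_int R / 2 ^ B) m))
    (\<lambda>s S'. same sample_vars s0 s \<and> s v_S = S' \<and> \<bar>S'\<bar> \<le> \<bar>S\<bar> + 2 ^ (3 * B * n))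
    ((m + 1) * (n + B + 2) * (60 * U))"
proof -
  let ?X = "sample_vars"
  let ?r = "random_edges (1 - real_of_int R / 2 ^ B) m"
  let ?\<Phi>1 = "\<lambda>s. same ?X s0 s \<and> labelled {} s"
  let ?\<Phi>2 = "\<lambda>s A. same ?X s0 s \<and> labelled A s \<and> s v_S = S"
  let ?\<Phi> = "\<lambda>s S'. same sample_vars s0 s \<and> s v_S = S' \<and> \<bar>S'\<bar> \<le> \<bar>S\<bar> + 2 ^ (3 * B * n)"
  have 2: "sim (Assign (Num v_kap) (Sub (var 0) (Num 1))) s (return_pmf ()) (\<lambda>s' _. ?\<Phi>1 s' \<and> s' v_S = S) U"
    if s: "same ({v_w} \<union> labs) s0 s \<and> (\<forall>w<n. s (lab w) = int w)" for s
  proof (rule simulates_assign)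
    have s0: "s 0 = int n" using sameD[OF conjunct1[OF s], of 0] ok(1) by (simp add: params_def)
    then show "\<bar>ival \<rho> (Sub (var 0) (Num 1)) s\<bar> \<le> 2 ^ \<beta>"
    proof -
      have "int n \<le> 2 ^ \<beta>" by simp
      then have "\<bar>int n - 1\<bar> \<le> 2 ^ \<beta>" using n1 by linarith
      then show ?thesis by (simp add: s0)
    qed
    have sm: "same ?X s0 s" by (rule same_trans[OF same_refl conjunct1[OF s], of "{}"]) auto
    have l: "component_labels G {} (\<lambda>w. s (lab w))"
      unfolding component_labels_def connected_rel_empty using s by (auto simp: verts_def n_def)
    then show "(?\<Phi>1 (s(ival \<rho> (Num v_kap) s := ival \<rho> (Sub (var 0) (Num 1)) s))) \<and>
      (s(ival \<rho> (Num v_kap) s := ival \<rho> (Sub (var 0) (Num 1)) s)) v_S = S"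
      using sm s0 n1 sameD[OF conjunct1[OF s], of v_S] ok(2)
      by (simp add: labelled_def same_upd num_components_empty n_def of_nat_diff)
  qed simp_all
  have 3: "sim (For v_i (var 1) p_edge) s ?r ?\<Phi>2 ((m + 1) * ((n + B + 2) * (20 * U) + 4 * U))"
    if s: "?\<Phi>1 s \<and> s v_S = S" for s
    unfolding random_edges_def
  proof (rule simulates_for[where k=m and I="\<lambda>r. ?\<Phi>2"])
    have ps: "params s" by (rule params_sample[OF ok(1)]) (use s in simp)
    then show "ival \<rho> (var 1) s = int m" by (simp add: params_def)
    show "?\<Phi>2 (s(v_i := int m)) {}" using s by (simp add: same_upd labelled_def)
    fix r s A
    assume r: "r < m" and I: "?\<Phi>2 s A"
    let ?s = "s(v_i := int r)"
    let ?Y = "{v_t, v_u, v_w, v_c, v_lu, v_lv, v_kap} \<union> labs"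
    have "params s" by (rule params_sample[OF ok(1)]) (use I in simp)
    then have p: "params ?s" by simp
    have l: "labelled A ?s" using I by (simp add: labelled_def)
    have sm: "same ?X s0 ?s" using I by (simp add: same_upd)
    show "sim p_edge ?s (map_pmf (\<lambda>b. if b then insert r A else A) (bernoulli_pmf (1 - real_of_int R / 2 ^ B)))
      (\<lambda>s' A'. ?\<Phi>2 s' A' \<and> s' v_i = int r) ((n + B + 2) * (20 * U))"
    proof (rule simulates_mono[OF simulates_p_edge[OF p l fun_upd_same r]])
      fix s' A' assume s': "same ?Y ?s s' \<and> labelled A' s'"
      have "same ?X s0 s'" by (rule same_trans[OF sm conjunct1[OF s']]) auto
      then show "?\<Phi>2 s' A' \<and> s' v_i = int r"
        using s' I sameD[OF conjunct1[OF s'], of v_i] sameD[OF conjunct1[OF s'], of v_S] by simp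
    qed simp
  qed simp_all
  let ?acc = "Seq (Assign (Num v_val) (Num 1))
     (Seq (p_power v_val v_w (var v_kap) v_a)
     (Seq (p_power v_val v_w (Sub (Sub (var 0) (Num 1)) (var v_kap)) v_b)
     (Assign (Num v_S) (Add (var v_S) (var v_val)))))"
  let ?T4 = "3 + 2 * U + 2 * ((n + 1) * (5 * U))"
  have 4: "sim ?acc s (return_pmf (S + h A)) ?\<Phi> ?T4" if s: "?\<Phi>2 s A" for s A
  proof (rule simulates_return, rule simulates_mono[OF simulates_p_accumulate])
    show "params s" by (rule params_sample[OF ok(1)]) (use s in simp)
    have "num_components G A - 1 + (n - num_components G A) \<le> n"
      using num_components_pos[OF wf, of A] num_components_le[of G A] by (simp add: n_def)
    then have "\<bar>h A\<bar> \<le> 2 ^ (3 * B * n)" unfolding h_def by (rule weight_bound)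
    then have hb: "\<bar>S + h A\<bar> \<le> \<bar>S\<bar> + 2 ^ (3 * B * n)" by linarith
    fix s' assume s': "same {v_val, v_w, v_S} s s' \<and> s' v_S = S + h A"
    have "same ?X s0 s'" by (rule same_trans[OF conjunct1[OF s] conjunct1[OF s']]) auto
    then show "?\<Phi> s' (S + h A)" using s' hb by simp
  qed (use s ok in simp_all)
  have "sim p_sample s0 (bind_pmf ?r (\<lambda>A. return_pmf (S + h A))) ?\<Phi>
     (1 + (n + 1) * (5 * U) + (1 + U + (1 + (m + 1) * ((n + B + 2) * (20 * U) + 4 * U) + ?T4)))"
    unfolding p_sample_def
    by (rule simulates_seq_det[OF simulates_p_labels[OF ok(1)] simulates_seq_det[OF 2 simulates_seq[OF 3 4]]])
  then show ?thesis unfolding map_pmf_def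
    by (rule simulates_weaken) (use U2 in \<open>simp add: algebra_simps\<close>)
qed

definition has_input :: "memory \<Rightarrow> bool" where
  "has_input s \<longleftrightarrow> s 0 = int n \<and> s 1 = int m \<and>
     (\<forall>i<m. s (4 + 2 * int i) = int (fst (edges G ! i)) \<and> s (5 + 2 * int i) = int (snd (edges G ! i)))"

lemma pow_beta: "\<bar>z\<bar> \<le> 2 ^ (i * B) \<Longrightarrow> i \<le> 4 \<Longrightarrow> \<bar>z\<bar> \<le> (2::int) ^ \<beta>"
proof (rule two_pow_le[of "i * B"])
  assume "i \<le> 4"
  then have "i * B \<le> 4 * B" by (rule mult_right_mono) simp
  then show "i * B \<le> \<beta>" using B_beta by linarith
qed

lemma simulates_p_init:
  assumes ok: "has_input s0" "s0 2 = int pn" "s0 3 = int qn"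
  shows "sim (p_init K) s0 (return_pmf ()) (\<lambda>s _. params s) ((B + 1) * (40 * U))"
proof -
  let ?Y = "\<lfloor>y * 2 ^ B\<rfloor>"
  have EB: "E = 2 ^ B" by (rule E_def)
  have bounds: "\<bar>X\<bar> \<le> 2 ^ \<beta>" "\<bar>?Y\<bar> \<le> 2 ^ \<beta>" "\<bar>R\<bar> \<le> 2 ^ \<beta>" "\<bar>a\<bar> \<le> 2 ^ \<beta>" "\<bar>b\<bar> \<le> 2 ^ \<beta>" "\<bar>D\<bar> \<le> 2 ^ \<beta>"
  proof -
    have "\<bar>X\<bar> \<le> 2 ^ (2 * B)" "\<bar>?Y\<bar> \<le> 2 ^ (2 * B)"
      using abs_X abs_Y zero_le_power[of "2::int" B] by linarith+
    then show "\<bar>X\<bar> \<le> 2 ^ \<beta>" "\<bar>?Y\<bar> \<le> 2 ^ \<beta>" "\<bar>b\<bar> \<le> 2 ^ \<beta>" "\<bar>D\<bar> \<le> 2 ^ \<beta>"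
      using coefficient_bounds by (auto intro: pow_beta[of _ 2])
    show "\<bar>a\<bar> \<le> 2 ^ \<beta>" using coefficient_bounds(1) by (rule pow_beta) simp
    show "\<bar>R\<bar> \<le> 2 ^ \<beta>" using coefficient_bounds(4) pow_beta[of R 1] by simp
  qed
  have two: "(2::int) ^ i \<le> 2 ^ \<beta>" if "i \<le> B" for i using that B_beta by (intro power_increasing) auto
  let ?P2 = "Seq (Assign (Num v_X) (Approx 0 (var v_B)))
    (Seq (Assign (Num v_Y) (Approx 1 (var v_B)))
    (Seq (Assign (Num v_R) (Div (Mul (var v_E) (var v_E)) (Add (var v_Y) (Num 1))))
    (Seq (Assign (Num v_a) (Mul (Sub (var v_X) (var v_E)) (Sub (var v_E) (var v_R))))
    (Seq (Assign (Num v_b) (Mul (var v_R) (var v_E)))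
         (Assign (Num v_D) (Mul (var v_E) (Sub (var v_E) (var v_R))))))))"
  have 2: "sim ?P2 s (return_pmf ()) (\<lambda>s _. params s) (1 + U + (1 + U + (1 + U + (1 + U + (1 + U + U)))))"
    if s: "has_input s \<and> s v_B = int B \<and> s v_N = int N \<and> s v_E = E" for s
    apply (rule simulates_approx_seq[where k=B and z=X], (simp add: s \<rho>_def X_def[symmetric] bounds B_beta; fail)+)
    apply (rule simulates_approx_seq[where k=B and z="?Y"], (simp add: s \<rho>_def bounds B_beta; fail)+)
    apply (rule simulates_set_seq[where z=R], (simp add: s R_def[symmetric] bounds; fail)+)
    apply (rule simulates_set_seq[where z=a], (simp add: s a_def[symmetric] bounds; fail)+)
    apply (rule simulates_set_seq[where z=b], (simp add: s b_def[symmetric] bounds; fail)+)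
    apply (rule simulates_assign)
         apply (simp_all add: s D_def[symmetric] bounds)
    using s by (simp add: params_def has_input_def)
  let ?s1 = "s0(v_k := int k, v_B := int B, v_N := int N, v_E := 1, v_R := 2)"
  have s1: "has_input ?s1" using ok(1) by (simp add: has_input_def)
  have 1: "sim (p_power v_E v_t (var v_B) v_R) ?s1 (return_pmf ())
    (\<lambda>s _. has_input s \<and> s v_B = int B \<and> s v_N = int N \<and> s v_E = E) ((B + 1) * (5 * U))"
  proof (rule simulates_mono[OF simulates_p_power[where l=B]])
    show "\<bar>?s1 v_E * ?s1 v_R ^ i\<bar> \<le> 2 ^ \<beta>" if "i \<le> B" for i using two[OF that] by simp
    fix s assume s: "same {v_E, v_t} ?s1 s \<and> s v_E = ?s1 v_E * ?s1 v_R ^ B"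
    note d = sameD[OF conjunct1[OF s]]
    have "has_input s"
      using s1 d[of 0] d[of 1] d[of "4 + 2 * int i" for i] d[of "5 + 2 * int i" for i]
      unfolding has_input_def by simp
    then show "has_input s \<and> s v_B = int B \<and> s v_N = int N \<and> s v_E = E"
      using d[of v_B] d[of v_N] s by (simp add: EB)
  qed simp_all
  have kz: "int qn div int pn + 1 = int k" by (simp add: k_def zdiv_int)
  have Bz: "int K * (int n + int m + int k) = int B" by (simp add: B_def)
  have Nz: "512 * int k * int k = int N" by (simp add: N_def)
  have in0: "s0 0 = int n" "s0 1 = int m" using ok(1) by (auto simp: has_input_def)
  have 3: "sim (Seq (p_power v_E v_t (var v_B) v_R) ?P2) ?s1 (return_pmf ()) (\<lambda>s _. params s)
     (1 + (B + 1) * (5 * U) + (1 + U + (1 + U + (1 + U + (1 + U + (1 + U + U))))))"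
    by (rule simulates_seq_det[OF 1 2])
  have "sim (p_init K) s0 (return_pmf ()) (\<lambda>s _. params s)
    (1 + U + (1 + U + (1 + U + (1 + U + (1 + U +
     (1 + (B + 1) * (5 * U) + (1 + U + (1 + U + (1 + U + (1 + U + (1 + U + U)))))))))))"
    unfolding p_init_def
    apply (rule simulates_set_seq[where z="int k"], (simp add: in0 ok kz; fail)+)
    apply (rule simulates_set_seq[where z="int B"], (simp add: in0 ok Bz; fail)+)
    apply (rule simulates_set_seq[where z="int N"], (simp add: in0 ok Nz; fail)+)
    apply (rule simulates_set_seq[where z="1"], (simp; fail)+)
    apply (rule simulates_set_seq[where z="2"], (simp; fail)+)
    by (rule 3)
  then show ?thesis by (rule simulates_weaken) (use U2 in \<open>simp add: algebra_simps\<close>)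
qed

lemma N_pow: "int N \<le> 2 ^ N"
  using less_imp_le[OF of_nat_less_two_power[of N, where 'a=int]] .

lemma simulates_p_final:
  assumes ok: "params s0" "s0 v_S = S" "\<bar>S\<bar> \<le> int N * 2 ^ (3 * B * n)"
  shows "sim p_final s0 (return_pmf ())
    (\<lambda>s _. s 0 = S * E ^ m \<and> s 1 = int N * R ^ m * D ^ (n - 1)) ((n + m + 1) * (40 * U))"
proof -
  let ?s1 = "s0(v_den := int N)"
  have p: "s0 v_N = int N" "s0 0 = int n" "s0 1 = int m" "s0 v_E = E" "s0 v_R = R" "s0 v_D = D"
    using ok(1) by (auto simp: params_def)
  have Sb: "\<bar>S * E ^ i\<bar> \<le> 2 ^ \<beta>" if "i \<le> m" for i
  proof -
    have "\<bar>S * E ^ i\<bar> \<le> (2 ^ N * 2 ^ (3 * B * n)) * 2 ^ (B * i)"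
      unfolding abs_mult
    proof (rule mult_mono)
      show "\<bar>S\<bar> \<le> 2 ^ N * 2 ^ (3 * B * n)" using ok(3) N_pow by (meson mult_right_mono order_trans zero_le_numeral zero_le_power)
      show "\<bar>E ^ i\<bar> \<le> 2 ^ (B * i)" by (rule power_bound) (rule coefficient_bounds)
    qed auto
    also have "\<dots> = 2 ^ (N + 3 * B * n + B * i)" by (simp add: power_add)
    also have "\<dots> \<le> 2 ^ \<beta>"
    proof (rule power_increasing)
      have "B * i \<le> B * m" using that by (intro mult_left_mono) auto
      then show "N + 3 * B * n + B * i \<le> \<beta>" unfolding \<beta>_def distrib_left by linarith
    qed simp
    finally show ?thesis .
  qed
  have Db: "\<bar>int N * R ^ i * D ^ j\<bar> \<le> 2 ^ \<beta>" if "i \<le> m" "j \<le> n" for i j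
  proof -
    have "\<bar>int N * R ^ i * D ^ j\<bar> \<le> (2 ^ N * 2 ^ (B * i)) * 2 ^ (2 * B * j)"
      unfolding abs_mult using N_pow coefficient_bounds by (intro mult_mono power_bound) auto
    also have "\<dots> = 2 ^ (N + B * i + 2 * B * j)" by (simp add: power_add)
    also have "\<dots> \<le> 2 ^ \<beta>"
    proof (rule power_increasing)
      have "B * i \<le> B * m" "2 * B * j \<le> 2 * B * n" using that by (auto intro!: mult_left_mono)
      then show "N + B * i + 2 * B * j \<le> \<beta>" unfolding \<beta>_def distrib_left by linarith
    qed simp
    finally show ?thesis .
  qed
  let ?base = "\<lambda>s. s 0 = int n \<and> s 1 = int m \<and> s v_E = E \<and> s v_R = R \<and> s v_D = D"
  have 1: "sim (p_power v_S v_w (var 1) v_E) ?s1 (return_pmf ())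
    (\<lambda>s _. ?base s \<and> s v_S = S * E ^ m \<and> s v_den = int N) ((m + 1) * (5 * U))"
  proof (rule simulates_mono[OF simulates_p_power[where l=m]])
    show "\<bar>?s1 v_S * ?s1 v_E ^ i\<bar> \<le> 2 ^ \<beta>" if "i \<le> m" for i using Sb[OF that] by (simp add: p ok(2))
    fix s assume s: "same {v_S, v_w} ?s1 s \<and> s v_S = ?s1 v_S * ?s1 v_E ^ m"
    note d = sameD[OF conjunct1[OF s]]
    show "?base s \<and> s v_S = S * E ^ m \<and> s v_den = int N"
      using s d[of 0] d[of 1] d[of v_E] d[of v_R] d[of v_D] d[of v_den] by (simp add: p ok(2))
  qed (simp_all add: p)
  have 2: "sim (p_power v_den v_w (var 1) v_R) s1 (return_pmf ())
    (\<lambda>s _. ?base s \<and> s v_S = S * E ^ m \<and> s v_den = int N * R ^ m) ((m + 1) * (5 * U))"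
    if s1: "?base s1 \<and> s1 v_S = S * E ^ m \<and> s1 v_den = int N" for s1
  proof (rule simulates_mono[OF simulates_p_power[where l=m]])
    show "\<bar>s1 v_den * s1 v_R ^ i\<bar> \<le> 2 ^ \<beta>" if "i \<le> m" for i using Db[OF that, of 0] by (simp add: s1)
    fix s assume s: "same {v_den, v_w} s1 s \<and> s v_den = s1 v_den * s1 v_R ^ m"
    note d = sameD[OF conjunct1[OF s]]
    show "?base s \<and> s v_S = S * E ^ m \<and> s v_den = int N * R ^ m"
      using s d[of 0] d[of 1] d[of v_E] d[of v_R] d[of v_D] d[of v_S] by (simp add: s1)
  qed (simp_all add: s1)
  have 3: "sim (p_power v_den v_w (Sub (var 0) (Num 1)) v_D) s1 (return_pmf ())
    (\<lambda>s _. s v_S = S * E ^ m \<and> s v_den = int N * R ^ m * D ^ (n - 1)) ((n + 1) * (5 * U))"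
    if s1: "?base s1 \<and> s1 v_S = S * E ^ m \<and> s1 v_den = int N * R ^ m" for s1
  proof (rule simulates_mono[OF simulates_p_power[where l="n - 1"]])
    show "\<bar>s1 v_den * s1 v_D ^ i\<bar> \<le> 2 ^ \<beta>" if "i \<le> n - 1" for i using Db[of m i] that by (simp add: s1)
    show "ival \<rho> (Sub (var 0) (Num 1)) s1 = int (n - 1)" using n1 by (simp add: s1 of_nat_diff)
    have "n - 1 \<le> 2 ^ \<beta>" using param_bounds(1) by linarith
    then show "int (n - 1) \<le> 2 ^ \<beta>" by (simp del: of_nat_diff)
    show "(n - 1 + 1) * (5 * U) \<le> (n + 1) * (5 * U)" by (intro mult_right_mono) auto
    fix s assume s: "same {v_den, v_w} s1 s \<and> s v_den = s1 v_den * s1 v_D ^ (n - 1)"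
    show "s v_S = S * E ^ m \<and> s v_den = int N * R ^ m * D ^ (n - 1)"
      using s sameD[OF conjunct1[OF s], of v_S] by (simp add: s1)
  qed simp_all
  have 4: "sim (Seq (Assign (Num 0) (var v_S)) (Assign (Num 1) (var v_den))) s (return_pmf ())
     (\<lambda>s _. s 0 = S * E ^ m \<and> s 1 = int N * R ^ m * D ^ (n - 1)) (1 + U + U)"
    if s: "s v_S = S * E ^ m \<and> s v_den = int N * R ^ m * D ^ (n - 1)" for s
    apply (rule simulates_set_seq[where z="S * E ^ m"], (simp add: s Sb; fail)+)
    apply (rule simulates_assign)
    using Db[of m "n - 1"] by (simp_all add: s)
  have "sim p_final s0 (return_pmf ()) (\<lambda>s _. s 0 = S * E ^ m \<and> s 1 = int N * R ^ m * D ^ (n - 1))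
    (1 + U + (1 + (m + 1) * (5 * U) + (1 + (m + 1) * (5 * U) + (1 + (n + 1) * (5 * U) + (1 + U + U)))))"
    unfolding p_final_def
    apply (rule simulates_set_seq[where z="int N"], (simp add: p; fail)+)
    by (rule simulates_seq_det[OF 1 simulates_seq_det[OF 2 simulates_seq_det[OF 3 4]]])
  then show ?thesis by (rule simulates_weaken) (use U2 in \<open>simp add: algebra_simps\<close>)
qed

lemma simulates_p_main:
  assumes ok: "has_input s0" "s0 2 = int pn" "s0 3 = int qn"
  shows "sim (p_main K) s0 samples (\<lambda>s S. outcome s = estimate S)
    ((N + 1) * (m + 1) * (n + m + B + 2) * (200 * U))"
proof -
  have Nb: "int N * 2 ^ (3 * B * n) \<le> 2 ^ \<beta>"
  proof -
    have "int N * 2 ^ (3 * B * n) \<le> 2 ^ N * 2 ^ (3 * B * n)" using N_pow by (intro mult_right_mono) auto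
    also have "\<dots> = 2 ^ (3 * B * n + N)" by (simp add: power_add)
    also have "\<dots> \<le> 2 ^ \<beta>" using weight_bound_beta by (intro power_increasing) auto
    finally show ?thesis .
  qed
  let ?V = "insert v_j sample_vars"
  let ?T1 = "(m + 1) * (n + B + 2) * (60 * U)"
  have 1: "sim (For v_j (var v_N) p_sample) s1 samples
    (\<lambda>s S. params s \<and> s v_S = S \<and> \<bar>S\<bar> \<le> int N * 2 ^ (3 * B * n)) ((N + 1) * (?T1 + 4 * U))"
    if s1: "params s1 \<and> s1 v_S = 0" for s1
    unfolding samples_def
  \<comment> \<open>With \<open>r\<close> rounds to go, N - r samples have been added, each of
    absolute value at most 2 ^ (3 B n).\<close>
  proof (rule simulates_for[where k=N and I="\<lambda>r s S. params s \<and> s v_S = S \<and> \<bar>S\<bar> \<le> (int N - int r) * 2 ^ (3 * B * n)"])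
    show "ival \<rho> (var v_N) s1 = int N" using s1 by (simp add: params_def)
    fix r s S
    assume r: "r < N" and I: "params s \<and> s v_S = S \<and> \<bar>S\<bar> \<le> (int N - int (Suc r)) * 2 ^ (3 * B * n)"
    let ?s = "s(v_j := int r)"
    have S: "\<bar>S\<bar> + 2 ^ (3 * B * n) \<le> (int N - int r) * 2 ^ (3 * B * n)" using I by (simp add: algebra_simps)
    also have "\<dots> \<le> int N * 2 ^ (3 * B * n)" by (intro mult_right_mono) auto
    finally have S': "\<bar>S\<bar> + 2 ^ (3 * B * n) \<le> 2 ^ \<beta>" using Nb by linarith
    have p: "params ?s" using I by simp
    show "sim p_sample ?s (map_pmf (\<lambda>A. S + h A) (random_edges (1 - real_of_int R / 2 ^ B) m))
      (\<lambda>s' S'. (params s' \<and> s' v_S = S' \<and> \<bar>S'\<bar> \<le> (int N - int r) * 2 ^ (3 * B * n)) \<and> s' v_j = int r) ?T1"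
    proof (rule simulates_mono[OF simulates_p_sample[OF p _ S']])
      fix s' S' assume s': "same sample_vars ?s s' \<and> s' v_S = S' \<and> \<bar>S'\<bar> \<le> \<bar>S\<bar> + 2 ^ (3 * B * n)"
      have "params s'" by (rule params_sample[OF p]) (use s' in simp)
      then show "(params s' \<and> s' v_S = S' \<and> \<bar>S'\<bar> \<le> (int N - int r) * 2 ^ (3 * B * n)) \<and> s' v_j = int r"
        using s' S sameD[OF conjunct1[OF s'], of v_j] by simp
    qed (use I in simp_all)
  qed (use s1 in simp_all)
  have 2: "sim p_final s (return_pmf S) (\<lambda>s S. outcome s = estimate S) ((n + m + 1) * (40 * U))"
    if s: "params s \<and> s v_S = S \<and> \<bar>S\<bar> \<le> int N * 2 ^ (3 * B * n)" for s S
    by (rule simulates_return, rule simulates_mono[OF simulates_p_final[where S=S]])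
      (use s in \<open>simp_all add: outcome_def estimate_def\<close>)
  have 3: "sim (Assign (Num v_S) (Num 0)) s (return_pmf ()) (\<lambda>s _. params s \<and> s v_S = 0) U"
    if "params s" for s
    by (rule simulates_assign) (use that in simp_all)
  have "sim (p_main K) s0 (bind_pmf samples return_pmf) (\<lambda>s S. outcome s = estimate S)
    (1 + (B + 1) * (40 * U) + (1 + U + (1 + (N + 1) * (?T1 + 4 * U) + (n + m + 1) * (40 * U))))"
    unfolding p_main_def
    by (rule simulates_seq_det[OF simulates_p_init[OF ok] simulates_seq_det[OF 3 simulates_seq[OF 1 2]]])
  then have "sim (p_main K) s0 samples (\<lambda>s S. outcome s = estimate S)
    (1 + (B + 1) * (40 * U) + (1 + U + (1 + (N + 1) * (?T1 + 4 * U) + (n + m + 1) * (40 * U))))"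
    by (simp only: bind_return_pmf')
  then show ?thesis
  proof (rule simulates_weaken)
    let ?W = "(N + 1) * (m + 1) * (n + m + B + 2) * U"
    have w1: "(B + 1) * U \<le> ?W" "(n + m + 1) * U \<le> ?W" "U \<le> ?W"
      by (auto intro!: mult_right_mono simp: algebra_simps)
    have w2: "(N + 1) * ((m + 1) * (n + B + 2) * U) \<le> ?W" "(N + 1) * U \<le> ?W"
      by (auto simp: algebra_simps)
    have "1 + (B + 1) * (40 * U) + (1 + U + (1 + (N + 1) * (?T1 + 4 * U) + (n + m + 1) * (40 * U)))
      = 3 + 40 * ((B + 1) * U) + U + 60 * ((N + 1) * ((m + 1) * (n + B + 2) * U)) + 4 * ((N + 1) * U) + 40 * ((n + m + 1) * U)"
      by (simp add: algebra_simps)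
    also have "\<dots> \<le> 200 * ?W" using w1 w2 U2 by linarith
    finally show "1 + (B + 1) * (40 * U) + (1 + U + (1 + (N + 1) * (?T1 + 4 * U) + (n + m + 1) * (40 * U)))
      \<le> (N + 1) * (m + 1) * (n + m + B + 2) * (200 * U)" by (simp add: mult_ac)
  qed
qed

section \<open>Polynomial running time and the initial memory\<close>

text \<open>The degree is 2 for the number of samples, 1 for the edges, 1 for the bits and vertices
  handled per edge, and 2 for the cost of a command; \<open>K\<close> enters the constant
  only.\<close>

lemma time_le:
  "(N + 1) * (m + 1) * (n + m + B + 2) * (200 * U) \<le>
    (600 * 5 * (K + 5) * 200 * 1000 * (4 * K + 700)) * (n + m + k + bit_length (int pn) + bit_length (int qn)) ^ 6"
proof -
  define Z where "Z = n + m + k + bit_length (int pn) + bit_length (int qn)"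
  have Z: "Z \<ge> 1" "m + 1 \<le> 5 * Z" "n + m + 2 \<le> 5 * Z" "k \<le> Z" "n + m + k \<le> Z" "n + m \<le> Z"
    using n1 k by (auto simp: Z_def)
  have "k * k \<le> Z * Z" using Z by (intro mult_mono) auto
  then have N: "N \<le> 512 * Z ^ 2" by (simp add: N_def power2_eq_square)
  have Z2: "1 \<le> Z ^ 2" "Z \<le> Z ^ 2" using Z(1) by (auto simp: self_le_power)
  have B: "B \<le> K * Z" unfolding B_def using Z by (intro mult_left_mono) auto
  have "4 * B * (n + m) \<le> 4 * (K * Z) * Z" using B Z by (intro mult_mono) auto
  then have "4 * B * (n + m) \<le> 4 * K * Z ^ 2" by (simp add: power2_eq_square)
  moreover have "bit_length (int pn) + bit_length (int qn) \<le> Z" by (simp add: Z_def)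
  ultimately have "\<beta> + 2 \<le> (4 * K + 700) * Z ^ 2"
    using N Z2 unfolding \<beta>_def distrib_right by linarith
  then have U: "U \<le> 1000 * ((4 * K + 700) * Z ^ 2)" unfolding unit_cost_def by (intro mult_left_mono) auto
  have "(N + 1) * (m + 1) * (n + m + B + 2) * (200 * U)
    \<le> (600 * Z ^ 2) * (5 * Z) * ((K + 5) * Z) * (200 * (1000 * ((4 * K + 700) * Z ^ 2)))"
  proof (intro mult_mono)
    show "N + 1 \<le> 600 * Z ^ 2" using N Z2 by linarith
    show "n + m + B + 2 \<le> (K + 5) * Z" using B Z unfolding distrib_right by linarith
  qed (use Z U in auto)
  also have "\<dots> = (600 * 5 * (K + 5) * 200 * 1000 * (4 * K + 700)) * (Z ^ 2 * Z * Z * Z ^ 2)"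
    by (simp only: mult_ac)
  also have "Z ^ 2 * Z * Z * Z ^ 2 = Z ^ 6"
    by (simp add: power2_eq_square power_numeral_reduce mult_ac)
  finally show ?thesis unfolding Z_def .
qed

lemma input_mem_has_input:
  "has_input (input_mem G pn qn)" "input_mem G pn qn 2 = int pn" "input_mem G pn qn 3 = int qn"
proof -
  let ?s = "input_mem G pn qn"
  have "?s (4 + 2 * int i) = int (fst (edges G ! i))" "?s (5 + 2 * int i) = int (snd (edges G ! i))" if "i < m" for i
  proof -
    have i: "i < length (edges G)" using that by (simp add: m_def)
    have *: "nat (4 + 2 * int i) = Suc (Suc (Suc (Suc (2 * i))))"
      "nat (5 + 2 * int i) = Suc (Suc (Suc (Suc (Suc (2 * i)))))" by auto
    show "?s (4 + 2 * int i) = int (fst (edges G ! i))" "?s (5 + 2 * int i) = int (snd (edges G ! i))"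
      using i by (simp_all add: input_mem_def Let_def * length_concat_pairs nth_concat_pairs)
  qed
  then show "has_input ?s" by (simp add: has_input_def input_mem_def Let_def n_def m_def)
  show "?s 2 = int pn" "?s 3 = int qn"
    by (simp_all add: input_mem_def Let_def numeral_2_eq_2 numeral_3_eq_3)
qed

lemma input_mem_bounded: "bounded_mem \<beta> (input_mem G pn qn)"
proof -
  let ?ws = "[nverts G, length (edges G), pn, qn] @ concat (map (\<lambda>(u, v). [u, v]) (edges G))"
  have pq: "i \<le> 2 ^ \<beta>" if "bit_length (int i) \<le> \<beta>" "i > 0" for i
  proof -
    have "i < 2 ^ floorlog 2 i" using floorlog_bounds[of i 2] that(2) by simp
    also have "(2::nat) ^ floorlog 2 i \<le> 2 ^ \<beta>" using that(1) by (intro power_increasing) (simp_all add: bit_length_def)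
    finally show ?thesis by simp
  qed
  have "w \<le> 2 ^ \<beta>" if "w \<in> set ?ws" for w
  proof -
    have ends: "u \<le> 2 ^ \<beta>" "v \<le> 2 ^ \<beta>" if "(u, v) \<in> set (edges G)" for u v
    proof -
      have "(u, v) \<in> verts G \<times> verts G" using wf that by (auto simp: wf_multigraph_def)
      then have "u < n" "v < n" by (auto simp: verts_def n_def)
      then show "u \<le> 2 ^ \<beta>" "v \<le> 2 ^ \<beta>" using param_bounds(1) by linarith+
    qed
    have "bit_length (int pn) \<le> \<beta>" "bit_length (int qn) \<le> \<beta>" by (simp_all add: \<beta>_def)
    then have "pn \<le> 2 ^ \<beta>" "qn \<le> 2 ^ \<beta>" using pn qn by (auto intro!: pq)
    then show ?thesis using that ends param_bounds(1,2) by (auto simp: n_def m_def)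
  qed
  then have w: "?ws ! i \<le> 2 ^ \<beta>" if "i < length ?ws" for i using that nth_mem by blast
  have "\<bar>if 0 \<le> c \<and> nat c < length ?ws then int (?ws ! nat c) else 0\<bar> \<le> 2 ^ \<beta>" for c
    using w[of "nat c"] by (simp del: append.simps)
  then show ?thesis unfolding bounded_mem_def input_mem_def Let_def by blast
qed

end

theorem theorem6p2:
  shows "\<exists>c :: real \<Rightarrow> real \<Rightarrow> nat \<Rightarrow> real.
    (\<forall>y0>1. (\<lambda>(x, y, n). c x y n)
       \<in> O[principal {(x, y, n). y \<ge> y0 \<and> n \<ge> 1}](
           \<lambda>(x, y, n). y * ln (real n * (1 + \<bar>x\<bar>) * y))) \<and>
    (\<forall>y>1. \<forall>x.
       has_fpras (\<lambda>i. if i = 0 then x else y)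
         {G. wf_multigraph G \<and>
             ereal (c x y (nverts G)) < ereal_of_enat (edge_connectivity G)}
         (\<lambda>G. tutte G x y))"
proof (intro exI[of _ conn_bound] conjI allI impI)
  show "(\<lambda>(x, y, n). conn_bound x y n) \<in> O[principal {(x, y, n). y \<ge> y0 \<and> n \<ge> 1}](
           \<lambda>(x, y, n). y * ln (real n * (1 + \<bar>x\<bar>) * y))" if "y0 > 1" for y0
    using that by (rule conn_bound_bigo)
  fix y x :: real assume y: "y > 1"
  \<comment> \<open>\<open>K\<close> depends on x and y alone, so one program and one constant serve
    all graphs and all error bounds.\<close>
  obtain K where K: "precise x y K" using precise_exists by blast
  define C where "C = 600 * 5 * (K + 5) * 200 * 1000 * (4 * K + 700)"
  let ?\<rho> = "\<lambda>i::nat. if i = 0 then x else y"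
  show "has_fpras ?\<rho> {G. wf_multigraph G \<and> ereal (conn_bound x y (nverts G)) < ereal_of_enat (edge_connectivity G)}
         (\<lambda>G. tutte G x y)"
    unfolding has_fpras_def is_fpras_def Let_def
  \<comment> \<open>The degree is that of \<open>time_le\<close>, whose size measure contains k
    \<le> 1 / \<epsilon> + 1 in place of 1 / \<epsilon>; it is at most 3 times the input size plus 1
    / \<epsilon>, whence \<open>3 ^ 6\<close>.\<close>
  proof (rule exI[of _ "p_main K"], rule exI[of _ "C * 3 ^ 6"], rule exI[of _ 6], intro ballI allI impI)
    fix G pn qn
    assume "G \<in> {G. wf_multigraph G \<and> ereal (conn_bound x y (nverts G)) < ereal_of_enat (edge_connectivity G)}"
      and pq: "(0::nat) < pn" "(0::nat) < qn"
    then interpret tutte_program G x y K "qn div pn + 1" pn qn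
      using y K by unfold_locales auto
    let ?k = "qn div pn + 1"
    let ?\<epsilon> = "real pn / real qn"
    let ?w = "real (input_size G pn qn) + 1 / ?\<epsilon>"
    have rho: "?\<rho> = \<rho>" by (simp add: \<rho>_def)
    have b10: "\<beta> \<ge> 1" unfolding \<beta>_def by linarith
    note run = simulates_weaken[OF simulates_p_main[OF input_mem_has_input] time_le]
    note res = simulatesD[OF run b10 input_mem_bounded, folded rho]
    have kq: "real ?k \<le> 1 / ?\<epsilon> + 1" "1 / ?\<epsilon> \<le> real ?k"
    proof -
      have f: "real (qn div pn) = of_int \<lfloor>real qn / real pn\<rfloor>" by (simp add: floor_divide_of_nat_eq)
      have "real (qn div pn) \<le> real qn / real pn" "real qn / real pn \<le> real (qn div pn) + 1"
        unfolding f by linarith+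
      then show "real ?k \<le> 1 / ?\<epsilon> + 1" "1 / ?\<epsilon> \<le> real ?k" by simp_all
    qed
    have "real (n + m + ?k + bit_length (int pn) + bit_length (int qn)) \<le> 3 * ?w"
      using kq(1) n1 pq by (simp add: input_size_def n_def m_def)
    then have "real (n + m + ?k + bit_length (int pn) + bit_length (int qn)) ^ 6 \<le> (3 * ?w) ^ 6"
      by (rule power_mono) simp
    then have "real (C * (n + m + ?k + bit_length (int pn) + bit_length (int qn)) ^ 6) \<le> real C * (3 * ?w) ^ 6"
      by (simp add: mult_left_mono)
    then have time: "real (C * (n + m + ?k + bit_length (int pn) + bit_length (int qn)) ^ 6) \<le> real (C * 3 ^ 6) * ?w ^ 6"
      by (simp only: power_mult_distrib[of 3] of_nat_mult[of C] of_nat_power of_nat_numeral mult.assoc)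
    have T: "real t \<le> real (C * 3 ^ 6) * ?w ^ 6"
      if "(s, t) \<in> set_spmf (exec ?\<rho> (p_main K) (input_mem G pn qn))" for s t
    proof -
      have "t \<le> C * (n + m + ?k + bit_length (int pn) + bit_length (int qn)) ^ 6"
        unfolding C_def by (rule res(2)[OF that])
      then have "real t \<le> real (C * (n + m + ?k + bit_length (int pn) + bit_length (int qn)) ^ 6)"
        by (rule of_nat_mono)
      then show ?thesis using time by linarith
    qed
    have k_eps: "1 / real ?k \<le> ?\<epsilon>" using kq(2) pq by (simp add: field_simps)
    have "3 / 4 \<le> measure_pmf.prob samples {S. \<bar>estimate S - tutte G x y\<bar> \<le> \<bar>tutte G x y\<bar> / real ?k}"
      by (rule prob_good)
    also have "\<dots> \<le> measure (measure_spmf (exec ?\<rho> (p_main K) (input_mem G pn qn)))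
       {(s, t). s \<in> {s. \<bar>outcome s - tutte G x y\<bar> \<le> ?\<epsilon> * \<bar>tutte G x y\<bar>}}"
    proof (rule res(3))
      fix s' S assume S: "outcome s' = estimate S" "S \<in> {S. \<bar>estimate S - tutte G x y\<bar> \<le> \<bar>tutte G x y\<bar> / real ?k}"
      have "\<bar>tutte G x y\<bar> / real ?k \<le> ?\<epsilon> * \<bar>tutte G x y\<bar>"
        using mult_right_mono[OF k_eps, of "\<bar>tutte G x y\<bar>"] by simp
      then show "s' \<in> {s. \<bar>outcome s - tutte G x y\<bar> \<le> ?\<epsilon> * \<bar>tutte G x y\<bar>}" using S by simp
    qed
    finally have P: "3 / 4 \<le> measure (measure_spmf (exec ?\<rho> (p_main K) (input_mem G pn qn)))
       {(s, t). \<bar>outcome s - tutte G x y\<bar> \<le> ?\<epsilon> * \<bar>tutte G x y\<bar>}" by simp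
    show "lossless_spmf (exec ?\<rho> (p_main K) (input_mem G pn qn)) \<and>
       (\<forall>(s, t)\<in>set_spmf (exec ?\<rho> (p_main K) (input_mem G pn qn)). real t \<le> real (C * 3 ^ 6) * ?w ^ 6) \<and>
       3 / 4 \<le> measure (measure_spmf (exec ?\<rho> (p_main K) (input_mem G pn qn)))
          {(s, t). \<bar>outcome s - tutte G x y\<bar> \<le> ?\<epsilon> * \<bar>tutte G x y\<bar>}"
      using res(1) T P by auto
  qed
qed

end
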